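(* For every integer $n\ge 0$, let $\Sigma_n$ be a closed, oriented, connected surface of genus $n$. Then $\Sigma_n\times S^1$ is a $\pi_1$-surjective branched double covering of $\#_n(S^2\times S^1)$; that is, there exists a branched double covering $\Sigma_n\times S^1\to\#_n(S^2\times S^1)$ that induces a surjection on fundamental groups.
   Context: $\#_n(S^2\times S^1)$ denotes the connected sum of $n$ copies of $S^2\times S^1$; by convention the empty connected sum ($n=0$) is $S^3$. A branched double covering $X\to Y$ of closed oriented three-manifolds is a continuous map that restricts to a two-sheeted covering over the complement of a closed one-dimensional submanifold (the branch locus) of $Y$ and that, near each point lying over the branch locus, is modelled in suitable local coordinates on $\mathbb{C}\times\mathbb{R}\to\mathbb{C}\times\mathbb{R}$, $(z,t)\mapsto(z^2,t)$. A map is $\pi_1$-surjective if it induces a surjection on fundamental groups. *)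

theory Defs
  imports "HOL-Analysis.Analysis"
begin

section \<open>Attaching one space to another\<close>

text \<open>
  The adjunction space of \<open>X\<close> and \<open>Y\<close> along \<open>g : A \<rightarrow> X\<close>, where \<open>A \<subseteq> Y\<close>: the quotient of the
  disjoint union of \<open>X\<close> and \<open>Y\<close> in which every \<open>a \<in> A\<close> is identified with \<open>g a\<close>. Each class is
  represented by its point in \<open>X\<close> if it has one, and by its only point (of \<open>Y - A\<close>) otherwise;
  \<open>Inl\<close> and \<open>attach A g\<close> are the two halves of the quotient map. The definition is meant for
  \<open>g ` A \<subseteq> topspace X\<close>.
\<close>

definition attach :: "'b set \<Rightarrow> ('b \<Rightarrow> 'a) \<Rightarrow> 'b \<Rightarrow> 'a + 'b" where
  "attach A g y = (if y \<in> A then Inl (g y) else Inr y)"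

definition adjunction_space ::
    "'a topology \<Rightarrow> 'b topology \<Rightarrow> 'b set \<Rightarrow> ('b \<Rightarrow> 'a) \<Rightarrow> ('a + 'b) topology" where
  "adjunction_space X Y A g = topology (\<lambda>U.
     U \<subseteq> Inl ` topspace X \<union> Inr ` (topspace Y - A) \<and>
     openin X {x \<in> topspace X. Inl x \<in> U} \<and>
     openin Y {y \<in> topspace Y. attach A g y \<in> U})"

lemma istopology_adjunction_space:
  "istopology (\<lambda>U. U \<subseteq> Inl ` topspace X \<union> Inr ` (topspace Y - A) \<and>
     openin X {x \<in> topspace X. Inl x \<in> U} \<and>
     openin Y {y \<in> topspace Y. attach A g y \<in> U})"
proof -
  have int: "{x \<in> T. h x \<in> U \<inter> V} = {x \<in> T. h x \<in> U} \<inter> {x \<in> T. h x \<in> V}"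
    for T :: "'c set" and h :: "'c \<Rightarrow> 'a + 'b" and U V by auto
  have un: "{x \<in> T. h x \<in> \<Union>K} = (\<Union>U\<in>K. {x \<in> T. h x \<in> U})"
    for T :: "'c set" and h :: "'c \<Rightarrow> 'a + 'b" and K by auto
  show ?thesis
    unfolding istopology_def int un by blast
qed

lemma openin_adjunction_space:
  "openin (adjunction_space X Y A g) U \<longleftrightarrow>
     U \<subseteq> Inl ` topspace X \<union> Inr ` (topspace Y - A) \<and>
     openin X {x \<in> topspace X. Inl x \<in> U} \<and>
     openin Y {y \<in> topspace Y. attach A g y \<in> U}"
  by (simp add: adjunction_space_def istopology_adjunction_space)

lemma topspace_adjunction_space:
  assumes "g ` (topspace Y \<inter> A) \<subseteq> topspace X"
  shows "topspace (adjunction_space X Y A g) = Inl ` topspace X \<union> Inr ` (topspace Y - A)"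
    (is "_ = ?C")
proof -
  have "{x \<in> topspace X. Inl x \<in> ?C} = topspace X" by auto
  moreover have "{y \<in> topspace Y. attach A g y \<in> ?C} = topspace Y"
    using assms by (auto simp: attach_def)
  ultimately have "openin (adjunction_space X Y A g) ?C"
    by (simp add: openin_adjunction_space)
  then have "?C \<subseteq> topspace (adjunction_space X Y A g)"
    by (rule openin_subset)
  moreover have "topspace (adjunction_space X Y A g) \<subseteq> ?C"
    using openin_topspace[of "adjunction_space X Y A g"] unfolding openin_adjunction_space by (rule conjunct1)
  ultimately show ?thesis by (rule subset_antisym[rotated])
qed

section \<open>Connected sums of copies of a manifold\<close>

text \<open>
  For a Euclidean space \<open>'v\<close> of dimension \<open>d\<close>, the unit sphere of \<open>'v \<times> real\<close> is the \<open>d\<close>-sphere.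
\<close>

definition inverse_stereographic :: "'v::euclidean_space \<Rightarrow> 'v \<times> real" where
  "inverse_stereographic v =
     ((2 / ((norm v)\<^sup>2 + 1)) *\<^sub>R v, ((norm v)\<^sup>2 - 1) / ((norm v)\<^sup>2 + 1))"

lemma norm_inverse_stereographic: "norm (inverse_stereographic v) = 1"
proof -
  define r where "r = (norm v)\<^sup>2"
  have r: "r + 1 > 0" unfolding r_def by (smt (verit) zero_le_power2)
  have "(norm (inverse_stereographic v))\<^sup>2 = (2 / (r + 1))\<^sup>2 * r + ((r - 1) / (r + 1))\<^sup>2"
    by (simp add: inverse_stereographic_def norm_Pair power_mult_distrib r_def power_divide)
  also have "\<dots> = (4 * r + (r - 1)\<^sup>2) / (r + 1)\<^sup>2"
    by (simp add: power_divide add_divide_distrib)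
  also have "4 * r + (r - 1)\<^sup>2 = (r + 1)\<^sup>2"
    by (simp add: power2_eq_square algebra_simps)
  finally show ?thesis using r by (simp add: power2_eq_1_iff)
       (smt (verit) norm_ge_zero)
qed

lemma inj_inverse_stereographic: "inj inverse_stereographic"
proof (rule injI)
  fix v w :: 'a
  define r s where "r = (norm v)\<^sup>2" and "s = (norm w)\<^sup>2"
  have pos: "r + 1 > 0" "s + 1 > 0" unfolding r_def s_def by (smt (verit) zero_le_power2)+
  assume eq: "inverse_stereographic v = inverse_stereographic w"
  then have "(r - 1) / (r + 1) = (s - 1) / (s + 1)"
    by (simp add: inverse_stereographic_def r_def s_def)
  then have "r = s" using pos by (simp add: divide_simps) (simp add: algebra_simps)
  then show "v = w" using eq pos by (simp add: inverse_stereographic_def r_def s_def)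
qed

text \<open>
  The centre of the \<open>i\<close>-th removed ball, seen in the stereographic chart, is \<open>4 * i\<close> times the unit
  vector \<open>b\<close>; the radius is 1, so that the balls are pairwise disjoint.
\<close>

definition sphere_ball :: "'v::euclidean_space \<Rightarrow> nat \<Rightarrow> 'v \<Rightarrow> 'v \<times> real" where
  "sphere_ball b i x = inverse_stereographic ((4 * real i) *\<^sub>R b + x)"

lemma disjoint_sphere_balls:
  assumes "norm b = 1" "i \<noteq> j"
  shows "sphere_ball b i ` cball 0 1 \<inter> sphere_ball b j ` cball 0 1 = {}"
proof -
  have *: False if eq: "sphere_ball b i x = sphere_ball b j y" and le: "norm x \<le> 1" "norm y \<le> 1" for x y
  proof -
    have "(4 * real i) *\<^sub>R b + x = (4 * real j) *\<^sub>R b + y"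
      using eq unfolding sphere_ball_def inj_eq[OF inj_inverse_stereographic] .
    then have "(4 * real i - 4 * real j) *\<^sub>R b = y - x"
      by (simp add: algebra_simps)
    then have "\<bar>4 * real i - 4 * real j\<bar> * norm b = norm (y - x)"
      unfolding norm_scaleR[symmetric] by (rule arg_cong)
    then have "\<bar>4 * real i - 4 * real j\<bar> = norm (y - x)"
      unfolding assms(1) by simp
    also have "\<dots> \<le> 2"
      using norm_triangle_ineq4[of y x] le by linarith
    finally show False using assms(2) by linarith
  qed
  show ?thesis
  proof (rule equals0I)
    fix p assume "p \<in> sphere_ball b i ` cball 0 1 \<inter> sphere_ball b j ` cball 0 1"
    then obtain x y where "p = sphere_ball b i x" "p = sphere_ball b j y" "x \<in> cball 0 1" "y \<in> cball 0 1"
      by (elim IntE imageE)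
    then show False using *[of x y] by simp
  qed
qed

text \<open>
  The connected sum \<open>M # \<dots> # M\<close> of \<open>n\<close> copies of a closed connected \<open>d\<close>-manifold \<open>M\<close>. The sphere
  being neutral for the connected sum, all \<open>n\<close> sums are performed at once on \<open>S\<^sup>d # M # \<dots> # M\<close>: remove
  \<open>n\<close> disjoint open balls from the sphere, remove from each copy of \<open>M\<close> the image of the open unit
  ball under the chart \<open>e\<close> (injective on a neighbourhood of the closed ball), and glue the
  \<open>i\<close>-th copy along the boundary spheres by \<open>e x \<sim> sphere_ball b i x\<close>, \<open>norm x = 1\<close>. For \<open>n = 0\<close> this
  is \<open>S\<^sup>d\<close>.

  No orientation is recorded. For the two manifolds used below the choice of gluing (orientation
  preserving or reversing) does not matter: the punctured \<open>M\<close> has a self-homeomorphism that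
  reverses the boundary sphere.
\<close>

definition connected_sum_copies ::
    "'v::euclidean_space \<Rightarrow> 'm topology \<Rightarrow> ('v \<Rightarrow> 'm) \<Rightarrow> nat \<Rightarrow> ('v \<times> real + nat \<times> 'm) topology" where
  "connected_sum_copies b M e n =
     adjunction_space
       (top_of_set (sphere 0 1 - (\<Union>i<n. sphere_ball b i ` ball 0 1)))
       (sum_topology (\<lambda>i. subtopology M (topspace M - e ` ball 0 1)) {..<n})
       ({..<n} \<times> e ` sphere 0 1)
       (\<lambda>(i, y). sphere_ball b i (inv_into (sphere 0 1) e y))"

lemma connected_sum_copies_0:
  fixes b :: "'v::euclidean_space"
  shows "connected_sum_copies b M e 0 homeomorphic_space top_of_set (sphere (0 :: 'v \<times> real) 1)"
proof -
  let ?S = "top_of_set (sphere (0 :: 'v \<times> real) 1)"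
  let ?Z = "connected_sum_copies b M e 0"
  have op: "openin ?Z U \<longleftrightarrow> U \<subseteq> Inl ` topspace ?S \<and> openin ?S {x \<in> topspace ?S. Inl x \<in> U}" for U
    by (simp add: connected_sum_copies_def openin_adjunction_space)
  have top: "topspace ?Z = Inl ` topspace ?S"
    unfolding connected_sum_copies_def
    by (subst topspace_adjunction_space) auto
  have "homeomorphic_map ?S ?Z Inl"
    unfolding homeomorphic_eq_everything_map
  proof (intro conjI)
    show "continuous_map ?S ?Z Inl"
      by (auto simp: continuous_map_def top op)
    show "open_map ?S ?Z Inl"
      unfolding open_map_def
    proof (intro allI impI)
      fix U assume U: "openin ?S U"
      have sub: "U \<subseteq> topspace ?S"
        using U by (rule openin_subset)
      then have "{x \<in> topspace ?S. Inl x \<in> Inl ` U} = U"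
        by (blast dest: Inl_inject)
      then have "openin ?S {x \<in> topspace ?S. Inl x \<in> Inl ` U}"
        using U by (rule ssubst)
      then show "openin ?Z (Inl ` U)"
        unfolding op using image_mono[OF sub] by (rule conjI[rotated])
    qed
    show "closed_map ?S ?Z Inl"
      unfolding closed_map_def
    proof (intro allI impI)
      fix U assume U: "closedin ?S U"
      have "topspace ?Z - Inl ` U = Inl ` (topspace ?S - U)"
        unfolding top by auto
      moreover have "openin ?Z (Inl ` (topspace ?S - U))"
        using \<open>open_map ?S ?Z Inl\<close> U unfolding open_map_def closedin_def by blast
      ultimately have "openin ?Z (topspace ?Z - Inl ` U)"
        by (rule ssubst)
      moreover have "Inl ` U \<subseteq> topspace ?Z"
        unfolding top using closedin_subset[OF U] by (rule image_mono)
      ultimately show "closedin ?Z (Inl ` U)"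
        unfolding closedin_def by (rule conjI[rotated])
    qed
  qed (auto simp: top)
  then show ?thesis
    using homeomorphic_map_imp_homeomorphic_space homeomorphic_space_sym by blast
qed

abbreviation circle :: "complex topology" where
  "circle \<equiv> top_of_set (sphere 0 1)"

definition torus_chart :: "complex \<Rightarrow> complex \<times> complex" where
  "torus_chart z = (cis (Re z), cis (Im z))"

lemma inj_on_cis: "inj_on cis {-2..2}"
proof (rule inj_onI)
  fix s t :: real
  assume st: "s \<in> {-2..2}" "t \<in> {-2..2}" and eq: "cis s = cis t"
  have "2 < pi" using pi_gt3 by linarith
  then have "s \<in> {-pi<..pi}" "t \<in> {-pi<..pi}" using st by auto
  then have "Arg (cis s) = s" "Arg (cis t) = t"
    using Arg_cis by blast+
  then show "s = t" unfolding eq by (rule subst)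
qed

lemma inj_on_torus_chart: "inj_on torus_chart (cball 0 2)"
proof (rule inj_onI)
  fix z w
  assume "z \<in> cball 0 2" "w \<in> cball 0 2" and eq: "torus_chart z = torus_chart w"
  then have "norm z \<le> 2" "norm w \<le> 2" by auto
  then have "Re z \<in> {-2..2}" "Re w \<in> {-2..2}" "Im z \<in> {-2..2}" "Im w \<in> {-2..2}"
    using abs_Re_le_cmod[of z] abs_Re_le_cmod[of w] abs_Im_le_cmod[of z] abs_Im_le_cmod[of w] by auto
  then show "z = w"
    using eq inj_on_eq_iff[OF inj_on_cis] by (simp add: torus_chart_def complex_eq_iff[of z w])
qed

text \<open>
  A closed oriented connected surface has genus \<open>n\<close> if it is a sphere with \<open>n\<close> handles, that is,
  homeomorphic to the connected sum of \<open>n\<close> tori.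
\<close>

definition closed_surface_of_genus :: "nat \<Rightarrow> 'a topology \<Rightarrow> bool" where
  "closed_surface_of_genus n S \<longleftrightarrow>
     S homeomorphic_space connected_sum_copies 1 (prod_topology circle circle) torus_chart n"

definition S2xS1_chart :: "complex \<times> real \<Rightarrow> (complex \<times> real) \<times> complex" where
  "S2xS1_chart p = (inverse_stereographic (fst p), cis (snd p))"

lemma inj_on_S2xS1_chart: "inj_on S2xS1_chart (cball 0 2)"
proof (rule inj_onI)
  fix p q
  assume "p \<in> cball 0 2" "q \<in> cball 0 2" and eq: "S2xS1_chart p = S2xS1_chart q"
  then have "norm p \<le> 2" "norm q \<le> 2" by auto
  then have "snd p \<in> {-2..2}" "snd q \<in> {-2..2}"
    using norm_snd_le[of "snd p" "fst p"] norm_snd_le[of "snd q" "fst q"] by auto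
  moreover have "fst p = fst q"
    using eq by (simp add: S2xS1_chart_def inj_eq[OF inj_inverse_stereographic])
  ultimately show "p = q"
    using eq inj_on_eq_iff[OF inj_on_cis] by (simp add: S2xS1_chart_def prod_eq_iff)
qed

definition connected_sum_S2xS1 ::
    "nat \<Rightarrow> ((complex \<times> real) \<times> real + nat \<times> (complex \<times> real) \<times> complex) topology" where
  "connected_sum_S2xS1 n =
     connected_sum_copies (0, 1) (prod_topology (top_of_set (sphere 0 1)) circle) S2xS1_chart n"

section \<open>Branched double coverings\<close>

text \<open>The library's \<^const>\<open>covering_space\<close>, for abstract topologies and with two sheets.\<close>

definition two_sheeted_covering :: "'a topology \<Rightarrow> 'b topology \<Rightarrow> ('a \<Rightarrow> 'b) \<Rightarrow> bool" where
  "two_sheeted_covering X Y f \<longleftrightarrow>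
     continuous_map X Y f \<and>
     (\<forall>y \<in> topspace Y. \<exists>V. openin Y V \<and> y \<in> V \<and>
        (\<exists>\<U>. card \<U> = 2 \<and> disjoint \<U> \<and> \<Union>\<U> = {x \<in> topspace X. f x \<in> V} \<and>
             (\<forall>U \<in> \<U>. openin X U \<and> homeomorphic_map (subtopology X U) (subtopology Y V) f)))"

definition local_coordinates :: "'a topology \<Rightarrow> 'a set \<Rightarrow> ('a \<Rightarrow> complex \<times> real) \<Rightarrow> bool" where
  "local_coordinates X U \<phi> \<longleftrightarrow>
     openin X U \<and> open (\<phi> ` U) \<and> homeomorphic_map (subtopology X U) (top_of_set (\<phi> ` U)) \<phi>"

definition closed_one_submanifold :: "'a topology \<Rightarrow> 'a set \<Rightarrow> bool" where
  "closed_one_submanifold Y B \<longleftrightarrow>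
     closedin Y B \<and> compactin Y B \<and>
     (\<forall>y \<in> B. \<exists>V \<psi>. y \<in> V \<and> local_coordinates Y V \<psi> \<and> B \<inter> V = {v \<in> V. fst (\<psi> v) = 0})"

text \<open>
  In the local model \<open>(z, t) \<mapsto> (z\<^sup>2, t)\<close> the branch locus is \<open>z = 0\<close>; the clause on \<open>B \<inter> V\<close> says this and
  in particular forces \<open>x\<close> itself to lie on \<open>z = 0\<close>.
\<close>

definition branched_double_covering :: "'a topology \<Rightarrow> 'b topology \<Rightarrow> ('a \<Rightarrow> 'b) \<Rightarrow> bool" where
  "branched_double_covering X Y f \<longleftrightarrow>
     continuous_map X Y f \<and>
     (\<exists>B. closed_one_submanifold Y B \<and>
        two_sheeted_covering (subtopology X {x \<in> topspace X. f x \<notin> B})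
                             (subtopology Y (topspace Y - B)) f \<and>
        (\<forall>x \<in> topspace X. f x \<in> B \<longrightarrow>
           (\<exists>U V \<phi> \<psi>. x \<in> U \<and> f ` U \<subseteq> V \<and> local_coordinates X U \<phi> \<and> local_coordinates Y V \<psi> \<and>
              B \<inter> V = {v \<in> V. fst (\<psi> v) = 0} \<and>
              (\<forall>u \<in> U. \<psi> (f u) = ((fst (\<phi> u))\<^sup>2, snd (\<phi> u))))))"

section \<open>Surjectivity on fundamental groups\<close>

definition loops_at :: "'a topology \<Rightarrow> 'a \<Rightarrow> (real \<Rightarrow> 'a) set" where
  "loops_at X x = {g. pathin X g \<and> g 0 = x \<and> g 1 = x}"

definition loop_homotopy :: "'a topology \<Rightarrow> 'a \<Rightarrow> ((real \<Rightarrow> 'a) \<times> (real \<Rightarrow> 'a)) set" where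
  "loop_homotopy X x =
     {(g, h). g \<in> loops_at X x \<and> h \<in> loops_at X x \<and>
        homotopic_with (\<lambda>k. k 0 = x \<and> k 1 = x) (top_of_set {0..1}) X g h}"

text \<open>
  The underlying set of the fundamental group; the group operation plays no role in surjectivity.
\<close>

definition pi1 :: "'a topology \<Rightarrow> 'a \<Rightarrow> (real \<Rightarrow> 'a) set set" where
  "pi1 X x = loops_at X x // loop_homotopy X x"

definition pi1_map ::
    "'b topology \<Rightarrow> ('a \<Rightarrow> 'b) \<Rightarrow> 'a \<Rightarrow> (real \<Rightarrow> 'a) set \<Rightarrow> (real \<Rightarrow> 'b) set" where
  "pi1_map Y f x C = loop_homotopy Y (f x) `` ((\<lambda>g. f \<circ> g) ` C)"

definition pi1_surjective :: "'a topology \<Rightarrow> 'b topology \<Rightarrow> ('a \<Rightarrow> 'b) \<Rightarrow> bool" where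
  "pi1_surjective X Y f \<longleftrightarrow>
     (\<forall>x \<in> topspace X. pi1_map Y f x ` pi1 X x = pi1 Y (f x))"

end

theory Submission
  imports Defs "HOL-Complex_Analysis.Conformal_Mappings"
begin

text \<open>
  Let \<open>\<tau>\<close> be the reflection of \<open>\<Sigma>\<^sub>n\<close> whose quotient is a disc with \<open>n\<close> holes. The covering is the
  quotient of \<open>\<Sigma>\<^sub>n \<times> S\<^sup>1\<close> by \<open>\<sigma> = \<tau> \<times> conjugation\<close>, whose fixed points are \<open>2(n + 1)\<close> circles: near them
  \<open>\<sigma>\<close> is \<open>(z, t) \<mapsto> (- z, t)\<close>, so \<open>(z\<^sup>2, t)\<close> is a chart of the quotient, and elsewhere \<open>\<sigma>\<close> acts freely.

  To identify the quotient, take \<open>\<tau>\<close> to be complex conjugation on \<open>S\<^sup>2 \<subseteq> \<complex> \<times> \<real>\<close> and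
  \<open>(u, v) \<mapsto> (u, cnj v)\<close> on each torus. The map \<open>(t, w) \<mapsto> (A t Re w) + i t Im w\<close> folds \<open>\<real> \<times> S\<^sup>1\<close> onto
  \<open>\<complex>\<close>, and \<open>(s + i t, w) \<mapsto> (s, fold (t, w))\<close> maps squares times \<open>S\<^sup>1\<close> to cylinders. Doubling a large
  square gives \<open>S\<^sup>2 \<times> S\<^sup>1 \<rightarrow> S\<^sup>3\<close>, and the same folding gives \<open>T\<^sup>2 \<times> S\<^sup>1 \<rightarrow> S\<^sup>2 \<times> S\<^sup>1\<close>. Both have the same
  local form on the squares around the removed discs; after rounding the squares and cylinders to
  discs and balls the two maps restrict to the same folding of the gluing tori onto the gluing spheres.

  For surjectivity on fundamental groups, an odd function \<open>j : \<Sigma>\<^sub>n \<times> S\<^sup>1 \<rightarrow> \<complex>\<close> vanishing only at the fixed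
  points turns the lifting of a path \<open>\<gamma>\<close> into the choice of a continuous square root of \<open>j\<^sup>2 \<circ> \<gamma>\<close>. If
  the lift of a loop from \<open>x\<close> ends at \<open>\<sigma> x\<close>, it is closed by the image under \<open>\<sigma>\<close> of a path \<open>d\<close> from \<open>x\<close>
  to a fixed point, followed by \<open>d\<close> backwards; this addition projects to a null-homotopic loop.
\<close>

section \<open>Quotients by an involution\<close>

text \<open>The target is a fixed adjunction space of round pieces in given charts. Its
  identification with the orbit space is built into the map: each piece gets an explicit continuous
  surjection with exactly the \<open>\<sigma>\<close>-orbits as fibres, and compactness makes it a
  quotient map. The difficulty is agreement on the gluing tori. \<open>fold_plane\<close> treats the
  two coordinates separately, so it carries squares to cylinders, whereas the connected sums are cut
  along round spheres; hence it is conjugated by homeomorphisms of the closed manifolds that move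
  points only in cells of gauge 3/2. This number lies between the radius 1 of the removed balls and
  half of their spacing 4, and below \<open>pi / 2\<close>, up to which the torus map is
  \<open>fold_plane\<close> in the charts. The semiaxis must be positive at \<open>t = 0\<close>,
  where exactly \<open>w\<close> and \<open>cnj w\<close> are to be identified, and equal to
  \<open>\<bar>t\<bar>\<close> from 1 on, so that the image has a round boundary and can be doubled.
  The sign of the odd function \<open>j\<close> tells the two sheets apart, both in the local
  triviality and in the lifting of paths.\<close>

locale involution_quotient =
  fixes X :: "'a topology" and Y :: "'b topology" and f :: "'a \<Rightarrow> 'b"
    and \<sigma> :: "'a \<Rightarrow> 'a" and j :: "'a \<Rightarrow> complex"
  assumes quotient: "quotient_map X Y f"
    and continuous_\<sigma>: "continuous_map X X \<sigma>"
    and \<sigma>_\<sigma>: "x \<in> topspace X \<Longrightarrow> \<sigma> (\<sigma> x) = x"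
    and fibre: "x \<in> topspace X \<Longrightarrow> x' \<in> topspace X \<Longrightarrow> f x = f x' \<longleftrightarrow> x' = x \<or> x' = \<sigma> x"
    and continuous_j: "continuous_map X euclidean j"
    and j_\<sigma>: "x \<in> topspace X \<Longrightarrow> j (\<sigma> x) = - j x"
    and j_eq_0: "x \<in> topspace X \<Longrightarrow> j x = 0 \<Longrightarrow> \<sigma> x = x"
begin

lemma continuous_f: "continuous_map X Y f"
  using quotient by (rule quotient_imp_continuous_map)

lemma \<sigma>_in: "x \<in> topspace X \<Longrightarrow> \<sigma> x \<in> topspace X"
  using continuous_\<sigma> by (auto simp: continuous_map_def)

lemma f_in: "x \<in> topspace X \<Longrightarrow> f x \<in> topspace Y"
  using continuous_f by (auto simp: continuous_map_def)

lemma f_\<sigma>: "x \<in> topspace X \<Longrightarrow> f (\<sigma> x) = f x"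
  using fibre \<sigma>_in by metis

lemma fixed_iff: "x \<in> topspace X \<Longrightarrow> \<sigma> x = x \<longleftrightarrow> j x = 0"
  using j_\<sigma> j_eq_0 by force

lemma image_\<sigma>: "U \<subseteq> topspace X \<Longrightarrow> \<sigma> ` U = {x \<in> topspace X. \<sigma> x \<in> U}"
proof (intro set_eqI iffI)
  fix x assume "U \<subseteq> topspace X" "x \<in> \<sigma> ` U"
  then show "x \<in> {x \<in> topspace X. \<sigma> x \<in> U}" using \<sigma>_in \<sigma>_\<sigma> by auto
next
  fix x assume "U \<subseteq> topspace X" "x \<in> {x \<in> topspace X. \<sigma> x \<in> U}"
  then show "x \<in> \<sigma> ` U" using \<sigma>_\<sigma>[of x] by (metis (mono_tags, lifting) imageI mem_Collect_eq)
qed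

lemma open_image_\<sigma>: "openin X U \<Longrightarrow> openin X (\<sigma> ` U)"
  using image_\<sigma>[OF openin_subset] openin_continuous_map_preimage[OF continuous_\<sigma>] by simp

lemma vimage_image:
  assumes "U \<subseteq> topspace X"
  shows "{x \<in> topspace X. f x \<in> f ` U} = U \<union> \<sigma> ` U"
proof
  show "{x \<in> topspace X. f x \<in> f ` U} \<subseteq> U \<union> \<sigma> ` U"
    using assms fibre by (fastforce simp: image_iff subset_iff)
  show "U \<union> \<sigma> ` U \<subseteq> {x \<in> topspace X. f x \<in> f ` U}"
    using assms \<sigma>_in f_\<sigma> by auto
qed

text \<open>The saturation of an open set is the union of two open sets: itself and its image under
  the homeomorphism \<open>\<sigma>\<close>.\<close>

lemma open_map_f: "open_map X Y f"
  unfolding open_map_def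
proof (intro allI impI)
  fix U assume U: "openin X U"
  then have sub: "U \<subseteq> topspace X" by (rule openin_subset)
  have "openin X {x \<in> topspace X. f x \<in> f ` U}"
    unfolding vimage_image[OF sub] using U open_image_\<sigma> by (simp add: openin_Un)
  moreover have "f ` U \<subseteq> topspace Y" using sub f_in by auto
  ultimately show "openin Y (f ` U)" using quotient unfolding quotient_map_def by simp
qed

definition branch :: "'b set" where
  "branch = f ` {x \<in> topspace X. j x = 0}"

lemma f_in_branch_iff: "x \<in> topspace X \<Longrightarrow> f x \<in> branch \<longleftrightarrow> j x = 0"
proof -
  assume x: "x \<in> topspace X"
  have "j x = 0" if "x' \<in> topspace X" "j x' = 0" "f x = f x'" for x'
    using fibre[of x' x] that x j_\<sigma>[of x'] by auto
  then show ?thesis using x unfolding branch_def by auto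
qed

text \<open>\<open>U\<close> is the preimage under \<open>j\<close> of the open half-plane centred
  on the direction of \<open>j x\<close>; as \<open>j\<close> is odd, \<open>\<sigma>\<close>
  carries \<open>U\<close> into the opposite half-plane. The sign condition stays in the conclusion
  because it decides between the two lifts of a point in \<open>path_lifting\<close>.\<close>

lemma separated_neighbourhood:
  assumes "x \<in> topspace X" "j x \<noteq> 0"
  obtains U where "openin X U" "x \<in> U" "\<And>u. u \<in> U \<Longrightarrow> 0 < Re (j u * cnj (j x))"
    "U \<inter> \<sigma> ` U = {}"
proof -
  define U where "U = {u \<in> topspace X. j u \<in> {z. 0 < Re (z * cnj (j x))}}"
  have "open {z. 0 < Re (z * cnj (j x))}"
    by (intro open_Collect_less continuous_intros)
  then have "openin X U"
    unfolding U_def by (intro openin_continuous_map_preimage[OF continuous_j]) simp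
  moreover have "x \<in> U"
    using assms by (simp add: U_def flip: power2_eq_square cmod_power2)
  moreover have "U \<inter> \<sigma> ` U = {}"
  proof -
    have "\<sigma> u \<notin> U" if "u \<in> U" for u
      using that j_\<sigma> by (auto simp: U_def)
    then show ?thesis by blast
  qed
  ultimately show thesis using that by (auto simp: U_def)
qed

lemma homeomorphic_map_f:
  assumes U: "openin X U" "U \<inter> \<sigma> ` U = {}"
  shows "homeomorphic_map (subtopology X U) (subtopology Y (f ` U)) f"
proof (rule bijective_open_imp_homeomorphic_map)
  have sub: "U \<subseteq> topspace X" using U(1) by (rule openin_subset)
  show "continuous_map (subtopology X U) (subtopology Y (f ` U)) f"
    using continuous_f by (simp add: continuous_map_in_subtopology continuous_map_from_subtopology)
  show "open_map (subtopology X U) (subtopology Y (f ` U)) f"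
    using open_map_f U(1) by (intro open_map_into_subtopology open_map_from_subtopology) auto
  show "f ` topspace (subtopology X U) = topspace (subtopology Y (f ` U))"
    using sub f_in by auto
  show "inj_on f (topspace (subtopology X U))"
  proof (rule inj_onI)
    fix u v assume uv: "u \<in> topspace (subtopology X U)" "v \<in> topspace (subtopology X U)" "f u = f v"
    then have "u \<in> U" "v \<in> U" "v = u \<or> v = \<sigma> u" using fibre by auto
    then show "u = v" using U(2) by blast
  qed
qed

text \<open>Over the image of a separated neighbourhood the sheets are \<open>U\<close> and its
  image under \<open>\<sigma>\<close>; being disjoint and nonempty, they are two.\<close>

lemma two_sheeted:
  "two_sheeted_covering (subtopology X {x \<in> topspace X. f x \<notin> branch})
     (subtopology Y (topspace Y - branch)) f"
  (is "two_sheeted_covering ?X ?Y f")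
  unfolding two_sheeted_covering_def
proof (intro conjI ballI)
  show "continuous_map ?X ?Y f"
    using continuous_f f_in by (auto simp: continuous_map_in_subtopology continuous_map_from_subtopology)
next
  fix y assume "y \<in> topspace ?Y"
  then have y: "y \<in> topspace Y" "y \<notin> branch" by auto
  then obtain x where x: "x \<in> topspace X" "f x = y"
    using quotient_imp_surjective_map[OF quotient] by (metis imageE)
  with y have "j x \<noteq> 0" using f_in_branch_iff by blast
  with x obtain U where U: "openin X U" "x \<in> U" "\<And>u. u \<in> U \<Longrightarrow> 0 < Re (j u * cnj (j x))"
    "U \<inter> \<sigma> ` U = {}"
    using separated_neighbourhood by metis
  have sub: "U \<subseteq> topspace X" using U(1) by (rule openin_subset)
  have sub\<sigma>: "\<sigma> ` U \<subseteq> topspace X" using sub \<sigma>_in by auto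
  have j: "j u \<noteq> 0" if "u \<in> U \<union> \<sigma> ` U" for u
    using that U(3) j_\<sigma> sub by force
  then have off: "f u \<notin> branch" if "u \<in> U \<union> \<sigma> ` U" for u
    using that f_in_branch_iff sub sub\<sigma> by blast
  have f\<sigma>U: "f ` \<sigma> ` U = f ` U"
    using f_\<sigma> sub by (force simp: image_iff)
  have \<sigma>\<sigma>U: "\<sigma> ` \<sigma> ` U = U"
    using \<sigma>_\<sigma> sub by (force simp: image_iff)
  let ?\<U> = "{U, \<sigma> ` U}"
  have "U \<noteq> \<sigma> ` U" using U(2,4) by blast
  then have "card ?\<U> = 2" by simp
  moreover have "disjoint ?\<U>" using U(4) by (auto simp: disjoint_def)
  moreover have "\<Union>?\<U> = {x \<in> topspace ?X. f x \<in> f ` U}"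
    using vimage_image[OF sub] off sub sub\<sigma> by auto
  moreover have "openin ?X W \<and> homeomorphic_map (subtopology ?X W) (subtopology ?Y (f ` U)) f"
    if W: "W \<in> ?\<U>" for W
  proof -
    have "openin X W" "W \<inter> \<sigma> ` W = {}" "f ` W = f ` U" "W \<subseteq> U \<union> \<sigma> ` U"
    proof -
      have cases: "W = U \<or> W = \<sigma> ` U" using W by blast
      then show "openin X W" using U(1) open_image_\<sigma> by metis
      show "W \<inter> \<sigma> ` W = {}" using cases U(4) \<sigma>\<sigma>U by (metis Int_commute)
      show "f ` W = f ` U" using cases f\<sigma>U by metis
      show "W \<subseteq> U \<union> \<sigma> ` U" using cases by blast
    qed
    note W_props = this
    have WX: "W \<subseteq> {x \<in> topspace X. f x \<notin> branch}"
      using W_props(4) off sub sub\<sigma> by blast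
    then have fW: "f ` W \<subseteq> topspace Y - branch" using f_in by blast
    have "openin ?X W"
      unfolding openin_subtopology using W_props(1) WX by blast
    moreover have "subtopology ?X W = subtopology X W"
      using WX by (simp add: subtopology_subtopology Int_absorb1)
    moreover have "subtopology ?Y (f ` U) = subtopology Y (f ` W)"
      using fW W_props(3) by (simp add: subtopology_subtopology Int_absorb1)
    ultimately show ?thesis
      using homeomorphic_map_f[OF W_props(1,2)] by simp
  qed
  moreover have "openin ?Y (f ` U)"
  proof -
    have "openin Y (f ` U)" using open_map_f U(1) by (simp add: open_map_def)
    moreover have "f ` U \<subseteq> topspace Y - branch" using off sub f_in by blast
    ultimately show ?thesis unfolding openin_subtopology by blast
  qed
  ultimately show "\<exists>V. openin ?Y V \<and> y \<in> V \<and> (\<exists>\<U>. card \<U> = 2 \<and> disjoint \<U> \<and>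
      \<Union>\<U> = {x \<in> topspace ?X. f x \<in> V} \<and>
      (\<forall>U\<in>\<U>. openin ?X U \<and> homeomorphic_map (subtopology ?X U) (subtopology ?Y V) f))"
    using U(2) x(2) by (intro exI[of _ "f ` U"] conjI exI[of _ ?\<U>] ballI) auto
qed

end

section \<open>Local charts of the quotient at branch points\<close>

lemma open_map_square: "open U \<Longrightarrow> open ((\<lambda>z::complex. z\<^sup>2) ` U)"
proof (rule open_mapping_thm[of _ UNIV])
  show "\<not> (\<lambda>z::complex. z\<^sup>2) constant_on UNIV"
    unfolding constant_on_def by (metis UNIV_I one_power2 power_zero_numeral zero_neq_one)
qed (auto intro!: holomorphic_intros)

lemma open_branched_model:
  fixes W :: "(complex \<times> real) set"
  assumes "open W"
  shows "open ((\<lambda>p. ((fst p)\<^sup>2, snd p)) ` W)"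
proof (subst open_subopen, intro ballI)
  fix q assume "q \<in> (\<lambda>p. ((fst p)\<^sup>2, snd p)) ` W"
  then obtain p where p: "p \<in> W" "q = ((fst p)\<^sup>2, snd p)" by blast
  with assms obtain A B where AB: "open A" "open B" "p \<in> A \<times> B" "A \<times> B \<subseteq> W"
    by (elim open_prod_elim) auto
  have "open ((\<lambda>z. z\<^sup>2) ` A \<times> B)"
    using AB by (intro open_Times open_map_square)
  moreover have "q \<in> (\<lambda>z. z\<^sup>2) ` A \<times> B"
    using AB p by (auto simp: mem_Times_iff)
  moreover have "(\<lambda>z. z\<^sup>2) ` A \<times> B \<subseteq> (\<lambda>p. ((fst p)\<^sup>2, snd p)) ` W"
    using AB(4) by force
  ultimately show "\<exists>T. open T \<and> q \<in> T \<and> T \<subseteq> (\<lambda>p. ((fst p)\<^sup>2, snd p)) ` W" by blast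
qed

context involution_quotient
begin

text \<open>In these coordinates \<open>\<sigma>\<close> is the half turn about the axis
  \<open>z = 0\<close>. Invariance makes \<open>U\<close> saturated, so that functions of
  \<open>(z^2, t)\<close> descend to its image.\<close>

definition linearising_chart :: "'a set \<Rightarrow> ('a \<Rightarrow> complex \<times> real) \<Rightarrow> bool" where
  "linearising_chart U \<phi> \<longleftrightarrow> \<sigma> ` U \<subseteq> U \<and> local_coordinates X U \<phi> \<and>
     (\<forall>u\<in>U. \<phi> (\<sigma> u) = (- fst (\<phi> u), snd (\<phi> u)))"

definition model_chart :: "'a set \<Rightarrow> ('a \<Rightarrow> complex \<times> real) \<Rightarrow> ('b \<Rightarrow> complex \<times> real) \<Rightarrow> bool" where
  "model_chart U \<phi> \<psi> \<longleftrightarrow> local_coordinates Y (f ` U) \<psi> \<and>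
     branch \<inter> f ` U = {v \<in> f ` U. fst (\<psi> v) = 0} \<and>
     (\<forall>u\<in>U. \<psi> (f u) = ((fst (\<phi> u))\<^sup>2, snd (\<phi> u)))"

text \<open>The fibres of \<open>(z, t) \<mapsto> (z^2, t)\<close> are the orbits of the half turn,
  so on \<open>U\<close> this map and \<open>f\<close> identify the same points:
  \<open>\<psi>\<close> is well defined and injective. It is continuous because \<open>f\<close>
  restricts to a quotient map on a saturated open set, and open because the model is. Branch locus
  and axis both come from the fixed points.\<close>

lemma model_chart_exists:
  assumes "linearising_chart U \<phi>"
  obtains \<psi> where "model_chart U \<phi> \<psi>"
proof -
  have U: "\<sigma> ` U \<subseteq> U" and \<phi>: "local_coordinates X U \<phi>"
    and \<phi>\<sigma>: "\<And>u. u \<in> U \<Longrightarrow> \<phi> (\<sigma> u) = (- fst (\<phi> u), snd (\<phi> u))"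
    using assms by (auto simp: linearising_chart_def)
  let ?N = "\<lambda>p. ((fst p)\<^sup>2, snd p) :: complex \<times> real"
  have opU: "openin X U" and op\<phi>: "open (\<phi> ` U)"
    and hom: "homeomorphic_map (subtopology X U) (top_of_set (\<phi> ` U)) \<phi>"
    using \<phi> by (auto simp: local_coordinates_def)
  have sub: "U \<subseteq> topspace X" using opU by (rule openin_subset)
  have top: "topspace (subtopology X U) = U" using sub by auto
  have inj: "inj_on \<phi> U"
    using homeomorphic_imp_injective_map[OF hom] unfolding top .
  have N_eq: "?N (\<phi> u) = ?N (\<phi> v) \<longleftrightarrow> f u = f v" if "u \<in> U" "v \<in> U" for u v
  proof -
    have "?N (\<phi> u) = ?N (\<phi> v) \<longleftrightarrow> \<phi> v = \<phi> u \<or> \<phi> v = \<phi> (\<sigma> u)"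
      unfolding \<phi>\<sigma>[OF that(1)] by (auto simp: prod_eq_iff power2_eq_iff)
    also have "\<dots> \<longleftrightarrow> v = u \<or> v = \<sigma> u"
      using that U inj_on_eq_iff[OF inj] by blast
    also have "\<dots> \<longleftrightarrow> f u = f v" using that sub fibre by blast
    finally show ?thesis .
  qed
  define \<psi> where "\<psi> v = ?N (\<phi> (SOME u. u \<in> U \<and> f u = v))" for v
  have \<psi>: "\<psi> (f u) = ?N (\<phi> u)" if "u \<in> U" for u
  proof -
    define u' where "u' = (SOME u'. u' \<in> U \<and> f u' = f u)"
    have "u' \<in> U \<and> f u' = f u"
      unfolding u'_def using someI[of "\<lambda>u'. u' \<in> U \<and> f u' = f u" u] that by simp
    then show ?thesis using N_eq[of u' u] that unfolding \<psi>_def u'_def[symmetric] by simp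
  qed
  have opV: "openin Y (f ` U)" using open_map_f opU by (auto simp: open_map_def)
  then have subV: "f ` U \<subseteq> topspace Y" by (rule openin_subset)
  have image: "\<psi> ` f ` W = ?N ` \<phi> ` W" if "W \<subseteq> U" for W
    unfolding image_image using that by (intro image_cong refl \<psi>) auto
  have open_image: "open (\<psi> ` f ` W)" if "W \<subseteq> U" "openin X W" for W
  proof -
    have "openin (subtopology X U) W" using that by (simp add: openin_open_subtopology opU)
    then have "openin (top_of_set (\<phi> ` U)) (\<phi> ` W)"
      using homeomorphic_map_openness_eq[OF hom, of W] by blast
    then have "open (\<phi> ` W)" using op\<phi> openin_open_eq by blast
    then show ?thesis unfolding image[OF that(1)] by (rule open_branched_model)
  qed
  have "local_coordinates Y (f ` U) \<psi>"
    unfolding local_coordinates_def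
  proof (intro conjI opV)
    show "open (\<psi> ` f ` U)" using open_image opU by blast
    show "homeomorphic_map (subtopology Y (f ` U)) (top_of_set (\<psi> ` f ` U)) \<psi>"
    proof (rule bijective_open_imp_homeomorphic_map)
      have eq: "{x \<in> topspace X. f x \<in> f ` U} = U"
        using vimage_image[OF sub] U by blast
      have "quotient_map (subtopology X U) (subtopology Y (f ` U)) f"
        using quotient_map_restriction[OF quotient eq] opV by blast
      moreover have "continuous_map (subtopology X U) (top_of_set (\<psi> ` f ` U)) (\<psi> \<circ> f)"
      proof -
        have "continuous_map (subtopology X U) euclidean (?N \<circ> \<phi>)"
        proof (rule continuous_map_compose)
          show "continuous_map (subtopology X U) euclidean \<phi>"
            using homeomorphic_imp_continuous_map[OF hom] by (simp add: continuous_map_in_subtopology)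
          show "continuous_map euclidean euclidean ?N"
            by (simp, intro continuous_intros)
        qed
        then have "continuous_map (subtopology X U) euclidean (\<psi> \<circ> f)"
          by (rule continuous_map_eq) (use \<psi> in auto)
        then show ?thesis by (auto simp: continuous_map_in_subtopology)
      qed
      ultimately show "continuous_map (subtopology Y (f ` U)) (top_of_set (\<psi> ` f ` U)) \<psi>"
        by (rule continuous_compose_quotient_map)
      show "open_map (subtopology Y (f ` U)) (top_of_set (\<psi> ` f ` U)) \<psi>"
        unfolding open_map_def
      proof (intro allI impI)
        fix W assume "openin (subtopology Y (f ` U)) W"
        then have W: "openin Y W" "W \<subseteq> f ` U" by (auto simp: openin_open_subtopology opV)
        let ?W = "{x \<in> topspace X. f x \<in> W}"
        have "openin X ?W" using continuous_f W(1) by (rule openin_continuous_map_preimage)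
        moreover have "?W \<subseteq> U" using W(2) eq by blast
        moreover have "f ` ?W = W" using W(2) sub by blast
        ultimately have "open (\<psi> ` W)" using open_image by metis
        then show "openin (top_of_set (\<psi> ` f ` U)) (\<psi> ` W)"
          using W(2) by (intro open_subset) auto
      qed
      show "\<psi> ` topspace (subtopology Y (f ` U)) = topspace (top_of_set (\<psi> ` f ` U))"
        using subV by (simp add: Int_absorb1)
      show "inj_on \<psi> (topspace (subtopology Y (f ` U)))"
        using subV N_eq by (auto simp: inj_on_def \<psi>)
    qed
  qed
  moreover have "branch \<inter> f ` U = {v \<in> f ` U. fst (\<psi> v) = 0}"
  proof -
    have neg_eq: "- z = z \<longleftrightarrow> z = 0" for z :: complex by (auto simp: complex_eq_iff)
    have "f u \<in> branch \<longleftrightarrow> fst (\<psi> (f u)) = 0" if "u \<in> U" for u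
    proof -
      have "f u \<in> branch \<longleftrightarrow> \<sigma> u = u" using that sub f_in_branch_iff fixed_iff by blast
      also have "\<dots> \<longleftrightarrow> \<phi> (\<sigma> u) = \<phi> u" using that U inj_on_eq_iff[OF inj] by blast
      also have "\<dots> \<longleftrightarrow> fst (\<psi> (f u)) = 0"
        using that neg_eq by (simp add: \<psi> \<phi>\<sigma> prod_eq_iff)
      finally show ?thesis .
    qed
    then show ?thesis by auto
  qed
  ultimately have "model_chart U \<phi> \<psi>" using \<psi> by (simp add: model_chart_def)
  then show thesis by (rule that)
qed

text \<open>Closedness of the branch locus is read off from its preimage, the zero set of
  \<open>j\<close>; its compactness comes from that of \<open>X\<close>.\<close>

theorem branched_double_covering_quotient:
  assumes "compact_space X"
    and charts: "\<And>x. x \<in> topspace X \<Longrightarrow> j x = 0 \<Longrightarrow> \<exists>U \<phi>. x \<in> U \<and> linearising_chart U \<phi>"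
  shows "branched_double_covering X Y f"
proof -
  let ?F = "{x \<in> topspace X. j x = 0}"
  have "closedin X {x \<in> topspace X. j x \<in> {0}}"
    by (rule closedin_continuous_map_preimage[OF continuous_j]) auto
  then have F: "closedin X ?F" by simp
  have cp: "compactin Y branch"
    unfolding branch_def
    by (rule image_compactin[OF closedin_compact_space[OF assms(1) F] continuous_f])
  have cl: "closedin Y branch"
  proof -
    have "{x \<in> topspace X. f x \<in> branch} = ?F" using f_in_branch_iff by blast
    moreover have "branch \<subseteq> topspace Y" using f_in by (auto simp: branch_def)
    ultimately show ?thesis using quotient F unfolding quotient_map_closedin by metis
  qed
  have models: "\<exists>U \<phi> \<psi>. x \<in> U \<and> linearising_chart U \<phi> \<and> model_chart U \<phi> \<psi>"
    if x: "x \<in> topspace X" "f x \<in> branch" for x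
  proof -
    have "j x = 0" using x f_in_branch_iff by blast
    then obtain U \<phi> where "x \<in> U" "linearising_chart U \<phi>" using charts x(1) by meson
    then show ?thesis using model_chart_exists by meson
  qed
  have "closed_one_submanifold Y branch"
    unfolding closed_one_submanifold_def
  proof (intro conjI cl cp ballI)
    fix y assume y: "y \<in> branch"
    then obtain x where x: "x \<in> topspace X" "f x = y" by (auto simp: branch_def)
    with models[of x] y obtain U \<phi> \<psi> where "x \<in> U" "model_chart U \<phi> \<psi>" by blast
    with x show "\<exists>V \<psi>. y \<in> V \<and> local_coordinates Y V \<psi> \<and> branch \<inter> V = {v \<in> V. fst (\<psi> v) = 0}"
      by (intro exI[of _ "f ` U"] exI[of _ \<psi>]) (auto simp: model_chart_def)
  qed
  moreover have "\<exists>U V \<phi> \<psi>. x \<in> U \<and> f ` U \<subseteq> V \<and> local_coordinates X U \<phi> \<and> local_coordinates Y V \<psi> \<and>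
              branch \<inter> V = {v \<in> V. fst (\<psi> v) = 0} \<and>
              (\<forall>u \<in> U. \<psi> (f u) = ((fst (\<phi> u))\<^sup>2, snd (\<phi> u)))"
    if x: "x \<in> topspace X" "f x \<in> branch" for x
  proof -
    obtain U \<phi> \<psi> where "x \<in> U" "linearising_chart U \<phi>" "model_chart U \<phi> \<psi>"
      using models[OF x] by blast
    then show ?thesis
      by (intro exI[of _ U] exI[of _ "f ` U"] exI[of _ \<phi>] exI[of _ \<psi>])
        (simp add: linearising_chart_def model_chart_def)
  qed
  ultimately show ?thesis
    unfolding branched_double_covering_def
    using continuous_f two_sheeted by (intro conjI exI[of _ branch] ballI impI)
qed

end

text \<open>Where \<open>g\<close> does not vanish the line splits into open intervals, and each
  carries a branch of the root. The branches may be chosen independently, because at a zero of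
  \<open>g\<close> continuity follows from \<open>norm (r s) = sqrt (norm (g s))\<close> alone. This
  is what lets a lifted path cross the branch locus.\<close>

lemma continuous_sqrt_real_line:
  fixes g :: "real \<Rightarrow> complex"
  assumes g: "continuous_on UNIV g"
  obtains r where "continuous_on UNIV r" "\<And>t. (r t)\<^sup>2 = g t"
proof -
  define S where "S = {t. g t \<noteq> 0}"
  have opS: "open S" unfolding S_def by (intro open_Collect_neq g continuous_intros)
  define C where "C t = connected_component_set S t" for t
  have ex: "\<exists>h. continuous_on (C t) h \<and> (\<forall>x\<in>C t. g x = (h x)\<^sup>2)" if "t \<in> S" for t
  proof -
    have "connected (C t)" unfolding C_def by (rule connected_connected_component)
    then have "contractible (C t)"
      by (intro convex_imp_contractible) (simp add: is_interval_convex is_interval_connected_1)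
    moreover have "C t \<subseteq> S" unfolding C_def by (rule connected_component_subset)
    ultimately show ?thesis
      using continuous_sqrt_on_contractible[of "C t" g] continuous_on_subset[OF g]
      by (metis (mono_tags, lifting) S_def mem_Collect_eq subsetD subset_UNIV)
  qed
  define R where "R t = (SOME h. continuous_on (C t) h \<and> (\<forall>x\<in>C t. g x = (h x)\<^sup>2))" for t
  have R: "continuous_on (C t) (R t) \<and> (\<forall>x\<in>C t. g x = (R t x)\<^sup>2)" if "t \<in> S" for t
    unfolding R_def by (rule someI_ex[OF ex[OF that]])
  define r where "r t = (if t \<in> S then R t t else 0)" for t
  have C_self: "t \<in> C t" if "t \<in> S" for t using that by (simp add: C_def)
  have sq: "(r t)\<^sup>2 = g t" for t
  proof (cases "t \<in> S")
    case True
    then have "g t = (R t t)\<^sup>2" using R C_self by blast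
    then show ?thesis using True by (simp only: r_def if_True)
  qed (simp add: r_def S_def)
  have "isCont r t" for t
  proof (cases "t \<in> S")
    case True
    have op: "open (C t)" unfolding C_def by (rule open_connected_component[OF opS])
    \<comment> \<open>\<open>R t\<close> depends on \<open>t\<close> only through
      \<open>C t\<close>, so the same branch is chosen at all points of a component.\<close>
    have eq: "r s = R t s" if "s \<in> C t" for s
    proof -
      have "C s = C t" using that unfolding C_def by (metis connected_component_eq)
      moreover have "s \<in> S" using that connected_component_subset unfolding C_def by blast
      ultimately show ?thesis by (simp add: r_def R_def)
    qed
    have "continuous_on (C t) r" using R[OF True] eq by (simp cong: continuous_on_cong)
    then show ?thesis using op C_self[OF True] by (simp add: continuous_on_eq_continuous_at)
  next
    case False
    then have "r t = 0" by (simp add: r_def)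
    have norm: "norm (r s) = sqrt (norm (g s))" for s
      by (simp add: norm_power flip: sq)
    have "isCont (\<lambda>s. sqrt (norm (g s))) t"
      using g by (intro continuous_intros) (simp add: continuous_on_eq_continuous_at)
    then have "((\<lambda>s. norm (r s)) \<longlongrightarrow> 0) (at t)"
      using False by (simp add: isCont_def norm S_def)
    then show ?thesis using \<open>r t = 0\<close> by (simp add: isCont_def tendsto_norm_zero_iff)
  qed
  then have "continuous_on UNIV r" by (simp add: continuous_at_imp_continuous_on)
  then show thesis using sq by (rule that)
qed

context involution_quotient
begin

text \<open>The square of \<open>j\<close> is invariant under \<open>\<sigma>\<close> and descends
  to \<open>J\<close> on \<open>Y\<close>. A point of \<open>X\<close> is determined by its images
  under \<open>f\<close> and \<open>j\<close>, so a continuous root \<open>r\<close> of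
  \<open>J\<close> along \<open>\<gamma>\<close> singles out one point \<open>\<delta> t\<close>
  over every \<open>\<gamma> t\<close>.\<close>

lemma path_lifting:
  assumes \<gamma>: "pathin Y \<gamma>" and x: "x \<in> topspace X" "f x = \<gamma> 0"
  obtains \<delta> where "pathin X \<delta>" "\<delta> 0 = x" "\<And>t. t \<in> {0..1} \<Longrightarrow> f (\<delta> t) = \<gamma> t"
proof -
  have \<gamma>_in: "\<gamma> t \<in> topspace Y" if "t \<in> {0..1}" for t
    using \<gamma> that by (auto simp: pathin_def continuous_map_def)
  define J where "J y = (j (SOME x. x \<in> topspace X \<and> f x = y))\<^sup>2" for y
  have J: "J (f x) = (j x)\<^sup>2" if "x \<in> topspace X" for x
  proof -
    define x' where "x' = (SOME x'. x' \<in> topspace X \<and> f x' = f x)"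
    have x': "x' \<in> topspace X \<and> f x' = f x"
      unfolding x'_def using someI[of "\<lambda>x'. x' \<in> topspace X \<and> f x' = f x" x] that by simp
    then have "x' = x \<or> x' = \<sigma> x" using fibre that by metis
    then show ?thesis unfolding J_def x'_def[symmetric] using j_\<sigma>[OF that] by auto
  qed
  have "continuous_map X euclidean (\<lambda>x. (j x)\<^sup>2)"
    using continuous_map_compose[OF continuous_j, of euclidean "\<lambda>z. z\<^sup>2"]
    by (simp add: comp_def continuous_on_power)
  then have "continuous_map X euclidean (J \<circ> f)"
    by (rule continuous_map_eq) (simp add: J)
  then have contJ: "continuous_map Y euclidean J"
    using continuous_compose_quotient_map[OF quotient] by blast
  \<comment> \<open>Clamping to the unit interval extends \<open>J \<circ> \<gamma>\<close> to the
    whole line, where \<open>continuous_sqrt_real_line\<close> applies.\<close>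
  define c :: "real \<Rightarrow> real" where "c t = max 0 (min 1 t)" for t
  have c: "c t \<in> {0..1}" "t \<in> {0..1} \<Longrightarrow> c t = t" for t by (auto simp: c_def)
  have "continuous_on {0..1} (J \<circ> \<gamma>)"
    using continuous_map_compose[OF \<gamma>[unfolded pathin_def] contJ] by simp
  moreover have "continuous_on UNIV c"
    unfolding c_def by (intro continuous_intros)
  ultimately have "continuous_on UNIV (\<lambda>t. J (\<gamma> (c t)))"
    using continuous_on_compose2[of "{0..1}" "J \<circ> \<gamma>" UNIV c] c(1) by (simp add: comp_def image_subset_iff)
  then obtain r0 where r0: "continuous_on UNIV r0" "\<And>t. (r0 t)\<^sup>2 = J (\<gamma> (c t))"
    using continuous_sqrt_real_line by blast
  \<comment> \<open>The two roots at time 0 are \<open>j x\<close> and its negative; the sign makes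
    the lift start at \<open>x\<close>.\<close>
  define s :: complex where "s = (if r0 0 = j x then 1 else -1)"
  define r where "r t = s * r0 t" for t
  have r: "continuous_on UNIV r" unfolding r_def by (intro continuous_intros r0)
  have s2: "s\<^sup>2 = 1" by (simp add: s_def)
  have r_sq: "(r t)\<^sup>2 = J (\<gamma> t)" if "t \<in> {0..1}" for t
    using r0(2)[of t] c(2)[OF that] s2 by (simp add: r_def power_mult_distrib)
  have "(r0 0)\<^sup>2 = (j x)\<^sup>2" using r0(2)[of 0] J[OF x(1)] x(2) by (simp add: c_def)
  then have "r0 0 = j x \<or> r0 0 = - j x" by (simp add: power2_eq_iff)
  then have r_0: "r 0 = j x" by (auto simp: r_def s_def)
  have ex: "\<exists>u. u \<in> topspace X \<and> f u = \<gamma> t \<and> j u = r t" if t: "t \<in> {0..1}" for t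
  proof -
    obtain u where u: "u \<in> topspace X" "f u = \<gamma> t"
      using \<gamma>_in[OF t] quotient_imp_surjective_map[OF quotient] by (metis imageE)
    have "(j u)\<^sup>2 = (r t)\<^sup>2" using r_sq[OF t] J[OF u(1)] u(2) by simp
    then have "j u = r t \<or> j (\<sigma> u) = r t" using j_\<sigma>[OF u(1)] by (auto simp: power2_eq_iff)
    then show ?thesis using u \<sigma>_in f_\<sigma> by metis
  qed
  have unique: "u = v" if "u \<in> topspace X" "v \<in> topspace X" "f u = f v" "j u = j v" for u v
  proof -
    have "v = u \<or> v = \<sigma> u" using that fibre by blast
    moreover have "\<sigma> u = u" if "v = \<sigma> u"
    proof -
      have "j u = - j u" using that \<open>j u = j v\<close> j_\<sigma> \<open>u \<in> topspace X\<close> by simp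
      then have "j u = 0" by (simp add: complex_eq_iff)
      then show ?thesis using j_eq_0 \<open>u \<in> topspace X\<close> by blast
    qed
    ultimately show ?thesis by metis
  qed
  define \<delta> where "\<delta> t = (SOME u. u \<in> topspace X \<and> f u = \<gamma> t \<and> j u = r t)" for t
  have \<delta>: "\<delta> t \<in> topspace X" "f (\<delta> t) = \<gamma> t" "j (\<delta> t) = r t" if "t \<in> {0..1}" for t
    using someI_ex[OF ex[OF that]] unfolding \<delta>_def by auto
  have "\<delta> 0 = x" using \<delta>[of 0] x r_0 by (intro unique) auto
  moreover have "pathin X \<delta>"
    unfolding pathin_def continuous_map_eq_topcontinuous_at
  proof
    fix t0 assume "t0 \<in> topspace (top_of_set {0..1::real})"
    then have t0: "t0 \<in> {0..1}" by simp
    show "topcontinuous_at (top_of_set {0..1}) X \<delta> t0"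
      unfolding topcontinuous_at_def
    proof (intro conjI allI impI)
      show "t0 \<in> topspace (top_of_set {0..1})" using t0 by simp
      show "\<delta> \<in> topspace (top_of_set {0..1}) \<rightarrow> topspace X" using \<delta>(1) by simp
      fix U assume U: "openin X U \<and> \<delta> t0 \<in> U"
      \<comment> \<open>Close to \<open>t0\<close> the point \<open>\<gamma> t\<close> stays in the
        open image of \<open>U'\<close>, so \<open>\<delta> t\<close> lies in \<open>U'\<close> or
        in its mirror image. At a fixed point \<open>U'\<close> can be taken symmetric inside
        \<open>U\<close>; elsewhere the sign of \<open>r\<close> on \<open>T\<close> excludes the
        mirror image.\<close>
      have "\<exists>U' T. openin X U' \<and> \<delta> t0 \<in> U' \<and> openin (top_of_set {0..1}) T \<and> t0 \<in> T \<and>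
          (\<forall>t\<in>T. \<delta> t \<in> U' \<union> \<sigma> ` U' \<longrightarrow> \<delta> t \<in> U)"
      proof (cases "j (\<delta> t0) = 0")
        case True
        then have "\<sigma> (\<delta> t0) = \<delta> t0" using j_eq_0 \<delta>(1)[OF t0] by blast
        then have "\<delta> t0 \<in> \<sigma> ` U" using U by (metis imageI)
        moreover have "openin X (U \<inter> \<sigma> ` U)" using U open_image_\<sigma> by blast
        moreover have "\<sigma> ` (U \<inter> \<sigma> ` U) \<subseteq> U"
          using \<sigma>_\<sigma> openin_subset[of X U] U by (auto simp: subset_iff)
        ultimately show ?thesis using U t0
          by (intro exI[of _ "U \<inter> \<sigma> ` U"] exI[of _ "{0..1}"]) auto
      next
        case False
        then obtain U0 where U0: "openin X U0" "\<delta> t0 \<in> U0"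
          "\<And>u. u \<in> U0 \<Longrightarrow> 0 < Re (j u * cnj (j (\<delta> t0)))"
          using separated_neighbourhood[OF \<delta>(1)[OF t0]] by metis
        define T where "T = {0..1} \<inter> r -` {z. 0 < Re (z * cnj (j (\<delta> t0)))}"
        have "open {z. 0 < Re (z * cnj (j (\<delta> t0)))}"
          by (intro open_Collect_less continuous_intros)
        moreover have "continuous_on {0..1} r" using r continuous_on_subset by blast
        ultimately have "openin (top_of_set {0..1}) T"
          unfolding T_def by (intro continuous_openin_preimage_gen)
        moreover have "t0 \<in> T"
          using t0 U0(3)[OF U0(2)] \<delta>(3)[OF t0] by (simp add: T_def)
        moreover have "\<delta> t \<in> U" if t: "t \<in> T" "\<delta> t \<in> (U \<inter> U0) \<union> \<sigma> ` (U \<inter> U0)" for t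
        proof (rule ccontr)
          assume "\<delta> t \<notin> U"
          then obtain u where u: "u \<in> U \<inter> U0" "\<delta> t = \<sigma> u" using t(2) by auto
          then have "j (\<delta> t) = - j u" using j_\<sigma> U openin_subset by (metis IntD1 subsetD)
          then have "r t = - j u" using t(1) \<delta>(3) by (simp add: T_def)
          then show False using t(1) U0(3)[of u] u(1) by (simp add: T_def)
        qed
        ultimately show ?thesis using U U0(1,2)
          by (intro exI[of _ "U \<inter> U0"] exI[of _ T]) auto
      qed
      then obtain U' T where U': "openin X U'" "\<delta> t0 \<in> U'" and T: "openin (top_of_set {0..1}) T" "t0 \<in> T"
        and *: "\<And>t. t \<in> T \<Longrightarrow> \<delta> t \<in> U' \<union> \<sigma> ` U' \<Longrightarrow> \<delta> t \<in> U"
        by blast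
      have "openin Y (f ` U')" using open_map_f U'(1) by (simp add: open_map_def)
      then have "openin (top_of_set {0..1}) {t \<in> topspace (top_of_set {0..1}). \<gamma> t \<in> f ` U'}"
        by (rule openin_continuous_map_preimage[OF \<gamma>[unfolded pathin_def]])
      then have "openin (top_of_set {0..1}) (T \<inter> {t \<in> {0..1}. \<gamma> t \<in> f ` U'})"
        using T(1) by (intro openin_Int) auto
      moreover have "t0 \<in> T \<inter> {t \<in> {0..1}. \<gamma> t \<in> f ` U'}"
        using T(2) t0 \<delta>(2)[OF t0] U'(2) by (auto intro: image_eqI[of _ f "\<delta> t0"])
      moreover have "\<delta> t \<in> U" if t: "t \<in> T \<inter> {t \<in> {0..1}. \<gamma> t \<in> f ` U'}" for t
      proof -
        have "\<delta> t \<in> {x \<in> topspace X. f x \<in> f ` U'}" using t \<delta>(1,2) by auto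
        then show ?thesis using * t vimage_image[OF openin_subset[OF U'(1)]] by blast
      qed
      ultimately show "\<exists>T. openin (top_of_set {0..1}) T \<and> t0 \<in> T \<and> (\<forall>t\<in>T. \<delta> t \<in> U)"
        by blast
    qed
  qed
  ultimately show thesis using that \<delta>(2) by blast
qed

end

section \<open>Detours, loop classes and surjectivity on fundamental groups\<close>

lemma subtopology_Collect_top_of_set:
  "subtopology (top_of_set S) {x \<in> topspace (top_of_set S). P x} = top_of_set {x \<in> S. P x}"
proof -
  have "S \<inter> {x \<in> S. P x} = {x \<in> S. P x}" by blast
  then show ?thesis by (simp only: subtopology_subtopology topspace_euclidean_subtopology)
qed

text \<open>The path \<open>g\<close> takes the first half of the time, then \<open>e\<close> is run
  to \<open>e 1\<close> and back, a quarter each: the argument of \<open>e\<close> is a tent with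
  peak 1 at \<open>t = 3/4\<close>.\<close>

definition detour :: "(real \<Rightarrow> 'a) \<Rightarrow> (real \<Rightarrow> 'a) \<Rightarrow> real \<Rightarrow> 'a" where
  "detour g e t = (if 2 * t \<le> 1 then g (2 * t) else e (2 * min (2 * t - 1) (2 - 2 * t)))"

text \<open>At stage \<open>u\<close> of the homotopy the excursion along \<open>e\<close> turns
  back at \<open>e u\<close>: time is stretched to \<open>a = (1 + u) t\<close>, and the tent
  \<open>b\<close> over \<open>1 \<le> a \<le> 1 + u\<close> has height \<open>u\<close>. At
  \<open>u = 0\<close> only \<open>g\<close> remains.\<close>

lemma homotopic_detour:
  assumes g: "pathin Y g" and e: "pathin Y e" and eq: "g 1 = e 0"
  shows "homotopic_with (\<lambda>k. k 0 = g 0 \<and> k 1 = g 1) (top_of_set {0..1}) Y g (detour g e)"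
proof -
  define a :: "real \<times> real \<Rightarrow> real" where "a p = (1 + fst p) * snd p" for p
  define b :: "real \<times> real \<Rightarrow> real" where "b p = 2 * min (a p - 1) (fst p - (a p - 1))" for p
  define h where "h p = (if a p \<le> 1 then g (a p) else e (b p))" for p
  let ?S = "{0..1::real} \<times> {0..1::real}"
  have conta: "continuous_on T a" for T unfolding a_def by (intro continuous_intros)
  have contb: "continuous_on T b" for T unfolding b_def by (intro continuous_intros conta)
  have a_nonneg: "0 \<le> a p" if "p \<in> ?S" for p using that by (auto simp: a_def)
  have a_le: "a p \<le> 1 + fst p" if "p \<in> ?S" for p
    using that mult_left_mono[of "snd p" 1 "1 + fst p"] by (auto simp: a_def)
  have b_in: "0 \<le> b p" "b p \<le> 1" if "p \<in> ?S" "1 \<le> a p" for p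
    using a_le[OF that(1)] that unfolding b_def by (auto simp: min_def)
  have prod: "prod_topology (top_of_set {0..1}) (top_of_set {0..1}) = top_of_set ?S"
    by (simp add: subtopology_Times euclidean_product_topology)
  have "continuous_map (top_of_set ?S) Y h"
    unfolding h_def
  proof (rule continuous_map_cases_le)
    show "continuous_map (top_of_set ?S) euclideanreal a" using conta by simp
    have "continuous_map (top_of_set {p \<in> ?S. a p \<le> 1}) Y (g \<circ> a)"
    proof (rule continuous_map_compose)
      show "continuous_map (top_of_set {p \<in> ?S. a p \<le> 1}) (top_of_set {0..1}) a"
        using conta a_nonneg by (auto simp: continuous_map_in_subtopology)
    qed (use g in \<open>simp add: pathin_def\<close>)
    then show "continuous_map (subtopology (top_of_set ?S) {p \<in> topspace (top_of_set ?S). a p \<le> 1}) Y (\<lambda>p. g (a p))"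
      unfolding subtopology_Collect_top_of_set comp_def .
    have "continuous_map (top_of_set {p \<in> ?S. 1 \<le> a p}) Y (e \<circ> b)"
    proof (rule continuous_map_compose)
      show "continuous_map (top_of_set {p \<in> ?S. 1 \<le> a p}) (top_of_set {0..1}) b"
        using contb b_in by (auto simp: continuous_map_in_subtopology)
    qed (use e in \<open>simp add: pathin_def\<close>)
    then show "continuous_map (subtopology (top_of_set ?S) {p \<in> topspace (top_of_set ?S). 1 \<le> a p}) Y (\<lambda>p. e (b p))"
      unfolding subtopology_Collect_top_of_set comp_def .
    show "g (a p) = e (b p)" if "p \<in> topspace (top_of_set ?S)" "a p = 1" for p
      using that eq by (auto simp: b_def)
  qed simp
  moreover have "h (0, t) = g t" if "t \<in> {0..1}" for t using that by (simp add: h_def a_def)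
  moreover have "h (1, t) = detour g e t" for t by (simp add: h_def a_def b_def detour_def)
  moreover have "h (u, 0) = g 0 \<and> h (u, 1) = g 1" if "u \<in> {0..1}" for u
    using that eq by (auto simp: h_def a_def b_def)
  ultimately show ?thesis
    by (subst homotopic_with) (auto simp: prod intro!: exI[of _ h])
qed

lemma pathin_detour:
  assumes "pathin X g" "pathin X e" "g 1 = e 0"
  shows "pathin X (detour g e)"
  using homotopic_with_imp_continuous_maps[OF homotopic_detour[OF assms]] by (simp add: pathin_def)

lemma loop_homotopy_refl: "g \<in> loops_at X x \<Longrightarrow> (g, g) \<in> loop_homotopy X x"
  by (auto simp: loop_homotopy_def loops_at_def pathin_def)

lemma loop_homotopy_sym: "(g, h) \<in> loop_homotopy X x \<Longrightarrow> (h, g) \<in> loop_homotopy X x"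
  by (auto simp: loop_homotopy_def intro: homotopic_with_symD)

lemma loop_homotopy_trans:
  "(g, h) \<in> loop_homotopy X x \<Longrightarrow> (h, k) \<in> loop_homotopy X x \<Longrightarrow> (g, k) \<in> loop_homotopy X x"
  by (auto simp: loop_homotopy_def intro: homotopic_with_trans)

lemma loop_homotopy_compose:
  assumes "continuous_map X Y f" "(g, h) \<in> loop_homotopy X x"
  shows "(f \<circ> g, f \<circ> h) \<in> loop_homotopy Y (f x)"
proof -
  have "homotopic_with (\<lambda>k. k 0 = x \<and> k 1 = x) (top_of_set {0..1}) X g h"
    using assms(2) by (simp add: loop_homotopy_def)
  then have "homotopic_with (\<lambda>k. k 0 = f x \<and> k 1 = f x) (top_of_set {0..1}) Y (f \<circ> g) (f \<circ> h)"
    by (rule homotopic_with_compose_continuous_map_left[OF _ assms(1)]) simp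
  then show ?thesis
    using assms by (auto simp: loop_homotopy_def loops_at_def intro: pathin_compose)
qed

text \<open>\<open>pi1_map\<close> takes the union of the classes of all images; these classes
  coincide because composition with \<open>f\<close> respects loop homotopy.\<close>

lemma pi1_map_class:
  assumes "continuous_map X Y f" "g \<in> loops_at X x"
  shows "pi1_map Y f x (loop_homotopy X x `` {g}) = loop_homotopy Y (f x) `` {f \<circ> g}"
proof -
  define S where "S = (\<lambda>g. f \<circ> g) ` (loop_homotopy X x `` {g})"
  have 1: "f \<circ> g \<in> S"
    unfolding S_def using loop_homotopy_refl[OF assms(2)] by blast
  have 2: "(f \<circ> g, k) \<in> loop_homotopy Y (f x)" if "k \<in> S" for k
    using that loop_homotopy_compose[OF assms(1)] unfolding S_def by blast
  have "loop_homotopy Y (f x) `` S = loop_homotopy Y (f x) `` {f \<circ> g}"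
  proof (intro equalityI subsetI)
    fix l assume "l \<in> loop_homotopy Y (f x) `` S"
    then obtain k where "k \<in> S" "(k, l) \<in> loop_homotopy Y (f x)" by blast
    then have "(f \<circ> g, l) \<in> loop_homotopy Y (f x)" using 2 loop_homotopy_trans by metis
    then show "l \<in> loop_homotopy Y (f x) `` {f \<circ> g}" by blast
  qed (use 1 in blast)
  then show ?thesis by (simp add: pi1_map_def S_def)
qed

context involution_quotient
begin

lemma loop_lifting:
  assumes x: "x \<in> topspace X" and g: "g \<in> loops_at Y (f x)"
    and d: "pathin X d" "d 0 = x" "j (d 1) = 0"
  obtains h where "h \<in> loops_at X x" "(g, f \<circ> h) \<in> loop_homotopy Y (f x)"
proof -
  have pg: "pathin Y g" "g 0 = f x" "g 1 = f x" using g by (auto simp: loops_at_def)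
  then obtain \<delta> where \<delta>: "pathin X \<delta>" "\<delta> 0 = x" "\<And>t. t \<in> {0..1} \<Longrightarrow> f (\<delta> t) = g t"
    using path_lifting x by metis
  have d_in: "d t \<in> topspace X" if "t \<in> {0..1}" for t
    using d(1) that by (auto simp: pathin_def continuous_map_def)
  have "\<delta> 1 \<in> topspace X" using \<delta>(1) by (auto simp: pathin_def continuous_map_def)
  moreover have "f (\<delta> 1) = f x" using \<delta>(3)[of 1] pg by simp
  ultimately have "\<delta> 1 = x \<or> \<delta> 1 = \<sigma> x" using fibre[OF x] by metis
  then show thesis
  proof
    assume "\<delta> 1 = x"
    then have loop: "\<delta> \<in> loops_at X x" using \<delta> by (simp add: loops_at_def)
    have "homotopic_with (\<lambda>k. k 0 = f x \<and> k 1 = f x) (top_of_set {0..1}) Y g (f \<circ> \<delta>)"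
      using pg \<delta>(3) by (intro homotopic_with_equal) (auto simp: pathin_def)
    moreover have "f \<circ> \<delta> \<in> loops_at Y (f x)"
      using loop continuous_f by (auto simp: loops_at_def intro: pathin_compose)
    ultimately have "(g, f \<circ> \<delta>) \<in> loop_homotopy Y (f x)" using g by (simp add: loop_homotopy_def)
    then show thesis using that loop by blast
  next
    assume \<delta>1: "\<delta> 1 = \<sigma> x"
    have "\<sigma> (d 1) = d 1" using d(3) d_in[of 1] j_eq_0 by simp
    have contd: "continuous_map (top_of_set {0..1}) X d" using d(1) by (simp add: pathin_def)
    \<comment> \<open>In the last quarter the detour would return along
      \<open>\<sigma> \<circ> d\<close> to \<open>\<sigma> x\<close>; \<open>h\<close> returns along
      \<open>d\<close> to \<open>x\<close> instead. The switch is continuous because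
      \<open>d 1\<close> is a fixed point, and \<open>f\<close> sees no difference.\<close>
    define h where "h t = (if 4 * t \<le> 3 then detour \<delta> (\<sigma> \<circ> d) t else d (4 - 4 * t))" for t
    have "pathin X h"
      unfolding pathin_def h_def
    proof (rule continuous_map_cases_le)
      have "pathin X (detour \<delta> (\<sigma> \<circ> d))"
        using \<delta>(1) d \<delta>1 continuous_\<sigma> by (intro pathin_detour pathin_compose) auto
      then show "continuous_map (subtopology (top_of_set {0..1}) {t \<in> topspace (top_of_set {0..1}). 4 * t \<le> 3}) X
          (detour \<delta> (\<sigma> \<circ> d))"
        by (simp add: pathin_def continuous_map_from_subtopology)
      have "continuous_map (top_of_set {t \<in> {0..1::real}. 3 \<le> 4 * t}) X (d \<circ> (\<lambda>t. 4 - 4 * t))"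
      proof (rule continuous_map_compose[OF _ contd])
        show "continuous_map (top_of_set {t \<in> {0..1::real}. 3 \<le> 4 * t}) (top_of_set {0..1}) (\<lambda>t. 4 - 4 * t)"
          by (auto simp: continuous_map_in_subtopology intro!: continuous_intros)
      qed
      then show "continuous_map (subtopology (top_of_set {0..1}) {t \<in> topspace (top_of_set {0..1}). 3 \<le> 4 * t}) X
          (\<lambda>t. d (4 - 4 * t))"
        unfolding subtopology_Collect_top_of_set comp_def .
      show "detour \<delta> (\<sigma> \<circ> d) t = d (4 - 4 * t)" if "4 * t = 3" for t
      proof -
        have "t = 3/4" using that by simp
        show ?thesis unfolding \<open>t = 3/4\<close> using \<open>\<sigma> (d 1) = d 1\<close> by (simp add: detour_def)
      qed
    qed (auto intro!: continuous_intros)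
    moreover have h01: "h 0 = x" "h 1 = x" using \<delta> d by (auto simp: h_def detour_def)
    ultimately have loop: "h \<in> loops_at X x" by (simp add: loops_at_def)
    have fh: "f (h t) = detour g (f \<circ> d) t" if t: "t \<in> {0..1}" for t
    proof -
      have "d (2 * (2 * t - 1)) \<in> topspace X" if "\<not> 2 * t \<le> 1" "4 * t \<le> 3"
        using that by (intro d_in) auto
      then show ?thesis
        using t \<delta>(3)[of "2 * t"] f_\<sigma>[of "d (2 * (2 * t - 1))"]
        by (auto simp: h_def detour_def min_def algebra_simps)
    qed
    have pfd: "pathin Y (f \<circ> d)" using d(1) continuous_f by (rule pathin_compose)
    have eq0: "g 1 = (f \<circ> d) 0" using pg d by simp
    have "homotopic_with (\<lambda>k. k 0 = f x \<and> k 1 = f x) (top_of_set {0..1}) Y g (detour g (f \<circ> d))"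
      using homotopic_detour[OF pg(1) pfd eq0] unfolding pg(2,3) .
    moreover have "homotopic_with (\<lambda>k. k 0 = f x \<and> k 1 = f x) (top_of_set {0..1}) Y (detour g (f \<circ> d)) (f \<circ> h)"
    proof (rule homotopic_with_equal)
      show "continuous_map (top_of_set {0..1}) Y (detour g (f \<circ> d))"
        using pathin_detour[OF pg(1) pfd eq0] by (simp only: pathin_def)
      show "detour g (f \<circ> d) 0 = f x \<and> detour g (f \<circ> d) 1 = f x" by (simp add: detour_def pg d)
      show "(f \<circ> h) 0 = f x \<and> (f \<circ> h) 1 = f x" by (simp add: h01)
      show "detour g (f \<circ> d) t = (f \<circ> h) t" if "t \<in> topspace (top_of_set {0..1})" for t
        using fh that by (simp only: topspace_euclidean_subtopology comp_apply)
    qed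
    ultimately have "homotopic_with (\<lambda>k. k 0 = f x \<and> k 1 = f x) (top_of_set {0..1}) Y g (f \<circ> h)"
      by (rule homotopic_with_trans)
    moreover have "f \<circ> h \<in> loops_at Y (f x)"
      using loop continuous_f by (auto simp: loops_at_def intro: pathin_compose)
    ultimately have "(g, f \<circ> h) \<in> loop_homotopy Y (f x)" using g by (simp add: loop_homotopy_def)
    then show thesis using that loop by blast
  qed
qed

theorem pi1_surjective_quotient:
  assumes paths: "\<And>x. x \<in> topspace X \<Longrightarrow> \<exists>d. pathin X d \<and> d 0 = x \<and> j (d 1) = 0"
  shows "pi1_surjective X Y f"
  unfolding pi1_surjective_def
proof (intro ballI subset_antisym subsetI)
  fix x C assume x: "x \<in> topspace X" and "C \<in> pi1_map Y f x ` pi1 X x"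
  then obtain g where g: "g \<in> loops_at X x" "C = pi1_map Y f x (loop_homotopy X x `` {g})"
    by (auto simp: pi1_def quotient_def)
  moreover have "f \<circ> g \<in> loops_at Y (f x)"
    using g(1) continuous_f by (auto simp: loops_at_def intro: pathin_compose)
  ultimately show "C \<in> pi1 Y (f x)"
    by (simp add: pi1_map_class[OF continuous_f] pi1_def quotientI)
next
  fix x C assume x: "x \<in> topspace X" and "C \<in> pi1 Y (f x)"
  then obtain g where g: "g \<in> loops_at Y (f x)" "C = loop_homotopy Y (f x) `` {g}"
    by (auto simp: pi1_def quotient_def)
  obtain d where "pathin X d" "d 0 = x" "j (d 1) = 0" using paths[OF x] by blast
  then obtain h where h: "h \<in> loops_at X x" "(g, f \<circ> h) \<in> loop_homotopy Y (f x)"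
    using loop_lifting[OF x g(1)] by metis
  have "C = loop_homotopy Y (f x) `` {f \<circ> h}"
    unfolding g(2)
    by (auto intro: loop_homotopy_trans[OF h(2)] loop_homotopy_trans[OF loop_homotopy_sym[OF h(2)]])
  then have "C = pi1_map Y f x (loop_homotopy X x `` {h})"
    by (simp add: pi1_map_class[OF continuous_f h(1)])
  moreover have "loop_homotopy X x `` {h} \<in> pi1 X x"
    using h(1) by (simp add: pi1_def quotientI)
  ultimately show "C \<in> pi1_map Y f x ` pi1 X x" by blast
qed

end

section \<open>Foldings\<close>

text \<open>On points, \<open>p\<close> is the orbit map of \<open>\<tau>\<close> times conjugation.
  For compact \<open>M\<close> the quotient topology comes for free in
  \<open>folding_quotient_map\<close>, so the constructions below only keep track of continuity,
  image and fibres.\<close>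

definition folding ::
    "'a::topological_space set \<Rightarrow> ('a \<Rightarrow> 'a) \<Rightarrow> 'b::topological_space set \<Rightarrow> ('a \<times> complex \<Rightarrow> 'b) \<Rightarrow> bool" where
  "folding M \<tau> N p \<longleftrightarrow> continuous_on (M \<times> sphere 0 1) p \<and> p ` (M \<times> sphere 0 1) = N \<and>
     (\<forall>m\<in>M. \<forall>w\<in>sphere 0 1. \<forall>m'\<in>M. \<forall>w'\<in>sphere 0 1.
        p (m, w) = p (m', w') \<longleftrightarrow> m' = m \<and> w' = w \<or> m' = \<tau> m \<and> w' = cnj w)"

lemma foldingI:
  assumes "continuous_on (M \<times> sphere 0 1) p"
    and "\<And>m w. m \<in> M \<Longrightarrow> norm w = 1 \<Longrightarrow> p (m, w) \<in> N"
    and "\<And>n. n \<in> N \<Longrightarrow> \<exists>m\<in>M. \<exists>w. norm w = 1 \<and> p (m, w) = n"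
    and "\<And>m w m' w'. m \<in> M \<Longrightarrow> norm w = 1 \<Longrightarrow> m' \<in> M \<Longrightarrow> norm w' = 1 \<Longrightarrow>
      p (m, w) = p (m', w') \<longleftrightarrow> m' = m \<and> w' = w \<or> m' = \<tau> m \<and> w' = cnj w"
  shows "folding M \<tau> N p"
  unfolding folding_def
proof (intro conjI ballI assms(1))
  show "p ` (M \<times> sphere 0 1) = N"
  proof
    show "p ` (M \<times> sphere 0 1) \<subseteq> N" using assms(2) by auto
    show "N \<subseteq> p ` (M \<times> sphere 0 1)"
    proof
      fix n assume "n \<in> N"
      then obtain m w where "m \<in> M" "norm w = 1" "p (m, w) = n" using assms(3) by blast
      then show "n \<in> p ` (M \<times> sphere 0 1)" by (intro image_eqI[of _ _ "(m, w)"]) auto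
    qed
  qed
qed (use assms(4) in \<open>simp\<close>)

lemma folding_continuous: "folding M \<tau> N p \<Longrightarrow> continuous_on (M \<times> sphere 0 1) p"
  by (simp add: folding_def)

lemma folding_in: "folding M \<tau> N p \<Longrightarrow> m \<in> M \<Longrightarrow> norm w = 1 \<Longrightarrow> p (m, w) \<in> N"
  by (auto simp: folding_def)

lemma folding_onto:
  assumes "folding M \<tau> N p" "n \<in> N"
  obtains m w where "m \<in> M" "norm w = 1" "p (m, w) = n"
proof -
  have "n \<in> p ` (M \<times> sphere 0 1)" using assms by (simp add: folding_def)
  then show thesis using that by auto
qed

lemma folding_fibre:
  "folding M \<tau> N p \<Longrightarrow> m \<in> M \<Longrightarrow> norm w = 1 \<Longrightarrow> m' \<in> M \<Longrightarrow> norm w' = 1 \<Longrightarrow>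
     p (m, w) = p (m', w') \<longleftrightarrow> m' = m \<and> w' = w \<or> m' = \<tau> m \<and> w' = cnj w"
  by (simp add: folding_def)

text \<open>The circles \<open>{t} \<times> S\<^sup>1\<close> go to nested ellipses around the slit \<open>[-1/2, 1/2]\<close>, which is the image of
  \<open>t = 0\<close>; they are round as soon as \<open>\<bar>t\<bar> \<ge> 1\<close>.\<close>

definition semiaxis :: "real \<Rightarrow> real" where
  "semiaxis t = max \<bar>t\<bar> ((1 + \<bar>t\<bar>) / 2)"

definition fold_line :: "real \<times> complex \<Rightarrow> complex" where
  "fold_line p = Complex (semiaxis (fst p) * Re (snd p)) (fst p * Im (snd p))"

lemma circle_eq: "norm (w::complex) = 1 \<Longrightarrow> (Re w)\<^sup>2 + (Im w)\<^sup>2 = 1"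
  by (simp add: flip: cmod_power2)

lemma semiaxis_pos: "0 < semiaxis t"
  by (auto simp: semiaxis_def max_def)

lemma semiaxis_abs_less: "\<bar>t\<bar> < \<bar>u\<bar> \<Longrightarrow> semiaxis t < semiaxis u"
  by (auto simp: semiaxis_def max_def)

lemma semiaxis_abs: "\<bar>t\<bar> = \<bar>u\<bar> \<Longrightarrow> semiaxis t = semiaxis u"
  by (simp add: semiaxis_def)

lemma norm_fold_line_sq:
  "(norm (fold_line (t, w)))\<^sup>2 = (semiaxis t)\<^sup>2 * (Re w)\<^sup>2 + t\<^sup>2 * (Im w)\<^sup>2"
  by (simp add: fold_line_def cmod_power2 power_mult_distrib)

lemma norm_fold_line_le: "norm w = 1 \<Longrightarrow> norm (fold_line (t, w)) \<le> semiaxis t"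
proof (rule power2_le_imp_le)
  assume w: "norm w = 1"
  have "t\<^sup>2 \<le> (semiaxis t)\<^sup>2"
    by (rule power2_le_iff_abs_le[THEN iffD2]) (auto simp: semiaxis_def)
  then have "(semiaxis t)\<^sup>2 * (Re w)\<^sup>2 + t\<^sup>2 * (Im w)\<^sup>2 \<le> (semiaxis t)\<^sup>2 * (Re w)\<^sup>2 + (semiaxis t)\<^sup>2 * (Im w)\<^sup>2"
    by (simp add: mult_right_mono)
  also have "\<dots> = (semiaxis t)\<^sup>2" using circle_eq[OF w] by (simp flip: distrib_left)
  finally show "(norm (fold_line (t, w)))\<^sup>2 \<le> (semiaxis t)\<^sup>2" unfolding norm_fold_line_sq .
qed (use semiaxis_pos[of t] in simp)

lemma norm_fold_line_less: "norm w = 1 \<Longrightarrow> \<bar>t\<bar> < 1 \<Longrightarrow> norm (fold_line (t, w)) < 1"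
  by (rule le_less_trans[OF norm_fold_line_le]) (auto simp: semiaxis_def)

lemma norm_fold_line:
  assumes "norm w = 1" "1 \<le> \<bar>t\<bar>"
  shows "norm (fold_line (t, w)) = \<bar>t\<bar>"
proof -
  have "semiaxis t = \<bar>t\<bar>" using assms by (simp add: semiaxis_def max_def)
  then have "(norm (fold_line (t, w)))\<^sup>2 = t\<^sup>2"
    unfolding norm_fold_line_sq using circle_eq[OF assms(1)] by (simp flip: distrib_left)
  then show ?thesis by (metis norm_ge_zero power2_abs power2_eq_iff_nonneg abs_ge_zero)
qed

text \<open>If \<open>\<bar>t\<bar> < \<bar>t'\<bar>\<close>, both semiaxes of the second ellipse
  are strictly longer, so both squared coordinates of \<open>w'\<close> are at most those of
  \<open>w\<close>. Either pair adds up to 1, so they agree, and then strictness forces both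
  coordinates of \<open>w\<close> to vanish.\<close>

lemma fold_line_abs_le:
  assumes w: "norm w = 1" "norm w' = 1" and eq: "fold_line (t, w) = fold_line (t', w')"
  shows "\<bar>t'\<bar> \<le> \<bar>t\<bar>"
proof (rule ccontr)
  assume "\<not> \<bar>t'\<bar> \<le> \<bar>t\<bar>"
  then have less: "\<bar>t\<bar> < \<bar>t'\<bar>" by simp
  let ?A = "semiaxis t" and ?B = "semiaxis t'"
  have AB: "0 < ?A" "?A < ?B" using semiaxis_pos semiaxis_abs_less less by auto
  have eqs: "?A * Re w = ?B * Re w'" "t * Im w = t' * Im w'"
    using eq by (auto simp: fold_line_def complex_eq_iff)
  have A2: "?A\<^sup>2 < ?B\<^sup>2" using AB by (simp add: power_strict_mono)
  have t2: "t\<^sup>2 < t'\<^sup>2" using less power_strict_mono[of "\<bar>t\<bar>" "\<bar>t'\<bar>" 2] by simp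
  have e1: "?A\<^sup>2 * (Re w)\<^sup>2 = ?B\<^sup>2 * (Re w')\<^sup>2" and e2: "t\<^sup>2 * (Im w)\<^sup>2 = t'\<^sup>2 * (Im w')\<^sup>2"
    using eqs by (metis power_mult_distrib)+
  have B2: "0 < ?B\<^sup>2" and t'2: "0 < t'\<^sup>2" using AB t2 by (auto intro: le_less_trans[of _ "t\<^sup>2"])
  have le1: "(Re w')\<^sup>2 \<le> (Re w)\<^sup>2"
  proof -
    have "?B\<^sup>2 * (Re w')\<^sup>2 \<le> ?B\<^sup>2 * (Re w)\<^sup>2"
      unfolding e1[symmetric] using A2 by (intro mult_right_mono) auto
    then show ?thesis using B2 by simp
  qed
  have le2: "(Im w')\<^sup>2 \<le> (Im w)\<^sup>2"
  proof -
    have "t'\<^sup>2 * (Im w')\<^sup>2 \<le> t'\<^sup>2 * (Im w)\<^sup>2"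
      unfolding e2[symmetric] using t2 by (intro mult_right_mono) auto
    then show ?thesis using t'2 by simp
  qed
  have "(Re w)\<^sup>2 = (Re w')\<^sup>2" "(Im w)\<^sup>2 = (Im w')\<^sup>2"
    using le1 le2 circle_eq[OF w(1)] circle_eq[OF w(2)] by linarith+
  with e1 e2 have "(Re w)\<^sup>2 = 0" "(Im w)\<^sup>2 = 0" using A2 t2 by auto
  then show False using circle_eq[OF w(1)] by simp
qed

text \<open>Equal images lie on the same ellipse, which fixes \<open>\<bar>t\<bar>\<close> and
  \<open>Re w\<close>. On the slit \<open>t = 0\<close> the sign of \<open>Im w\<close> is lost;
  there the second alternative has \<open>- t = t\<close>.\<close>

lemma fold_line_eq_iff:
  assumes w: "norm w = 1" "norm w' = 1"
  shows "fold_line (t, w) = fold_line (t', w') \<longleftrightarrow> t' = t \<and> w' = w \<or> t' = - t \<and> w' = cnj w"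
proof
  assume eq: "fold_line (t, w) = fold_line (t', w')"
  have abs: "\<bar>t\<bar> = \<bar>t'\<bar>"
    using fold_line_abs_le[OF w eq] fold_line_abs_le[OF w(2,1) eq[symmetric]] by simp
  have Re: "Re w = Re w'"
    using eq semiaxis_abs[OF abs] semiaxis_pos[of t'] by (simp add: fold_line_def)
  have Im: "t * Im w = t' * Im w'" using eq by (simp add: fold_line_def)
  have "(Im w)\<^sup>2 = (Im w')\<^sup>2" using circle_eq[OF w(1)] circle_eq[OF w(2)] Re by simp
  then have "Im w' = Im w \<or> Im w' = - Im w" by (auto simp: power2_eq_iff)
  moreover have "t' = t \<or> t' = - t" using abs by (auto simp: abs_eq_iff)
  ultimately show "t' = t \<and> w' = w \<or> t' = - t \<and> w' = cnj w"
    using Re Im by (auto simp: complex_eq_iff)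
next
  assume "t' = t \<and> w' = w \<or> t' = - t \<and> w' = cnj w"
  then show "fold_line (t, w) = fold_line (t', w')"
    by (auto simp: fold_line_def semiaxis_def)
qed

lemma continuous_fold_line: "continuous_on S fold_line"
proof -
  have "fold_line = (\<lambda>p. complex_of_real (semiaxis (fst p) * Re (snd p)) + \<i> * complex_of_real (fst p * Im (snd p)))"
    by (auto simp: fold_line_def complex_eq_iff fun_eq_iff)
  moreover have "continuous_on S \<dots>"
    unfolding semiaxis_def by (intro continuous_intros) auto
  ultimately show ?thesis by (simp only:)
qed

text \<open>Outside the open unit disc the ellipses are circles and polar coordinates serve. Inside,
  a point off the real axis lies on some ellipse by the intermediate value theorem; on the real axis
  the parameters are given directly, as the ellipses degenerate to the slit at
  \<open>t = 0\<close>.\<close>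

lemma fold_line_onto: "\<exists>t w. norm w = 1 \<and> fold_line (t, w) = z"
proof (cases "1 \<le> norm z")
  case True
  have "fold_line (norm z, z / norm z) = z"
    using True by (auto simp: fold_line_def semiaxis_def max_def complex_eq_iff Re_divide_of_real Im_divide_of_real)
  moreover have "norm (z / norm z) = 1" using True by (auto simp: norm_divide)
  ultimately show ?thesis by blast
next
  case False
  define x y where "x = Re z" and "y = Im z"
  have xy: "x\<^sup>2 + y\<^sup>2 < 1"
    using False by (simp add: x_def y_def abs_square_less_1 flip: cmod_power2)
  \<comment> \<open>The ellipse equation \<open>(x / semiaxis t)^2 + (y / t)^2 = 1\<close> with
    denominators cleared.\<close>
  have found: ?thesis if t: "0 < t" "t < 1" and eq: "y\<^sup>2 * (semiaxis t)\<^sup>2 + x\<^sup>2 * t\<^sup>2 = (semiaxis t)\<^sup>2 * t\<^sup>2" for t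
  proof -
    define w where "w = Complex (x / semiaxis t) (y / t)"
    have A: "semiaxis t \<noteq> 0" using semiaxis_pos[of t] by simp
    have "(norm w)\<^sup>2 = x\<^sup>2 / (semiaxis t)\<^sup>2 + y\<^sup>2 / t\<^sup>2"
      by (simp add: w_def cmod_power2 power_divide)
    also have "\<dots> = (y\<^sup>2 * (semiaxis t)\<^sup>2 + x\<^sup>2 * t\<^sup>2) / ((semiaxis t)\<^sup>2 * t\<^sup>2)"
      using A t by (simp add: field_simps)
    also have "\<dots> = 1" unfolding eq using A t by simp
    finally have "norm w = 1" by (simp add: power2_eq_1_iff) (smt (verit) norm_ge_zero)
    moreover have "fold_line (t, w) = z"
      using A t by (simp add: fold_line_def w_def x_def y_def complex_eq_iff)
    ultimately show ?thesis by blast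
  qed
  show ?thesis
  proof (cases "y = 0")
    case True
    have x1: "\<bar>x\<bar> < 1" using xy True by (simp add: abs_square_less_1)
    show ?thesis
    proof (cases "\<bar>x\<bar> \<le> 1/2")
      case True
      define w where "w = Complex (2 * x) (sqrt (1 - (2 * x)\<^sup>2))"
      have "(2 * x)\<^sup>2 \<le> 1" using True by (subst abs_square_le_1) simp
      then have "norm w = 1" by (simp add: w_def cmod_def)
      moreover have "fold_line (0, w) = z"
        using \<open>y = 0\<close> by (simp add: fold_line_def semiaxis_def w_def x_def y_def complex_eq_iff)
      ultimately show ?thesis by blast
    next
      case False
      \<comment> \<open>Solves \<open>(1 + t) / 2 = \<bar>x\<bar>\<close> for \<open>t\<close>, so
        that \<open>z\<close> is an end of the horizontal axis.\<close>
      have "semiaxis (2 * \<bar>x\<bar> - 1) = \<bar>x\<bar>" using False x1 by (auto simp: semiaxis_def max_def)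
      then have "fold_line (2 * \<bar>x\<bar> - 1, of_real (sgn x)) = z"
        using \<open>y = 0\<close> by (simp add: fold_line_def x_def y_def complex_eq_iff abs_mult_sgn)
      moreover have "norm (of_real (sgn x) :: complex) = 1" using False by (auto simp: sgn_if)
      ultimately show ?thesis by blast
    qed
  next
    case False
    \<comment> \<open>The sign of \<open>g t\<close> tells on which side of the ellipse
      \<open>z\<close> lies: \<open>g 0 = - y^2 / 4\<close> and
      \<open>g 1 = 1 - x^2 - y^2\<close>.\<close>
    define g where "g t = (semiaxis t)\<^sup>2 * t\<^sup>2 - y\<^sup>2 * (semiaxis t)\<^sup>2 - x\<^sup>2 * t\<^sup>2" for t
    have "g 0 < 0" "0 < g 1" using False xy by (auto simp: g_def semiaxis_def)
    moreover have "continuous_on {0..1} g"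
      unfolding g_def semiaxis_def by (intro continuous_intros) auto
    ultimately obtain t where t: "0 \<le> t" "t \<le> 1" "g t = 0"
      using IVT'[of g 0 0 1] by force
    with \<open>g 0 < 0\<close> \<open>0 < g 1\<close> have "0 < t" "t < 1"
      by (metis less_irrefl order_le_less)+
    then show ?thesis using found[of t] t(3) by (simp add: g_def)
  qed
qed

lemma folding_fold_line:
  assumes "1 \<le> L"
  shows "folding {-L..L} uminus (cball 0 L) fold_line"
proof (rule foldingI[OF continuous_fold_line])
  have le_iff: "norm (fold_line (t, w)) \<le> L \<longleftrightarrow> \<bar>t\<bar> \<le> L" if "norm w = 1" for t w
    using norm_fold_line[OF that, of t] norm_fold_line_less[OF that, of t] assms by linarith
  fix t w assume "t \<in> {-L..L}" "norm (w::complex) = 1"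
  then show "fold_line (t, w) \<in> cball 0 L" using le_iff by (auto simp: abs_le_iff)
next
  fix z :: complex assume z: "z \<in> cball 0 L"
  obtain t w where tw: "norm w = 1" "fold_line (t, w) = z" using fold_line_onto by blast
  then have "\<bar>t\<bar> \<le> L"
    using norm_fold_line[OF tw(1), of t] z assms by (cases "1 \<le> \<bar>t\<bar>") auto
  then show "\<exists>t\<in>{-L..L}. \<exists>w. norm w = 1 \<and> fold_line (t, w) = z"
    using tw by (intro bexI[of _ t]) auto
qed (use fold_line_eq_iff in auto)

text \<open>The balls of the two gauges are squares and cylinders, the shapes that
  \<open>fold_plane\<close> matches from size 1 on.\<close>

definition square_gauge :: "complex \<Rightarrow> real" where
  "square_gauge y = max \<bar>Re y\<bar> \<bar>Im y\<bar>"

definition cylinder_gauge :: "complex \<times> real \<Rightarrow> real" where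
  "cylinder_gauge v = max (norm (fst v)) \<bar>snd v\<bar>"

definition fold_plane :: "complex \<times> complex \<Rightarrow> complex \<times> real" where
  "fold_plane p = (fold_line (Im (fst p), snd p), Re (fst p))"

lemma cylinder_gauge_fold_plane:
  assumes "norm w = 1"
  shows "1 \<le> square_gauge y \<Longrightarrow> cylinder_gauge (fold_plane (y, w)) = square_gauge y"
    and "square_gauge y < 1 \<Longrightarrow> cylinder_gauge (fold_plane (y, w)) < 1"
  using norm_fold_line[OF assms, of "Im y"] norm_fold_line_less[OF assms, of "Im y"]
  unfolding square_gauge_def cylinder_gauge_def fold_plane_def fst_conv snd_conv by linarith+

lemma cylinder_gauge_fold_plane_iff:
  assumes "norm w = 1" "1 \<le> L"
  shows "cylinder_gauge (fold_plane (y, w)) \<le> L \<longleftrightarrow> square_gauge y \<le> L"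
    and "cylinder_gauge (fold_plane (y, w)) = L \<longleftrightarrow> square_gauge y = L"
    and "cylinder_gauge (fold_plane (y, w)) < L \<longleftrightarrow> square_gauge y < L"
  using cylinder_gauge_fold_plane[OF assms(1), of y] assms(2) by (cases "1 \<le> square_gauge y"; force)+

lemma continuous_fold_plane: "continuous_on S fold_plane"
  unfolding fold_plane_def
  by (intro continuous_intros continuous_on_compose2[OF continuous_fold_line[of UNIV]]) auto

lemma fold_plane_eq_iff:
  assumes "norm w = 1" "norm w' = 1"
  shows "fold_plane (y, w) = fold_plane (y', w') \<longleftrightarrow> y' = y \<and> w' = w \<or> y' = cnj y \<and> w' = cnj w"
  using fold_line_eq_iff[OF assms, of "Im y" "Im y'"] by (auto simp: fold_plane_def complex_eq_iff)

lemma fold_plane_onto: "\<exists>y w. norm w = 1 \<and> fold_plane (y, w) = v"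
proof -
  obtain t w where "norm w = 1" "fold_line (t, w) = fst v" using fold_line_onto by blast
  then show ?thesis by (intro exI[of _ "Complex (snd v) t"] exI[of _ w]) (simp add: fold_plane_def)
qed

lemma folding_fold_plane:
  assumes "1 \<le> L"
  shows "folding {y. square_gauge y \<le> L} cnj {v. cylinder_gauge v \<le> L} fold_plane"
proof (rule foldingI[OF continuous_fold_plane])
  fix v assume "v \<in> {v. cylinder_gauge v \<le> L}"
  moreover obtain y w where "norm w = 1" "fold_plane (y, w) = v" using fold_plane_onto by blast
  ultimately show "\<exists>y\<in>{y. square_gauge y \<le> L}. \<exists>w. norm w = 1 \<and> fold_plane (y, w) = v"
    using cylinder_gauge_fold_plane_iff(1)[OF _ assms] by auto
qed (use cylinder_gauge_fold_plane_iff(1)[OF _ assms] fold_plane_eq_iff in auto)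

text \<open>Real translations pass through the folding. This is why the balls of the source are
  lined up in the direction \<open>1\<close> and those of the target in the direction
  \<open>(0, 1)\<close>.\<close>

lemma fold_plane_translate:
  "fold_plane (complex_of_real a + y, w) = (0, a) + fold_plane (y, w)"
  by (simp add: fold_plane_def)

section \<open>Gluing two foldings\<close>

text \<open>\<open>M\<close> and \<open>N\<close> are doubles: \<open>\<alpha>\<close> and
  \<open>\<beta>\<close> embed two copies of \<open>K\<close> that meet where \<open>E\<close>
  holds, and likewise for \<open>K'\<close> and \<open>E'\<close>. Applying \<open>g\<close> in both
  halves is consistent because \<open>g\<close> matches \<open>E\<close> with \<open>E'\<close>.
  Compactness of \<open>K\<close> makes the halves closed and the embeddings homeomorphisms, so the
  two formulas paste continuously.\<close>

lemma doubling:
  fixes \<alpha> \<beta> :: "'a::t2_space \<Rightarrow> 'm::t2_space" and \<alpha>' \<beta>' :: "'b::topological_space \<Rightarrow> 'n::topological_space"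
  assumes K: "compact K"
    and \<alpha>: "continuous_on K \<alpha>" "inj_on \<alpha> K" and \<beta>: "continuous_on K \<beta>" "inj_on \<beta> K"
    and M: "M = \<alpha> ` K \<union> \<beta> ` K"
    and glue: "\<And>x y. x \<in> K \<Longrightarrow> y \<in> K \<Longrightarrow> \<alpha> x = \<beta> y \<longleftrightarrow> x = y \<and> E y"
    and \<alpha>': "continuous_on K' \<alpha>'" "inj_on \<alpha>' K'" and \<beta>': "continuous_on K' \<beta>'" "inj_on \<beta>' K'"
    and N: "N = \<alpha>' ` K' \<union> \<beta>' ` K'"
    and glue': "\<And>x y. x \<in> K' \<Longrightarrow> y \<in> K' \<Longrightarrow> \<alpha>' x = \<beta>' y \<longleftrightarrow> x = y \<and> E' y"
    and g: "folding K \<rho> K' g"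
    and E: "\<And>y w. y \<in> K \<Longrightarrow> norm w = 1 \<Longrightarrow> E' (g (y, w)) \<longleftrightarrow> E y"
    and \<rho>: "\<And>y. y \<in> K \<Longrightarrow> \<rho> y \<in> K" "\<And>y. y \<in> K \<Longrightarrow> E (\<rho> y) \<longleftrightarrow> E y"
    and \<tau>: "\<And>y. y \<in> K \<Longrightarrow> \<tau> (\<alpha> y) = \<alpha> (\<rho> y)" "\<And>y. y \<in> K \<Longrightarrow> \<tau> (\<beta> y) = \<beta> (\<rho> y)"
  obtains p where "folding M \<tau> N p"
    "\<And>y w. y \<in> K \<Longrightarrow> norm w = 1 \<Longrightarrow> p (\<alpha> y, w) = \<alpha>' (g (y, w))"
proof -
  define p where "p = (\<lambda>(m, w). if m \<in> \<alpha> ` K then \<alpha>' (g (the_inv_into K \<alpha> m, w)) else \<beta>' (g (the_inv_into K \<beta> m, w)))"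
  note g_in = folding_in[OF g]
  have p\<alpha>: "p (\<alpha> y, w) = \<alpha>' (g (y, w))" if "y \<in> K" for y w
    using that \<alpha>(2) by (simp add: p_def the_inv_into_f_f)
  have p\<beta>: "p (\<beta> y, w) = \<beta>' (g (y, w))" if y: "y \<in> K" and w: "norm w = 1" for y w
  proof (cases "\<beta> y \<in> \<alpha> ` K")
    case True
    then obtain x where x: "x \<in> K" "\<alpha> x = \<beta> y" by auto
    then have "x = y" "E y" using glue y by auto
    then have "\<alpha>' (g (y, w)) = \<beta>' (g (y, w))" using glue' E g_in y w by blast
    then show ?thesis using p\<alpha>[OF y] x \<open>x = y\<close> by metis
  next
    case False
    then show ?thesis using y \<beta>(2) by (simp add: p_def the_inv_into_f_f)
  qed
  let ?C = "sphere 0 1 :: complex set"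
  have piece: "continuous_on (\<gamma> ` K \<times> ?C) p"
    if \<gamma>: "continuous_on K \<gamma>" "inj_on \<gamma> K" and \<gamma>': "continuous_on K' \<gamma>'"
      and eq: "\<And>y w. y \<in> K \<Longrightarrow> norm w = 1 \<Longrightarrow> p (\<gamma> y, w) = \<gamma>' (g (y, w))" for \<gamma> :: "'a \<Rightarrow> 'm" and \<gamma>' :: "'b \<Rightarrow> 'n"
  proof -
    have "continuous_on (\<gamma> ` K \<times> ?C) (\<lambda>q. (the_inv_into K \<gamma> (fst q), snd q))"
      using continuous_on_inv_into[OF \<gamma>(1) K \<gamma>(2)]
      by (intro continuous_on_Pair continuous_on_compose2[of "\<gamma> ` K" "the_inv_into K \<gamma>" _ fst]
          continuous_on_fst continuous_on_snd continuous_on_id) auto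
    moreover have "(\<lambda>q. (the_inv_into K \<gamma> (fst q), snd q)) ` (\<gamma> ` K \<times> ?C) \<subseteq> K \<times> ?C"
      using \<gamma>(2) by (auto simp: the_inv_into_f_f)
    ultimately have "continuous_on (\<gamma> ` K \<times> ?C) (\<lambda>q. g (the_inv_into K \<gamma> (fst q), snd q))"
      using continuous_on_compose2[OF folding_continuous[OF g]] by blast
    then have "continuous_on (\<gamma> ` K \<times> ?C) (\<lambda>q. \<gamma>' (g (the_inv_into K \<gamma> (fst q), snd q)))"
      by (rule continuous_on_compose2[OF \<gamma>']) (use \<gamma>(2) g_in in \<open>auto simp: the_inv_into_f_f\<close>)
    then show ?thesis
      by (rule continuous_on_eq) (use \<gamma>(2) eq in \<open>auto simp: the_inv_into_f_f\<close>)
  qed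
  have "continuous_on (\<alpha> ` K \<times> ?C \<union> \<beta> ` K \<times> ?C) p"
  proof (rule continuous_on_closed_Un)
    show "closed (\<alpha> ` K \<times> ?C)"
      by (intro closed_Times closed_sphere compact_imp_closed compact_continuous_image \<alpha>(1) K)
    show "closed (\<beta> ` K \<times> ?C)"
      by (intro closed_Times closed_sphere compact_imp_closed compact_continuous_image \<beta>(1) K)
    show "continuous_on (\<alpha> ` K \<times> ?C) p" using piece[OF \<alpha> \<alpha>'(1)] p\<alpha> by blast
    show "continuous_on (\<beta> ` K \<times> ?C) p" using piece[OF \<beta> \<beta>'(1)] p\<beta> by blast
  qed
  then have cont: "continuous_on (M \<times> ?C) p" unfolding M by (simp add: Sigma_Un_distrib1)
  note fib = folding_fibre[OF g]
  \<comment> \<open>Points of different halves can have equal images only over the seam, and there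
    they also belong to the same half.\<close>
  have fib_\<alpha>\<beta>: "p (\<alpha> y, w) = p (\<beta> y', w') \<longleftrightarrow>
      \<beta> y' = \<alpha> y \<and> w' = w \<or> \<beta> y' = \<tau> (\<alpha> y) \<and> w' = cnj w"
    if "y \<in> K" "y' \<in> K" "norm w = 1" "norm w' = 1" for y y' w w'
  proof -
    have "p (\<alpha> y, w) = p (\<beta> y', w') \<longleftrightarrow> g (y, w) = g (y', w') \<and> E y'"
      using that glue' E g_in by (simp add: p\<alpha> p\<beta>)
    also have "\<dots> \<longleftrightarrow> (y = y' \<and> E y' \<and> w' = w \<or> \<rho> y = y' \<and> E y' \<and> w' = cnj w)"
      using that fib[of y w y' w'] by auto
    also have "\<dots> \<longleftrightarrow> \<alpha> y = \<beta> y' \<and> w' = w \<or> \<alpha> (\<rho> y) = \<beta> y' \<and> w' = cnj w"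
      using that glue \<rho>(1) by auto
    finally show ?thesis using that \<tau>(1) by auto
  qed
  have fib_\<beta>\<alpha>: "p (\<beta> y, w) = p (\<alpha> y', w') \<longleftrightarrow>
      \<alpha> y' = \<beta> y \<and> w' = w \<or> \<alpha> y' = \<tau> (\<beta> y) \<and> w' = cnj w"
    if "y \<in> K" "y' \<in> K" "norm w = 1" "norm w' = 1" for y y' w w'
  proof -
    have "p (\<beta> y, w) = p (\<alpha> y', w') \<longleftrightarrow> g (y', w') = g (y, w) \<and> E y"
      using that glue'[of "g (y', w')" "g (y, w)"] E[of y w] g_in by (auto simp add: p\<alpha> p\<beta>)
    also have "\<dots> \<longleftrightarrow> (y' = y \<and> E y \<and> w' = w \<or> y' = \<rho> y \<and> E (\<rho> y) \<and> w' = cnj w)"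
      using that fib[of y w y' w'] \<rho>(2) by auto
    also have "\<dots> \<longleftrightarrow> \<alpha> y' = \<beta> y \<and> w' = w \<or> \<alpha> y' = \<beta> (\<rho> y) \<and> w' = cnj w"
      using that glue \<rho>(1) by auto
    finally show ?thesis using that \<tau>(2) by auto
  qed
  have fib_same: "\<gamma>' (g (y, w)) = \<gamma>' (g (y', w')) \<longleftrightarrow>
      \<gamma> y' = \<gamma> y \<and> w' = w \<or> \<gamma> y' = \<gamma> (\<rho> y) \<and> w' = cnj w"
    if "y \<in> K" "y' \<in> K" "norm w = 1" "norm w' = 1" "inj_on \<gamma> K" "inj_on \<gamma>' K'"
    for y y' w w' and \<gamma> :: "'a \<Rightarrow> 'm" and \<gamma>' :: "'b \<Rightarrow> 'n"
    using that fib[of y w y' w'] g_in \<rho>(1) by (simp add: inj_on_eq_iff)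
  have "folding M \<tau> N p"
  proof (rule foldingI[OF cont])
    show "p (m, w) \<in> N" if "m \<in> M" "norm w = 1" for m w
      using that g_in unfolding M N by (auto simp: p\<alpha> p\<beta>)
    show "\<exists>m\<in>M. \<exists>w. norm w = 1 \<and> p (m, w) = n" if n: "n \<in> N" for n
    proof -
      obtain v where v: "v \<in> K'" "n = \<alpha>' v \<or> n = \<beta>' v" using n unfolding N by blast
      obtain y w where yw: "y \<in> K" "norm w = 1" "g (y, w) = v" using folding_onto[OF g v(1)] .
      have "p (\<alpha> y, w) = \<alpha>' v" "p (\<beta> y, w) = \<beta>' v" using yw by (simp_all add: p\<alpha> p\<beta>)
      then show ?thesis using v(2) yw unfolding M by blast
    qed
    show "p (m, w) = p (m', w') \<longleftrightarrow> m' = m \<and> w' = w \<or> m' = \<tau> m \<and> w' = cnj w"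
      if ms: "m \<in> M" "norm w = 1" "m' \<in> M" "norm w' = 1" for m w m' w'
    proof -
      obtain y y' where y: "y \<in> K" "y' \<in> K" "m = \<alpha> y \<or> m = \<beta> y" "m' = \<alpha> y' \<or> m' = \<beta> y'"
        using ms unfolding M by blast
      from y(3,4) show ?thesis
      proof (elim disjE)
        assume "m = \<alpha> y" "m' = \<alpha> y'"
        then show ?thesis using fib_same[OF y(1,2) ms(2,4) \<alpha>(2) \<alpha>'(2)] y ms \<tau> by (simp add: p\<alpha>)
      next
        assume "m = \<beta> y" "m' = \<beta> y'"
        then show ?thesis using fib_same[OF y(1,2) ms(2,4) \<beta>(2) \<beta>'(2)] y ms \<tau> by (simp add: p\<beta>)
      next
        assume "m = \<alpha> y" "m' = \<beta> y'"
        then show ?thesis using fib_\<alpha>\<beta> y ms by simp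
      next
        assume "m = \<beta> y" "m' = \<alpha> y'"
        then show ?thesis using fib_\<beta>\<alpha> y ms by simp
      qed
    qed
  qed
  then show thesis using that p\<alpha> by blast
qed

section \<open>Spheres as doubles\<close>

definition stereographic :: "'v::euclidean_space \<times> real \<Rightarrow> 'v" where
  "stereographic p = fst p /\<^sub>R (1 - snd p)"

lemma stereographic_inverse_stereographic [simp]: "stereographic (inverse_stereographic v) = v"
proof -
  define r where "r = (norm v)\<^sup>2 + 1"
  have r: "r \<noteq> 0" unfolding r_def by (smt (verit) zero_le_power2)
  have "fst (inverse_stereographic v) = (2 / r) *\<^sub>R v" by (simp add: inverse_stereographic_def r_def)
  moreover have "1 - snd (inverse_stereographic v) = 2 / r"
  proof -
    have "snd (inverse_stereographic v) = (r - 2) / r" by (simp add: inverse_stereographic_def r_def)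
    then show ?thesis using r by (simp add: diff_divide_distrib)
  qed
  ultimately show ?thesis using r by (simp add: stereographic_def)
qed

lemma snd_inverse_stereographic_less: "snd (inverse_stereographic v) < 1"
proof -
  have "0 < (norm v)\<^sup>2 + 1" by (smt (verit) zero_le_power2)
  then show ?thesis by (simp add: inverse_stereographic_def)
qed

lemma inverse_stereographic_stereographic:
  assumes "norm p = 1" "snd p \<noteq> 1"
  shows "inverse_stereographic (stereographic p) = p"
proof -
  define h where "h = snd p"
  have sq: "(norm (fst p))\<^sup>2 = 1 - h\<^sup>2"
    using assms(1) norm_Pair[of "fst p" h] by (simp add: h_def real_sqrt_eq_1_iff)
  have h: "1 - h \<noteq> 0" using assms(2) by (simp add: h_def)
  have "(norm (stereographic p))\<^sup>2 = (1 - h\<^sup>2) / (1 - h)\<^sup>2"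
    using sq by (simp add: stereographic_def power_mult_distrib h_def divide_inverse power_inverse)
  also have "1 - h\<^sup>2 = (1 - h) * (1 + h)" by (simp add: power2_eq_square algebra_simps)
  also have "\<dots> / (1 - h)\<^sup>2 = (1 + h) / (1 - h)" unfolding power2_eq_square using h by simp
  finally have n: "(norm (stereographic p))\<^sup>2 = (1 + h) / (1 - h)" .
  have n1: "(norm (stereographic p))\<^sup>2 + 1 = 2 / (1 - h)" and n2: "(norm (stereographic p))\<^sup>2 - 1 = 2 * h / (1 - h)"
    unfolding n using h by (simp_all add: field_simps)
  show ?thesis
  proof -
    have e1: "2 / (2 / (1 - h)) = 1 - h" by simp
    have e2: "2 * h / (1 - h) / (2 / (1 - h)) = h" using h by simp
    have "(1 - h) *\<^sub>R stereographic p = fst p" using h by (simp add: stereographic_def h_def)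
    then show ?thesis
      unfolding inverse_stereographic_def n1 n2 e1 e2 by (simp add: h_def)
  qed
qed

lemma continuous_inverse_stereographic: "continuous_on S inverse_stereographic"
proof -
  have "(norm (v::'a))\<^sup>2 + 1 \<noteq> 0" for v by (smt (verit) zero_le_power2)
  then show ?thesis unfolding inverse_stereographic_def by (intro continuous_intros) auto
qed

lemma continuous_stereographic: "continuous_on {p. snd p \<noteq> 1} stereographic"
  unfolding stereographic_def by (intro continuous_intros) auto

text \<open>The chordal distance to the pole controls \<open>outer_chart\<close> at the
  origin.\<close>

lemma dist_pole_inverse_stereographic:
  "dist (inverse_stereographic v) (0, 1) = 2 / sqrt ((norm v)\<^sup>2 + 1)"
proof -
  define r where "r = (norm v)\<^sup>2 + 1"
  have r: "0 < r" unfolding r_def by (smt (verit) zero_le_power2)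
  have eq: "((norm v)\<^sup>2 - 1) / r - 1 = - 2 / r" using r by (simp add: r_def field_simps)
  have "(dist (inverse_stereographic v) (0, 1))\<^sup>2 = (2 / r)\<^sup>2 * (norm v)\<^sup>2 + (2 / r)\<^sup>2"
    by (simp add: inverse_stereographic_def dist_norm norm_Pair eq power_mult_distrib power_divide flip: r_def)
  also have "\<dots> = (2 / r)\<^sup>2 * r" by (simp add: r_def algebra_simps)
  also have "\<dots> = (2 / sqrt r)\<^sup>2" using r by (simp add: power2_eq_square power_divide field_simps)
  finally show ?thesis using r unfolding r_def by (simp add: power2_eq_iff_nonneg)
qed

text \<open>The shapes to be doubled are the square, the cylinder and the round disc. The factor 2
  bounds the Euclidean norm by the maximum of the norms of two components.\<close>

locale gauge =
  fixes \<mu> :: "'v::euclidean_space \<Rightarrow> real"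
  assumes continuous_gauge: "continuous_on UNIV \<mu>"
    and gauge_scaleR: "\<mu> (c *\<^sub>R v) = \<bar>c\<bar> * \<mu> v"
    and gauge_le_norm: "\<mu> v \<le> norm v"
    and norm_le_gauge: "norm v \<le> 2 * \<mu> v"
begin

lemma gauge_nonneg: "0 \<le> \<mu> v"
  using norm_le_gauge[of v] norm_ge_zero[of v] by linarith

lemma gauge_zero [simp]: "\<mu> 0 = 0"
  using gauge_scaleR[of 0 0] by simp

lemma gauge_pos: "v \<noteq> 0 \<Longrightarrow> 0 < \<mu> v"
  using norm_le_gauge[of v] zero_less_norm_iff[of v] by linarith

lemma continuous_gauge_on: "continuous_on S \<mu>"
  using continuous_gauge continuous_on_subset by blast

lemma compact_gauge: "compact {v. \<mu> v \<le> L}"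
proof -
  have "bounded {v. \<mu> v \<le> L}"
    using norm_le_gauge by (intro boundedI[of _ "2 * L"]) (smt (verit) mem_Collect_eq)
  moreover have "closed {v. \<mu> v \<le> L}"
    by (intro closed_Collect_le continuous_gauge continuous_intros)
  ultimately show ?thesis by (simp add: compact_eq_bounded_closed)
qed

text \<open>Inversion in the gauge sphere of radius \<open>L\<close>: it preserves rays and replaces
  the gauge by \<open>L^2 / \<mu> v\<close>.\<close>

definition invert :: "real \<Rightarrow> 'v \<Rightarrow> 'v" where
  "invert L v = (L\<^sup>2 / (\<mu> v)\<^sup>2) *\<^sub>R v"

lemma gauge_invert: "v \<noteq> 0 \<Longrightarrow> \<mu> (invert L v) = L\<^sup>2 / \<mu> v"
  using gauge_pos[of v] by (simp add: invert_def gauge_scaleR power2_eq_square)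

lemma invert_invert:
  assumes "L \<noteq> 0" "v \<noteq> 0" shows "invert L (invert L v) = v"
proof -
  have "invert L (invert L v) = (L\<^sup>2 / (L\<^sup>2 / \<mu> v)\<^sup>2) *\<^sub>R (L\<^sup>2 / (\<mu> v)\<^sup>2) *\<^sub>R v"
    using gauge_invert[OF assms(2), of L] by (simp add: invert_def[of L "invert L v"]) (simp add: invert_def)
  then show ?thesis using assms gauge_pos[of v] by (simp add: power2_eq_square)
qed

lemma invert_nonzero: "L \<noteq> 0 \<Longrightarrow> v \<noteq> 0 \<Longrightarrow> invert L v \<noteq> 0"
  using gauge_pos[of v] by (simp add: invert_def)

text \<open>On the ball of gauge \<open>L\<close> this covers what
  \<open>inverse_stereographic\<close> leaves out there, with the pole at the origin. The two agree
  where \<open>\<mu> v = L\<close>, so the sphere becomes a double.\<close>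

definition outer_chart :: "real \<Rightarrow> 'v \<Rightarrow> 'v \<times> real" where
  "outer_chart L v = (if v = 0 then (0, 1) else inverse_stereographic (invert L v))"

lemma continuous_outer_chart:
  assumes "0 < L"
  shows "continuous_on S (outer_chart L)"
proof -
  have "isCont (outer_chart L) v" for v
  proof (cases "v = 0")
    case True
    \<comment> \<open>As \<open>\<mu> u \<le> norm u\<close>, the inverted point has norm at least
      \<open>L^2 / norm u\<close>, hence is close to the pole.\<close>
    have bound: "dist (outer_chart L u) (0, 1) \<le> 2 * norm u / L\<^sup>2" for u
    proof (cases "u = 0")
      case False
      have pos: "0 < \<mu> u" "0 < norm u" using False gauge_pos by auto
      have "(\<mu> u)\<^sup>2 \<le> (norm u)\<^sup>2" using gauge_le_norm[of u] gauge_nonneg by (intro power_mono)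
      then have "L\<^sup>2 / norm u \<le> norm (invert L u)"
        using pos assms by (simp add: invert_def field_simps power2_eq_square)
      also have "\<dots> \<le> sqrt ((norm (invert L u))\<^sup>2 + 1)" by (rule real_le_rsqrt) simp
      finally have "2 / sqrt ((norm (invert L u))\<^sup>2 + 1) \<le> 2 / (L\<^sup>2 / norm u)"
        using pos assms by (intro divide_left_mono mult_pos_pos) (auto simp: add_nonneg_pos)
      then show ?thesis using False by (simp add: outer_chart_def dist_pole_inverse_stereographic)
    qed (simp add: outer_chart_def)
    have "isCont (\<lambda>u. 2 * norm u / L\<^sup>2) (0::'v)"
      by (intro continuous_intros) (use assms in auto)
    then have "((\<lambda>u::'v. 2 * norm u / L\<^sup>2) \<longlongrightarrow> 0) (at 0)" unfolding isCont_def by simp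
    then have "((\<lambda>u. dist (outer_chart L u) (0, 1)) \<longlongrightarrow> 0) (at 0)"
      by (rule Lim_null_comparison[rotated]) (simp add: bound)
    then have "(outer_chart L \<longlongrightarrow> (0, 1)) (at 0)" by (subst tendsto_dist_iff)
    then show ?thesis using True by (simp add: isCont_def outer_chart_def)
  next
    case False
    have "continuous_on (- {0}) (\<lambda>v. inverse_stereographic (invert L v))"
      unfolding invert_def
      by (intro continuous_on_compose2[OF continuous_inverse_stereographic[of UNIV]] continuous_intros continuous_gauge_on)
        (auto dest: gauge_pos)
    then have "continuous_on (- {0}) (outer_chart L)"
      by (rule continuous_on_eq) (simp add: outer_chart_def)
    then show ?thesis using False by (simp add: continuous_on_eq_continuous_at[OF open_Compl[OF closed_singleton]])
  qed
  then show ?thesis by (simp add: continuous_at_imp_continuous_on)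
qed

lemma norm_outer_chart: "norm (outer_chart L v) = 1"
  by (simp add: outer_chart_def norm_inverse_stereographic norm_Pair)

lemma inj_outer_chart: "L \<noteq> 0 \<Longrightarrow> inj (outer_chart L)"
proof (rule injI)
  fix v w assume L: "L \<noteq> 0" and eq: "outer_chart L v = outer_chart L w"
  have pole: "inverse_stereographic u \<noteq> (0, 1)" for u :: 'v
    using snd_inverse_stereographic_less[of u] by auto
  show "v = w"
  proof (cases "v = 0 \<or> w = 0")
    case True
    then show ?thesis using eq pole pole[symmetric] by (auto simp: outer_chart_def split: if_splits)
  next
    case False
    then have "invert L v = invert L w"
      using eq by (simp add: outer_chart_def inj_eq[OF inj_inverse_stereographic])
    then show ?thesis using False L invert_invert by metis
  qed
qed

lemma inverse_stereographic_eq_outer_chart: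
  assumes L: "0 < L" and x: "\<mu> x \<le> L" and y: "\<mu> y \<le> L"
  shows "inverse_stereographic x = outer_chart L y \<longleftrightarrow> x = y \<and> \<mu> y = L"
proof
  assume eq: "inverse_stereographic x = outer_chart L y"
  have y0: "y \<noteq> 0"
    using eq snd_inverse_stereographic_less[of x] by (auto simp: outer_chart_def)
  then have xy: "x = invert L y" using eq by (simp add: outer_chart_def inj_eq[OF inj_inverse_stereographic])
  then have "\<mu> x = L\<^sup>2 / \<mu> y" using gauge_invert[OF y0] by simp
  \<comment> \<open>Neither factor exceeds \<open>L\<close>, so \<open>\<mu> y\<close> must equal
    \<open>L\<close>, where the inversion is the identity.\<close>
  then have "\<mu> x * \<mu> y = L\<^sup>2" using gauge_pos[OF y0] by simp
  then have "L\<^sup>2 \<le> L * \<mu> y" using mult_right_mono[OF x gauge_nonneg[of y]] by simp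
  then have "\<mu> y = L" using y L by (simp add: power2_eq_square)
  moreover from this have "x = y" using xy L by (simp add: invert_def)
  ultimately show "x = y \<and> \<mu> y = L" by simp
next
  assume "x = y \<and> \<mu> y = L"
  then show "inverse_stereographic x = outer_chart L y"
    using L by (auto simp: outer_chart_def invert_def)
qed

lemma sphere_eq_double:
  assumes L: "0 < L"
  shows "sphere 0 1 = inverse_stereographic ` {v. \<mu> v \<le> L} \<union> outer_chart L ` {v. \<mu> v \<le> L}"
proof
  show "inverse_stereographic ` {v. \<mu> v \<le> L} \<union> outer_chart L ` {v. \<mu> v \<le> L} \<subseteq> sphere 0 1"
    by (auto simp: norm_inverse_stereographic norm_outer_chart)
  show "sphere 0 1 \<subseteq> inverse_stereographic ` {v. \<mu> v \<le> L} \<union> outer_chart L ` {v. \<mu> v \<le> L}"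
  proof
    fix p :: "'v \<times> real" assume "p \<in> sphere 0 1"
    then have p: "norm p = 1" by simp
    show "p \<in> inverse_stereographic ` {v. \<mu> v \<le> L} \<union> outer_chart L ` {v. \<mu> v \<le> L}"
    proof (cases "snd p = 1")
      case True
      then have "fst p = 0" using p by (cases p) (simp add: norm_Pair)
      then have "p = outer_chart L 0" using True by (simp add: outer_chart_def prod_eq_iff)
      then show ?thesis using L by auto
    next
      case False
      define u where "u = stereographic p"
      have pu: "p = inverse_stereographic u"
        unfolding u_def using inverse_stereographic_stereographic[OF p False] by simp
      show ?thesis
      proof (cases "\<mu> u \<le> L")
        case True
        then show ?thesis using pu by blast
      next
        case not_le: False
        then have "u \<noteq> 0" using L by auto
        then have "p = outer_chart L (invert L u)"
          using L invert_nonzero by (simp add: pu outer_chart_def invert_invert)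
        moreover have "\<mu> (invert L u) \<le> L"
          unfolding gauge_invert[OF \<open>u \<noteq> 0\<close>] using L not_le by (simp add: field_simps power2_eq_square)
        ultimately show ?thesis by blast
      qed
    qed
  qed
qed

end

interpretation square: gauge square_gauge
proof
  show "continuous_on UNIV square_gauge" unfolding square_gauge_def by (intro continuous_intros)
  show "square_gauge (c *\<^sub>R v) = \<bar>c\<bar> * square_gauge v" for c v
    by (simp add: square_gauge_def abs_mult max_mult_distrib_left)
  show "square_gauge v \<le> norm v" for v
    using abs_Re_le_cmod abs_Im_le_cmod by (simp add: square_gauge_def)
  show "norm v \<le> 2 * square_gauge v" for v
    using cmod_le[of v] by (simp add: square_gauge_def max_def split: if_splits)
qed

interpretation cylinder: gauge cylinder_gauge
proof
  show "continuous_on UNIV cylinder_gauge" unfolding cylinder_gauge_def by (intro continuous_intros)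
  show "cylinder_gauge (c *\<^sub>R v) = \<bar>c\<bar> * cylinder_gauge v" for c v
    by (simp add: cylinder_gauge_def abs_mult max_mult_distrib_left)
  show "cylinder_gauge v \<le> norm v" for v
    using norm_fst_le[of "fst v" "snd v"] norm_snd_le[of "snd v" "fst v"] by (simp add: cylinder_gauge_def)
  show "norm v \<le> 2 * cylinder_gauge v" for v
    using norm_Pair_le[of "fst v" "snd v"] by (simp add: cylinder_gauge_def)
qed

interpretation round: gauge norm
  by standard (auto intro: continuous_intros)

section \<open>Foldings of the sphere and of the circle\<close>

definition reflect_sphere :: "complex \<times> real \<Rightarrow> complex \<times> real" where
  "reflect_sphere p = (cnj (fst p), snd p)"

lemma square_gauge_cnj [simp]: "square_gauge (cnj y) = square_gauge y"
  by (simp add: square_gauge_def)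

lemma reflect_inverse_stereographic:
  "reflect_sphere (inverse_stereographic y) = inverse_stereographic (cnj y)"
  by (simp add: reflect_sphere_def inverse_stereographic_def)

lemma reflect_outer_chart: "reflect_sphere (square.outer_chart L y) = square.outer_chart L (cnj y)"
  by (simp add: square.outer_chart_def square.invert_def reflect_inverse_stereographic)
    (simp add: reflect_sphere_def)

text \<open>The double of the folding of a square of size \<open>L\<close>. \<open>L\<close> stays
  free so that the inner square, where the formula is explicit, can contain all the discs to be
  removed.\<close>

lemma sphere_folding:
  assumes L: "1 \<le> L"
  obtains p where "folding (sphere 0 1) reflect_sphere (sphere 0 1) p"
    "\<And>y w. square_gauge y \<le> L \<Longrightarrow> norm w = 1 \<Longrightarrow>
       p (inverse_stereographic y, w) = inverse_stereographic (fold_plane (y, w))"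
proof -
  have L0: "0 < L" using L by simp
  obtain p where "folding (sphere 0 1) reflect_sphere (sphere 0 1) p"
    "\<And>y w. y \<in> {y. square_gauge y \<le> L} \<Longrightarrow> norm w = 1 \<Longrightarrow>
       p (inverse_stereographic y, w) = inverse_stereographic (fold_plane (y, w))"
  proof (rule doubling[where E = "\<lambda>y. square_gauge y = L" and E' = "\<lambda>v. cylinder_gauge v = L"
        and K = "{y. square_gauge y \<le> L}" and K' = "{v. cylinder_gauge v \<le> L}"
        and \<alpha> = inverse_stereographic and \<alpha>' = inverse_stereographic
        and \<beta> = "square.outer_chart L" and \<beta>' = "cylinder.outer_chart L"
        and g = fold_plane and \<rho> = cnj and \<tau> = reflect_sphere and M = "sphere 0 1" and N = "sphere 0 1"])
    show "compact {y. square_gauge y \<le> L}" by (rule square.compact_gauge)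
    show "folding {y. square_gauge y \<le> L} cnj {v. cylinder_gauge v \<le> L} fold_plane"
      using L by (rule folding_fold_plane)
    show "sphere 0 1 = inverse_stereographic ` {y. square_gauge y \<le> L} \<union> square.outer_chart L ` {y. square_gauge y \<le> L}"
      using L0 by (rule square.sphere_eq_double)
    show "sphere 0 1 = inverse_stereographic ` {v. cylinder_gauge v \<le> L} \<union> cylinder.outer_chart L ` {v. cylinder_gauge v \<le> L}"
      using L0 by (rule cylinder.sphere_eq_double)
  qed (use L L0 in \<open>auto intro!: continuous_inverse_stereographic square.continuous_outer_chart
      cylinder.continuous_outer_chart inj_on_subset[OF inj_inverse_stereographic]
      inj_on_subset[OF square.inj_outer_chart] inj_on_subset[OF cylinder.inj_outer_chart]
      simp: square.inverse_stereographic_eq_outer_chart cylinder.inverse_stereographic_eq_outer_chart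
        cylinder_gauge_fold_plane_iff reflect_inverse_stereographic reflect_outer_chart\<close>)
  then show thesis using that by simp
qed

text \<open>The circle is the double of the arc from \<open>- pi/2\<close> to \<open>pi/2\<close> by
  means of \<open>z \<mapsto> - cnj z\<close>. The 2-sphere is the double of the disc of radius
  \<open>pi/2\<close>, onto which \<open>fold_line\<close> folds arc times circle because
  \<open>1 \<le> pi/2\<close>.\<close>

lemma circle_folding:
  obtains p where "folding (sphere 0 1) cnj (sphere 0 1) p"
    "\<And>t w. \<bar>t\<bar> \<le> pi / 2 \<Longrightarrow> norm w = 1 \<Longrightarrow> p (cis t, w) = inverse_stereographic (fold_line (t, w))"
proof -
  let ?K = "{- (pi/2)..pi/2}"
  have L: "1 \<le> pi / 2" using pi_gt3 by simp
  have L0: "0 < pi / 2" by simp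
  have \<beta>: "- cnj (cis t) = cis (pi - t)" for t by (simp add: complex_eq_iff)
  have inj: "inj_on cis ?K"
    by (rule inj_on_subset[OF inj_on_cis]) (use pi_less_4 in auto)
  obtain p where "folding (sphere 0 1) cnj (sphere 0 1) p"
    "\<And>t w. t \<in> ?K \<Longrightarrow> norm w = 1 \<Longrightarrow> p (cis t, w) = inverse_stereographic (fold_line (t, w))"
  proof (rule doubling[where E = "\<lambda>t. \<bar>t\<bar> = pi / 2" and E' = "\<lambda>v. norm v = pi / 2"
        and K = ?K and K' = "{v. norm v \<le> pi / 2}" and \<alpha> = cis and \<alpha>' = inverse_stereographic
        and \<beta> = "\<lambda>t. - cnj (cis t)" and \<beta>' = "round.outer_chart (pi / 2)"
        and g = fold_line and \<rho> = uminus and \<tau> = cnj and M = "sphere 0 1" and N = "sphere 0 1"])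
    show "folding ?K uminus {v. norm v \<le> pi/2} fold_line"
      using folding_fold_line[OF L] by (simp add: cball_def)
    show "inj_on (\<lambda>t. - cnj (cis t)) ?K" using inj by (simp add: inj_on_def)
    show "sphere 0 1 = cis ` ?K \<union> (\<lambda>t. - cnj (cis t)) ` ?K"
    proof
      show "sphere 0 1 \<subseteq> cis ` ?K \<union> (\<lambda>t. - cnj (cis t)) ` ?K"
      proof
        fix w :: complex assume "w \<in> sphere 0 1"
        then have w: "w = cis (Arg w)" using cis_Arg[of w] by (cases "w = 0") (auto simp: sgn_eq)
        have b: "- pi < Arg w" "Arg w \<le> pi" using Arg_bounded by auto
        consider "Arg w \<in> ?K" | "pi/2 < Arg w" | "Arg w < - (pi/2)" by fastforce
        then show "w \<in> cis ` ?K \<union> (\<lambda>t. - cnj (cis t)) ` ?K"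
        proof cases
          case 2
          then have "w = - cnj (cis (pi - Arg w))" "pi - Arg w \<in> ?K" using w b by (auto simp: \<beta>)
          then show ?thesis by blast
        next
          case 3
          have "- cnj (cis (- pi - Arg w)) = cis (Arg w)" by (simp add: complex_eq_iff cos_diff sin_diff)
          then have "w = - cnj (cis (- pi - Arg w))" "- pi - Arg w \<in> ?K" using w 3 b by auto
          then show ?thesis by blast
        qed (use w in blast)
      qed
    qed auto
    show "cis x = - cnj (cis y) \<longleftrightarrow> x = y \<and> \<bar>y\<bar> = pi / 2" if xy: "x \<in> ?K" "y \<in> ?K" for x y
    proof
      assume eq: "cis x = - cnj (cis y)"
      then have c: "cos x = - cos y" and s: "sin x = sin y" by (auto simp: complex_eq_iff)
      have "0 \<le> cos x" "0 \<le> cos y" using xy by (auto intro: cos_ge_zero)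
      with c have c0: "cos x = 0" "cos y = 0" by linarith+
      then have "cis x = cis y" using s by (simp add: complex_eq_iff)
      moreover have "\<bar>y\<bar> = pi / 2"
      proof (rule ccontr)
        assume "\<bar>y\<bar> \<noteq> pi / 2"
        then have "0 < cos y" using xy by (intro cos_gt_zero_pi) auto
        then show False using c0 by simp
      qed
      ultimately show "x = y \<and> \<bar>y\<bar> = pi / 2" using inj_onD[OF inj] xy by blast
    next
      assume "x = y \<and> \<bar>y\<bar> = pi / 2"
      then have "x = y" and y: "y = pi/2 \<or> y = - (pi/2)" by auto
      from y have "cos y = 0" by (elim disjE; simp only: cos_minus cos_pi_half)
      then show "cis x = - cnj (cis y)" using \<open>x = y\<close> by (simp add: complex_eq_iff)
    qed
    show "norm (fold_line (t, w)) = pi / 2 \<longleftrightarrow> \<bar>t\<bar> = pi / 2" if "norm w = 1" for t w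
      using norm_fold_line[OF that, of t] norm_fold_line_less[OF that, of t] L by linarith
    show "sphere 0 1 = inverse_stereographic ` {v. norm v \<le> pi/2} \<union> round.outer_chart (pi/2) ` {v::complex. norm v \<le> pi/2}"
      using L0 by (rule round.sphere_eq_double)
  qed (use inj L0 in \<open>auto intro!: continuous_intros continuous_inverse_stereographic round.continuous_outer_chart
      inj_on_subset[OF inj_inverse_stereographic] inj_on_subset[OF round.inj_outer_chart]
      simp: round.inverse_stereographic_eq_outer_chart cis_cnj\<close>)
  moreover have "t \<in> ?K" if "\<bar>t\<bar> \<le> pi / 2" for t using that by auto
  ultimately show thesis using that by blast
qed

section \<open>Rounding\<close>

text \<open>A homeomorphism that carries the unit ball of a gauge to the round unit ball and is the identity
  where the gauge is at least \<open>3/2\<close>; it preserves rays from the origin.\<close>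

context gauge
begin

text \<open>A cut-off function: 0 up to gauge 1, and 1 from gauge 3/2 on.\<close>

definition blend :: "'v \<Rightarrow> real" where
  "blend v = max 0 (min 1 (2 * (\<mu> v - 1)))"

text \<open>The factor \<open>\<mu> v / norm v\<close> turns gauge spheres into round ones; the
  blend leads back to the identity. At the origin division by zero gives the value 0, which
  \<open>rounding\<close> multiplies by the zero vector.\<close>

definition stretch :: "'v \<Rightarrow> real" where
  "stretch v = (1 - blend v) * (\<mu> v / norm v) + blend v"

definition rounding :: "'v \<Rightarrow> 'v" where
  "rounding v = stretch v *\<^sub>R v"

lemma blend_bounds: "0 \<le> blend v" "blend v \<le> 1"
  by (auto simp: blend_def)

lemma continuous_blend: "continuous_on S blend"
  unfolding blend_def by (intro continuous_intros continuous_gauge_on)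

lemma ratio_bounds: "0 \<le> \<mu> v / norm v" "\<mu> v / norm v \<le> 1"
  using gauge_nonneg[of v] gauge_le_norm[of v] by (auto simp: divide_le_eq_1)

lemma stretch_bounds: "0 \<le> stretch v" "stretch v \<le> 1"
proof -
  show "0 \<le> stretch v" unfolding stretch_def
    by (intro add_nonneg_nonneg mult_nonneg_nonneg ratio_bounds blend_bounds) (simp add: blend_bounds)
  have "(1 - blend v) * (\<mu> v / norm v) \<le> (1 - blend v) * 1"
    using blend_bounds[of v] ratio_bounds[of v] by (intro mult_left_mono) auto
  then show "stretch v \<le> 1" by (simp add: stretch_def)
qed

lemma stretch_pos: "v \<noteq> 0 \<Longrightarrow> 0 < stretch v"
proof -
  assume v: "v \<noteq> 0"
  then have r: "0 < \<mu> v / norm v" using gauge_pos by simp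
  show ?thesis
  proof (cases "blend v = 0")
    case True then show ?thesis using r by (simp add: stretch_def)
  next
    case False
    then have "0 < blend v" using blend_bounds[of v] by linarith
    moreover have "0 \<le> (1 - blend v) * (\<mu> v / norm v)" 
      by (intro mult_nonneg_nonneg ratio_bounds) (simp add: blend_bounds)
    ultimately show ?thesis by (simp add: stretch_def)
  qed
qed

lemma norm_rounding: "norm (rounding v) = (1 - blend v) * \<mu> v + blend v * norm v"
proof (cases "v = 0")
  case False
  have "norm (rounding v) = stretch v * norm v"
    using stretch_bounds[of v] by (simp add: rounding_def)
  then show ?thesis using False by (simp add: stretch_def distrib_right)
qed (simp add: rounding_def)

lemma norm_rounding_inner: "\<mu> v \<le> 1 \<Longrightarrow> norm (rounding v) = \<mu> v"
  by (simp add: norm_rounding blend_def)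

lemma norm_rounding_outer: "1 \<le> \<mu> v \<Longrightarrow> \<mu> v \<le> norm (rounding v)"
proof -
  have "blend v * \<mu> v \<le> blend v * norm v"
    using blend_bounds[of v] gauge_le_norm[of v] by (intro mult_left_mono) auto
  then show ?thesis by (simp add: norm_rounding left_diff_distrib)
qed

lemma norm_rounding_iff:
  "norm (rounding v) \<le> 1 \<longleftrightarrow> \<mu> v \<le> 1" "norm (rounding v) < 1 \<longleftrightarrow> \<mu> v < 1"
  "norm (rounding v) = 1 \<longleftrightarrow> \<mu> v = 1"
  using norm_rounding_inner[of v] norm_rounding_outer[of v] by fastforce+

lemma rounding_id: "3/2 \<le> \<mu> v \<Longrightarrow> rounding v = v"
  by (simp add: rounding_def stretch_def blend_def)

lemma gauge_rounding_le: "\<mu> (rounding v) \<le> \<mu> v"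
  using stretch_bounds[of v] gauge_nonneg[of v]
  by (simp add: rounding_def gauge_scaleR mult_left_le_one_le)

lemma continuous_rounding: "continuous_on S rounding"
proof -
  have "isCont rounding v" for v
  proof (cases "v = 0")
    case True
    have "((\<lambda>u::'v. norm u) \<longlongrightarrow> 0) (at 0)" by (rule tendsto_norm_zero) (rule tendsto_ident_at)
    then have "(rounding \<longlongrightarrow> 0) (at 0)"
    proof (rule Lim_null_comparison[rotated])
      have "norm (rounding u) \<le> norm u" for u
        using stretch_bounds[of u] by (simp add: rounding_def mult_left_le_one_le)
      then show "\<forall>\<^sub>F u in at 0. norm (rounding u) \<le> norm u" by simp
    qed
    then show ?thesis using True by (simp add: isCont_def rounding_def)
  next
    case False
    have "continuous_on (- {0}) rounding"
      unfolding rounding_def stretch_def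
      by (intro continuous_intros continuous_gauge_on continuous_blend) auto
    then show ?thesis using False by (simp add: continuous_on_eq_continuous_at[OF open_Compl[OF closed_singleton]])
  qed
  then show ?thesis by (simp add: continuous_at_imp_continuous_on)
qed

text \<open>Along a ray the ratio \<open>k \<le> 1\<close> is constant and only the weight shifts,
  from \<open>k\<close> towards 1. Hence \<open>rounding\<close> is strictly increasing on rays, and
  so injective.\<close>

lemma stretch_mono: "1 \<le> c \<Longrightarrow> v \<noteq> 0 \<Longrightarrow> stretch v \<le> stretch (c *\<^sub>R v)"
proof -
  assume c: "1 \<le> c" and v: "v \<noteq> 0"
  define k where "k = \<mu> v / norm v"
  have k: "\<mu> (c *\<^sub>R v) / norm (c *\<^sub>R v) = k" "k \<le> 1"
    using c v ratio_bounds[of v] by (simp_all add: gauge_scaleR k_def)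
  have "\<mu> v \<le> \<mu> (c *\<^sub>R v)"
    using c mult_right_mono[OF c gauge_nonneg[of v]] by (simp add: gauge_scaleR)
  then have b: "blend v \<le> blend (c *\<^sub>R v)" by (simp add: blend_def max_def min_def)
  have "stretch (c *\<^sub>R v) - stretch v = (blend (c *\<^sub>R v) - blend v) * (1 - k)"
    unfolding stretch_def k(1) by (simp add: algebra_simps flip: k_def)
  moreover have "0 \<le> \<dots>" using b k(2) by simp
  ultimately show ?thesis by linarith
qed

lemma inj_rounding: "inj rounding"
proof (rule injI)
  have 0: "rounding v = 0 \<longleftrightarrow> v = 0" for v
    using stretch_pos[of v] unfolding rounding_def scaleR_eq_0_iff by (metis less_irrefl)
  have less: "c \<le> 1" if "v \<noteq> 0" "0 < c" "rounding (c *\<^sub>R v) = rounding v" for v c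
  proof (rule ccontr)
    assume "\<not> c \<le> 1"
    then have c: "1 < c" by simp
    have "stretch (c *\<^sub>R v) * c = stretch v" using that by (simp add: rounding_def)
    moreover have "stretch v < stretch v * c" using stretch_pos[OF that(1)] c by simp
    moreover have "stretch v * c \<le> stretch (c *\<^sub>R v) * c"
      using stretch_mono[of c v] c that(1) by (intro mult_right_mono) auto
    ultimately show False by linarith
  qed
  fix v w assume eq: "rounding v = rounding w"
  show "v = w"
  proof (cases "v = 0 \<or> w = 0")
    case True then show ?thesis using eq 0 by (metis)
  next
    case False
    define c where "c = stretch v / stretch w"
    have c: "0 < c" using False stretch_pos by (simp add: c_def)
    have w: "w = c *\<^sub>R v"
    proof -
      have "stretch w *\<^sub>R w = stretch v *\<^sub>R v" using eq by (simp add: rounding_def)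
      then have "(1 / stretch w) *\<^sub>R stretch w *\<^sub>R w = (1 / stretch w) *\<^sub>R stretch v *\<^sub>R v" by simp
      then show ?thesis using stretch_pos[of w] False by (simp add: c_def)
    qed
    have "v = (1 / c) *\<^sub>R w" using w c by simp
    then have "1 / c \<le> 1" using less[of w "1 / c"] c False eq by simp
    moreover have "c \<le> 1" using less[of v c] c False eq w by simp
    ultimately have "c = 1" using c by simp
    then show ?thesis using w by simp
  qed
qed

lemma surj_rounding: "\<exists>u. rounding u = v"
proof (cases "v = 0")
  case False
  \<comment> \<open>The gauge of \<open>R *\<^sub>R v\<close> is at least 2, so
    \<open>rounding\<close> is the identity there and \<open>h R = R \<ge> 1\<close>.\<close>
  define R where "R = max 1 (2 / \<mu> v)"
  define h where "h r = r * stretch (r *\<^sub>R v)" for r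
  have "2 / \<mu> v \<le> R" "1 \<le> R" by (auto simp: R_def)
  then have "2 \<le> R * \<mu> v" using gauge_pos[OF False] by (simp add: field_simps)
  then have "stretch (R *\<^sub>R v) = 1" using \<open>1 \<le> R\<close> by (simp add: stretch_def blend_def gauge_scaleR)
  then have h1: "1 \<le> h R" using \<open>1 \<le> R\<close> by (simp add: h_def)
  have ray: "rounding (r *\<^sub>R v) = h r *\<^sub>R v" for r by (simp add: rounding_def h_def mult.commute)
  \<comment> \<open>\<open>stretch\<close> jumps at the origin, so the continuity of
    \<open>h\<close> is taken from that of \<open>rounding\<close>.\<close>
  have "h r = norm (rounding (r *\<^sub>R v)) / norm v" if "0 \<le> r" for r
  proof -
    have "0 \<le> h r" using that stretch_bounds by (simp add: h_def)
    then show ?thesis using False by (simp add: ray)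
  qed
  moreover have "continuous_on {0..R} (\<lambda>r. norm (rounding (r *\<^sub>R v)) / norm v)"
    using False by (intro continuous_intros continuous_on_compose2[OF continuous_rounding[of UNIV]]) auto
  ultimately have "continuous_on {0..R} h"
    using continuous_on_cong[of "{0..R}" "{0..R}" h "\<lambda>r. norm (rounding (r *\<^sub>R v)) / norm v"] by simp
  then obtain r where "h r = 1" using IVT'[of h 0 1 R] h1 \<open>1 \<le> R\<close> by (auto simp: h_def)
  then have "rounding (r *\<^sub>R v) = v" by (simp add: ray)
  then show ?thesis by blast
qed (auto simp: rounding_def intro: exI[of _ 0])

abbreviation cell :: "'v set" where
  "cell \<equiv> {v. \<mu> v \<le> 3/2}"

lemma rounding_cell: "rounding ` cell = cell"
proof
  show "rounding ` cell \<subseteq> cell" using gauge_rounding_le order_trans by blast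
  show "cell \<subseteq> rounding ` cell"
  proof
    fix v assume v: "v \<in> cell"
    obtain u where u: "rounding u = v" using surj_rounding by blast
    show "v \<in> rounding ` cell"
    proof (cases "\<mu> u \<le> 3/2")
      case False
      then have "rounding u = u" by (intro rounding_id) simp
      then show ?thesis using u v by (metis image_eqI)
    qed (use u in blast)
  qed
qed

end

lemma square_rounding_cnj: "square.rounding (cnj y) = cnj (square.rounding y)"
  by (simp add: square.rounding_def square.stretch_def square.blend_def)

text \<open>\<open>fold_plane\<close> in rounded coordinates: round disc times circle is folded onto
  the round ball. It is the form that both foldings take in their charts on the gluing tori.\<close>

definition fold_ball :: "complex \<times> complex \<Rightarrow> complex \<times> real" where
  "fold_ball p = cylinder.rounding (fold_plane (the_inv square.rounding (fst p), snd p))"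

lemma fold_ball_rounding: "fold_ball (square.rounding y, w) = cylinder.rounding (fold_plane (y, w))"
  by (simp add: fold_ball_def the_inv_f_f[OF square.inj_rounding])

lemma norm_fold_ball_iff:
  assumes "norm w = 1"
  shows "norm (fold_ball (x, w)) \<le> 1 \<longleftrightarrow> norm x \<le> 1" "norm (fold_ball (x, w)) < 1 \<longleftrightarrow> norm x < 1"
    "norm (fold_ball (x, w)) = 1 \<longleftrightarrow> norm x = 1"
proof -
  obtain y where "square.rounding y = x" using square.surj_rounding by blast
  then show "norm (fold_ball (x, w)) \<le> 1 \<longleftrightarrow> norm x \<le> 1" "norm (fold_ball (x, w)) < 1 \<longleftrightarrow> norm x < 1"
    "norm (fold_ball (x, w)) = 1 \<longleftrightarrow> norm x = 1"
    using fold_ball_rounding[of y w] cylinder_gauge_fold_plane_iff[OF assms order_refl, of y]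
    by (metis cylinder.norm_rounding_iff square.norm_rounding_iff)+
qed

lemma fold_ball_onto: "\<exists>x w. norm w = 1 \<and> fold_ball (x, w) = v"
proof -
  obtain u where u: "cylinder.rounding u = v" using cylinder.surj_rounding by blast
  obtain y w where "norm w = 1" "fold_plane (y, w) = u" using fold_plane_onto by blast
  then show ?thesis using u fold_ball_rounding by metis
qed

text \<open>\<open>r\<close> is transplanted into disjoint cells and extended by the identity. Since
  \<open>r\<close> is the identity on \<open>C - D\<close> and the images of \<open>D\<close> are
  open in \<open>M\<close>, two closed sets cover \<open>M\<close>: the cells, and the complement of
  the images of \<open>D\<close>. \<open>R\<close> is continuous on each.\<close>

lemma rounding_map:
  fixes e :: "nat \<Rightarrow> 'v::topological_space \<Rightarrow> 'm::t2_space"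
  assumes I: "finite I" and C: "compact C" "D \<subseteq> C"
    and M: "closed M" "\<And>i. i \<in> I \<Longrightarrow> e i ` C \<subseteq> M"
    and e: "\<And>i. i \<in> I \<Longrightarrow> continuous_on C (e i)" "\<And>i. i \<in> I \<Longrightarrow> inj_on (e i) C"
    and op: "\<And>i. i \<in> I \<Longrightarrow> openin (top_of_set M) (e i ` D)"
    and disj: "\<And>i j x y. i \<in> I \<Longrightarrow> j \<in> I \<Longrightarrow> x \<in> C \<Longrightarrow> y \<in> C \<Longrightarrow> e i x = e j y \<Longrightarrow> i = j"
    and r: "continuous_on C r" "inj_on r C" "r ` C = C" "\<And>x. x \<in> C - D \<Longrightarrow> r x = x"
  obtains R where "continuous_on M R" "bij_betw R M M"
    "\<And>i x. i \<in> I \<Longrightarrow> x \<in> C \<Longrightarrow> R (e i x) = e i (r x)"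
    "\<And>m. m \<in> M \<Longrightarrow> m \<notin> (\<Union>i\<in>I. e i ` C) \<Longrightarrow> R m = m"
proof -
  define s where "s m = (THE i. i \<in> I \<and> m \<in> e i ` C)" for m
  define R where "R m = (if m \<in> (\<Union>i\<in>I. e i ` C) then e (s m) (r (the_inv_into C (e (s m)) m)) else m)" for m
  have s: "s (e i x) = i" if "i \<in> I" "x \<in> C" for i x
    unfolding s_def
  proof (rule the_equality)
    show "i \<in> I \<and> e i x \<in> e i ` C" using that by blast
    show "k = i" if "k \<in> I \<and> e i x \<in> e k ` C" for k
      using that disj[of i k x] \<open>i \<in> I\<close> \<open>x \<in> C\<close> by blast
  qed
  have Re: "R (e i x) = e i (r x)" if "i \<in> I" "x \<in> C" for i x
  proof -
    have "e i x \<in> (\<Union>i\<in>I. e i ` C)" using that by blast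
    then show ?thesis using s[OF that] that e(2) by (simp add: R_def the_inv_into_f_f)
  qed
  have Rout: "R m = m" if "m \<notin> (\<Union>i\<in>I. e i ` C)" for m
    using that by (simp add: R_def)
  have Rout': "R m = m" if "m \<in> M - (\<Union>i\<in>I. e i ` D)" for m
  proof (cases "m \<in> (\<Union>i\<in>I. e i ` C)")
    case True
    then obtain i x where "i \<in> I" "x \<in> C" "m = e i x" by blast
    moreover from this that have "x \<notin> D" by blast
    ultimately show ?thesis using Re r(4) by simp
  qed (rule Rout)
  have closedC: "closed (e i ` C)" if "i \<in> I" for i
    using that e(1) C(1) by (blast intro: compact_imp_closed compact_continuous_image)
  have cont: "continuous_on (e i ` C) R" if i: "i \<in> I" for i
  proof -
    have "continuous_on (e i ` C) (the_inv_into C (e i))"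
      using e[OF i] C(1) by (intro continuous_on_inv_into)
    then have "continuous_on (e i ` C) (\<lambda>m. r (the_inv_into C (e i) m))"
      by (rule continuous_on_compose2[OF r(1)]) (use e(2)[OF i] in \<open>auto simp: the_inv_into_f_f\<close>)
    then have "continuous_on (e i ` C) (\<lambda>m. e i (r (the_inv_into C (e i) m)))"
      by (rule continuous_on_compose2[OF e(1)[OF i]]) (use e(2)[OF i] r(3) in \<open>auto simp: the_inv_into_f_f\<close>)
    then show ?thesis
      by (rule continuous_on_eq) (use e(2)[OF i] Re[OF i] in \<open>auto simp: the_inv_into_f_f\<close>)
  qed
  have "continuous_on (\<Union>i\<in>I. e i ` C) R"
    using I closedC cont by (intro continuous_on_closed_Union) auto
  moreover have "continuous_on (M - (\<Union>i\<in>I. e i ` D)) R"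
    using continuous_on_eq[OF continuous_on_id, of _ R] Rout' by (metis id_apply)
  moreover have "closed (M - (\<Union>i\<in>I. e i ` D))"
  proof -
    have "openin (top_of_set M) (\<Union>i\<in>I. e i ` D)" using op by blast
    then have "closedin (top_of_set M) (M - (\<Union>i\<in>I. e i ` D))"
      using closedin_diff[OF closedin_topspace, of "top_of_set M"] by simp
    then show ?thesis using M(1) closedin_closed_trans by blast
  qed
  moreover have "closed (\<Union>i\<in>I. e i ` C)" using I closedC by (intro closed_UN) auto
  ultimately have "continuous_on ((\<Union>i\<in>I. e i ` C) \<union> (M - (\<Union>i\<in>I. e i ` D))) R"
    by (intro continuous_on_closed_Un)
  moreover have "(\<Union>i\<in>I. e i ` C) \<union> (M - (\<Union>i\<in>I. e i ` D)) = M"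
    using M(2) C(2) by blast
  ultimately have "continuous_on M R" by simp
  moreover have "bij_betw R M M"
    unfolding bij_betw_def
  proof
    \<comment> \<open>\<open>R\<close> maps each cell into itself and its complement into the
      complement, so injectivity can be checked piece by piece.\<close>
    have R_in: "R m \<in> e i ` C \<longleftrightarrow> m \<in> e i ` C" if i: "i \<in> I" for i m
    proof (cases "m \<in> (\<Union>i\<in>I. e i ` C)")
      case True
      then obtain k x where "k \<in> I" "x \<in> C" "m = e k x" by blast
      moreover have "r x \<in> C" using r(3) \<open>x \<in> C\<close> by blast
      ultimately show ?thesis using Re[of k x] disj[of k i x] disj[of k i "r x"] i
        by (metis imageE imageI)
    qed (use Rout in simp)
    show "inj_on R M"
    proof (rule inj_onI)
      fix m m' assume eq: "R m = R m'"
      show "m = m'"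
      proof (cases "m \<in> (\<Union>i\<in>I. e i ` C)")
        case True
        then obtain i x where i: "i \<in> I" "x \<in> C" "m = e i x" by blast
        then have "m' \<in> e i ` C" using R_in[OF i(1)] eq by (metis imageI)
        then obtain x' where x': "x' \<in> C" "m' = e i x'" by blast
        have "e i (r x) = e i (r x')" using eq i x' Re by simp
        moreover have "r x \<in> C" "r x' \<in> C" using r(3) i x' by blast+
        ultimately have "r x = r x'" using inj_onD[OF e(2)[OF i(1)]] by blast
        then show ?thesis using inj_onD[OF r(2)] i x' by blast
      next
        case False
        then have "R m' \<notin> (\<Union>i\<in>I. e i ` C)" using eq Rout by metis
        then have "m' \<notin> (\<Union>i\<in>I. e i ` C)" using R_in by blast
        then show ?thesis using eq Rout False by metis
      qed
    qed
    show "R ` M = M"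
    proof
      show "R ` M \<subseteq> M"
      proof
        fix y assume "y \<in> R ` M"
        then obtain m where m: "m \<in> M" "y = R m" by blast
        show "y \<in> M"
        proof (cases "m \<in> (\<Union>i\<in>I. e i ` C)")
          case True
          then show ?thesis using m R_in M(2) by blast
        qed (use m Rout in simp)
      qed
      show "M \<subseteq> R ` M"
      proof
        fix m assume m: "m \<in> M"
        show "m \<in> R ` M"
        proof (cases "m \<in> (\<Union>i\<in>I. e i ` C)")
          case True
          then obtain i x where i: "i \<in> I" "x \<in> C" "m = e i x" by blast
          moreover obtain u where "u \<in> C" "x = r u" using r(3) i(2) by blast
          ultimately show ?thesis using Re[of i u] M(2) by (metis image_eqI image_subset_iff)
        qed (use m Rout in \<open>metis imageI\<close>)
      qed
    qed
  qed
  ultimately show thesis using that Re Rout by blast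
qed

text \<open>The inverse of \<open>R\<close> is applied on the first factor before \<open>p\<close>,
  and \<open>R'\<close> after it. Fibres survive because \<open>R\<close> commutes with
  \<open>\<tau>\<close>, and on the unit discs the chart expression changes from
  \<open>fold_plane\<close> to \<open>fold_ball\<close>.\<close>

lemma rounded_folding:
  fixes e :: "nat \<Rightarrow> complex \<Rightarrow> 'm::t2_space" and e' :: "nat \<Rightarrow> complex \<times> real \<Rightarrow> 'n::t2_space"
  assumes p: "folding M \<tau> N p" and I: "finite I"
    and M: "compact M" "\<And>i x. i \<in> I \<Longrightarrow> x \<in> square.cell \<Longrightarrow> e i x \<in> M"
    and e: "\<And>i. i \<in> I \<Longrightarrow> continuous_on square.cell (e i)" "\<And>i. i \<in> I \<Longrightarrow> inj_on (e i) square.cell"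
      "\<And>i. i \<in> I \<Longrightarrow> openin (top_of_set M) (e i ` {y. square_gauge y < 3/2})"
      "\<And>i j x y. i \<in> I \<Longrightarrow> j \<in> I \<Longrightarrow> x \<in> square.cell \<Longrightarrow> y \<in> square.cell \<Longrightarrow> e i x = e j y \<Longrightarrow> i = j"
    and N: "closed N" "\<And>i v. i \<in> I \<Longrightarrow> v \<in> cylinder.cell \<Longrightarrow> e' i v \<in> N"
    and e': "\<And>i. i \<in> I \<Longrightarrow> continuous_on cylinder.cell (e' i)" "\<And>i. i \<in> I \<Longrightarrow> inj_on (e' i) cylinder.cell"
      "\<And>i. i \<in> I \<Longrightarrow> openin (top_of_set N) (e' i ` {v. cylinder_gauge v < 3/2})"
      "\<And>i j x y. i \<in> I \<Longrightarrow> j \<in> I \<Longrightarrow> x \<in> cylinder.cell \<Longrightarrow> y \<in> cylinder.cell \<Longrightarrow> e' i x = e' j y \<Longrightarrow> i = j"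
    and p_e: "\<And>i x w. i \<in> I \<Longrightarrow> x \<in> square.cell \<Longrightarrow> norm w = 1 \<Longrightarrow> p (e i x, w) = e' i (fold_plane (x, w))"
    and \<tau>: "\<And>m. m \<in> M \<Longrightarrow> \<tau> m \<in> M" "\<And>m. m \<in> M \<Longrightarrow> \<tau> (\<tau> m) = m"
      "\<And>i x. i \<in> I \<Longrightarrow> x \<in> square.cell \<Longrightarrow> \<tau> (e i x) = e i (cnj x)"
  obtains q where "folding M \<tau> N q"
    "\<And>i x w. i \<in> I \<Longrightarrow> norm x \<le> 1 \<Longrightarrow> norm w = 1 \<Longrightarrow> q (e i x, w) = e' i (fold_ball (x, w))"
proof -
  obtain R where R: "continuous_on M R" "bij_betw R M M"
    "\<And>i x. i \<in> I \<Longrightarrow> x \<in> square.cell \<Longrightarrow> R (e i x) = e i (square.rounding x)"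
    "\<And>m. m \<in> M \<Longrightarrow> m \<notin> (\<Union>i\<in>I. e i ` square.cell) \<Longrightarrow> R m = m"
  proof (rule rounding_map[of I square.cell "{y. square_gauge y < 3/2}" M e square.rounding])
    show "compact square.cell" by (rule square.compact_gauge)
    show "closed M" using M(1) by (rule compact_imp_closed)
    show "continuous_on square.cell square.rounding" by (rule square.continuous_rounding)
    show "inj_on square.rounding square.cell" using square.inj_rounding inj_on_subset by blast
    show "square.rounding ` square.cell = square.cell" by (rule square.rounding_cell)
    show "square.rounding x = x" if "x \<in> square.cell - {y. square_gauge y < 3/2}" for x
      using that by (intro square.rounding_id) auto
    show "e i ` square.cell \<subseteq> M" if "i \<in> I" for i using M(2) that by blast
  qed (use I e in \<open>auto\<close>)
  obtain R' where R': "continuous_on N R'" "bij_betw R' N N"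
    "\<And>i v. i \<in> I \<Longrightarrow> v \<in> cylinder.cell \<Longrightarrow> R' (e' i v) = e' i (cylinder.rounding v)"
  proof (rule rounding_map[of I cylinder.cell "{y. cylinder_gauge y < 3/2}" N e' cylinder.rounding])
    show "compact cylinder.cell" by (rule cylinder.compact_gauge)
    show "continuous_on cylinder.cell cylinder.rounding" by (rule cylinder.continuous_rounding)
    show "inj_on cylinder.rounding cylinder.cell" using cylinder.inj_rounding inj_on_subset by blast
    show "cylinder.rounding ` cylinder.cell = cylinder.cell" by (rule cylinder.rounding_cell)
    show "cylinder.rounding x = x" if "x \<in> cylinder.cell - {y. cylinder_gauge y < 3/2}" for x
      using that by (intro cylinder.rounding_id) auto
    show "e' i ` cylinder.cell \<subseteq> N" if "i \<in> I" for i using N(2) that by blast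
  qed (use I e' N(1) in \<open>auto\<close>)
  have R_\<tau>: "R (\<tau> m) = \<tau> (R m)" if m: "m \<in> M" for m
  proof (cases "m \<in> (\<Union>i\<in>I. e i ` square.cell)")
    case True
    then obtain i x where i: "i \<in> I" "x \<in> square.cell" "m = e i x" by blast
    moreover have "square.rounding x \<in> square.cell" using square.rounding_cell i(2) by blast
    moreover have "cnj x \<in> square.cell" using i(2) by simp
    ultimately show ?thesis by (simp only: \<tau>(3) R(3) square_rounding_cnj)
  next
    case False
    have "\<tau> m \<notin> (\<Union>i\<in>I. e i ` square.cell)"
    proof
      assume "\<tau> m \<in> (\<Union>i\<in>I. e i ` square.cell)"
      then obtain i x where i: "i \<in> I" "x \<in> square.cell" "\<tau> m = e i x" by blast
      then have "m = e i (cnj x)" using \<tau>(2)[OF m] \<tau>(3) by metis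
      moreover have "cnj x \<in> square.cell" using i(2) by simp
      ultimately show False using False i(1) by blast
    qed
    then show ?thesis using R(4) False m \<tau>(1) by metis
  qed
  define R1 where "R1 = the_inv_into M R"
  have injR: "inj_on R M" and imR: "R ` M = M" using R(2) by (auto simp: bij_betw_def)
  have contR1: "continuous_on M R1"
    using continuous_on_inv_into[OF R(1) M(1) injR] unfolding R1_def imR .
  have R1_R: "R1 (R m) = m" if "m \<in> M" for m unfolding R1_def using injR that by (rule the_inv_into_f_f)
  have R_in: "R m \<in> M" if "m \<in> M" for m using imR that by blast
  have R_onto: "\<exists>u\<in>M. R u = m" if "m \<in> M" for m using imR that by (metis imageE)
  have R1_in: "R1 m \<in> M" if "m \<in> M" for m using R_onto[OF that] R1_R by metis
  have injR': "inj_on R' N" and imR': "R' ` N = N" using R'(2) by (auto simp: bij_betw_def)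
  define q where "q = (\<lambda>(m, w). R' (p (R1 m, w)))"
  have q: "q (R m, w) = R' (p (m, w))" if "m \<in> M" for m w
    using that by (simp add: q_def R1_R)
  note p_in = folding_in[OF p] and fib = folding_fibre[OF p]
  have "folding M \<tau> N q"
  proof (rule foldingI)
    have "continuous_on (M \<times> sphere 0 1) (\<lambda>m. (R1 (fst m), snd m))"
      by (intro continuous_on_Pair continuous_on_compose2[OF contR1] continuous_on_fst continuous_on_snd continuous_on_id) auto
    then have "continuous_on (M \<times> sphere 0 1) (\<lambda>m. p (R1 (fst m), snd m))"
      by (rule continuous_on_compose2[OF folding_continuous[OF p]]) (use R1_in in auto)
    then have "continuous_on (M \<times> sphere 0 1) (\<lambda>m. R' (p (R1 (fst m), snd m)))"
      by (rule continuous_on_compose2[OF R'(1)]) (use R1_in p_in in auto)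
    then show "continuous_on (M \<times> sphere 0 1) q" by (simp add: q_def case_prod_unfold)
    show "q (m, w) \<in> N" if "m \<in> M" "norm w = 1" for m w
      using imR' p_in[OF R1_in[OF that(1)] that(2)] by (auto simp: q_def)
    show "\<exists>m\<in>M. \<exists>w. norm w = 1 \<and> q (m, w) = n" if "n \<in> N" for n
    proof -
      have "n \<in> R' ` N" using that by (simp only: imR')
      then obtain n' where n': "n' \<in> N" "R' n' = n" by blast
      obtain m w where "m \<in> M" "norm w = 1" "p (m, w) = n'" using folding_onto[OF p n'(1)] .
      then show ?thesis using n'(2) by (intro bexI[of _ "R m"] exI[of _ w]) (simp_all add: q R_in)
    qed
    show "q (m, w) = q (m', w') \<longleftrightarrow> m' = m \<and> w' = w \<or> m' = \<tau> m \<and> w' = cnj w"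
      if mw: "m \<in> M" "norm w = 1" "m' \<in> M" "norm w' = 1" for m w m' w'
    proof -
      obtain u u' where u: "u \<in> M" "R u = m" "u' \<in> M" "R u' = m'" using mw R_onto by metis
      have "q (m, w) = q (m', w') \<longleftrightarrow> p (u, w) = p (u', w')"
        unfolding u(2,4)[symmetric] q[OF u(1)] q[OF u(3)]
        by (rule inj_on_eq_iff[OF injR' p_in[OF u(1) mw(2)] p_in[OF u(3) mw(4)]])
      also have "\<dots> \<longleftrightarrow> u' = u \<and> w' = w \<or> u' = \<tau> u \<and> w' = cnj w"
        by (rule fib[OF u(1) mw(2) u(3) mw(4)])
      also have "\<dots> \<longleftrightarrow> R u' = R u \<and> w' = w \<or> R u' = R (\<tau> u) \<and> w' = cnj w"
        unfolding inj_on_eq_iff[OF injR u(3) u(1)] inj_on_eq_iff[OF injR u(3) \<tau>(1)[OF u(1)]] ..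
      finally show ?thesis unfolding R_\<tau>[OF u(1)] u(2,4) .
    qed
  qed
  moreover have "q (e i x, w) = e' i (fold_ball (x, w))" if "i \<in> I" "norm x \<le> 1" "norm w = 1" for i x w
  proof -
    obtain y where y: "square.rounding y = x" using square.surj_rounding by blast
    then have y1: "square_gauge y \<le> 1" using that(2) square.norm_rounding_iff(1) by blast
    then have cell: "y \<in> square.cell" by simp
    have "cylinder_gauge (fold_plane (y, w)) \<le> 1"
      using cylinder_gauge_fold_plane_iff(1)[OF that(3) order_refl] y1 by blast
    then have cell': "fold_plane (y, w) \<in> cylinder.cell" by simp
    have "q (e i x, w) = q (R (e i y), w)" using R(3)[OF that(1) cell] y by simp
    also have "\<dots> = R' (p (e i y, w))" using q M(2)[OF that(1) cell] by simp
    also have "\<dots> = e' i (cylinder.rounding (fold_plane (y, w)))"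
      using p_e[OF that(1) cell that(3)] R'(3)[OF that(1) cell'] by simp
    finally show ?thesis using fold_ball_rounding y by metis
  qed
  ultimately show thesis using that by blast
qed

section \<open>Folding the pieces of the connected sums\<close>

lemma folding_restrict:
  assumes p: "folding M \<tau> N p"
    and UV: "\<And>m w. m \<in> M \<Longrightarrow> norm w = 1 \<Longrightarrow> p (m, w) \<in> V \<longleftrightarrow> m \<in> U"
  shows "folding (M - U) \<tau> (N - V) p"
proof (rule foldingI)
  show "continuous_on ((M - U) \<times> sphere 0 1) p"
    using folding_continuous[OF p] by (rule continuous_on_subset) auto
  show "p (m, w) \<in> N - V" if "m \<in> M - U" "norm w = 1" for m w
    using that UV folding_in[OF p] by auto
  show "\<exists>m\<in>M - U. \<exists>w. norm w = 1 \<and> p (m, w) = n" if n: "n \<in> N - V" for n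
  proof -
    obtain m w where "m \<in> M" "norm w = 1" "p (m, w) = n" using folding_onto[OF p] n by blast
    then show ?thesis using UV[of m w] n by blast
  qed
qed (use folding_fibre[OF p] in auto)

text \<open>Every point of the target ball or sphere is already hit from inside the chart
  \<open>e\<close>, by \<open>fold_ball_onto\<close>. The rest of its fibre is the mirror image,
  which lies in the same chart at the same radius.\<close>

lemma folding_ball_iff:
  assumes q: "folding M \<tau> N q"
    and e: "\<And>x. norm x \<le> 1 \<Longrightarrow> e x \<in> M" and e': "inj_on e' (cball 0 1)"
    and \<tau>: "\<And>x. norm x \<le> 1 \<Longrightarrow> \<tau> (e x) = e (cnj x)" "\<And>m. m \<in> M \<Longrightarrow> \<tau> m \<in> M" "\<And>m. m \<in> M \<Longrightarrow> \<tau> (\<tau> m) = m"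
    and q_e: "\<And>x w. norm x \<le> 1 \<Longrightarrow> norm w = 1 \<Longrightarrow> q (e x, w) = e' (fold_ball (x, w))"
    and m: "m \<in> M" "norm w = 1"
  shows "q (m, w) \<in> e' ` ball 0 1 \<longleftrightarrow> m \<in> e ` ball 0 1"
    and "q (m, w) \<in> e' ` sphere 0 1 \<longleftrightarrow> m \<in> e ` sphere 0 1"
proof -
  \<comment> \<open>The predicate \<open>P\<close> on radii treats the open ball and the sphere at
    once.\<close>
  have main: "m \<in> e ` {x. P (norm x)}"
    if qm: "q (m, w) \<in> e' ` {v. P (norm v)}" and P: "\<And>r. P r \<Longrightarrow> r \<le> 1"
      and PF: "\<And>x w. norm w = 1 \<Longrightarrow> P (norm (fold_ball (x, w))) \<longleftrightarrow> P (norm x)" for P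
  proof -
    obtain v where v: "P (norm v)" "q (m, w) = e' v" using qm by blast
    obtain x w' where x: "norm w' = 1" "fold_ball (x, w') = v" using fold_ball_onto by blast
    then have Px: "P (norm x)" using PF v(1) by blast
    then have x1: "norm x \<le> 1" using P by blast
    have "q (e x, w') = q (m, w)" using q_e[OF x1 x(1)] x(2) v(2) by simp
    then have "m = e x \<or> m = \<tau> (e x)"
      using folding_fibre[OF q e[OF x1] x(1) m] by blast
    then have "m = e x \<or> m = e (cnj x)" using \<tau>(1)[OF x1] by simp
    moreover have "P (norm (cnj x))" using Px by simp
    ultimately show ?thesis using Px by blast
  qed
  have conv: "q (m, w) \<in> e' ` {v. P (norm v)}"
    if "m \<in> e ` {x. P (norm x)}" and P: "\<And>r. P r \<Longrightarrow> r \<le> 1"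
      and PF: "\<And>x w. norm w = 1 \<Longrightarrow> P (norm (fold_ball (x, w))) \<longleftrightarrow> P (norm x)" for P
    using that q_e m(2) by blast
  show "q (m, w) \<in> e' ` ball 0 1 \<longleftrightarrow> m \<in> e ` ball 0 1"
    using main[of "\<lambda>r. r < 1"] conv[of "\<lambda>r. r < 1"] norm_fold_ball_iff by (auto simp: ball_def)
  show "q (m, w) \<in> e' ` sphere 0 1 \<longleftrightarrow> m \<in> e ` sphere 0 1"
    using main[of "\<lambda>r. r = 1"] conv[of "\<lambda>r. r = 1"] norm_fold_ball_iff by (auto simp: sphere_def)
qed

section \<open>Openness of the charts\<close>

lemma openin_inverse_stereographic:
  assumes "open W"
  shows "openin (top_of_set (sphere 0 1)) (inverse_stereographic ` W)"
proof -
  have "open {p :: 'a \<times> real. snd p \<noteq> 1}" by (intro open_Collect_neq continuous_intros)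
  then have "open ({p :: 'a \<times> real. snd p \<noteq> 1} \<inter> stereographic -` W)"
    using continuous_open_preimage[OF continuous_stereographic] assms by blast
  moreover have "inverse_stereographic ` W = sphere 0 1 \<inter> ({p. snd p \<noteq> 1} \<inter> stereographic -` W)"
  proof (intro set_eqI iffI)
    fix p :: "'a \<times> real" assume "p \<in> inverse_stereographic ` W"
    then obtain v where "v \<in> W" "p = inverse_stereographic v" by blast
    then show "p \<in> sphere 0 1 \<inter> ({p. snd p \<noteq> 1} \<inter> stereographic -` W)"
      using snd_inverse_stereographic_less[of v] by (simp add: norm_inverse_stereographic less_imp_neq)
  next
    fix p :: "'a \<times> real" assume p: "p \<in> sphere 0 1 \<inter> ({p. snd p \<noteq> 1} \<inter> stereographic -` W)"
    then have "inverse_stereographic (stereographic p) = p" by (intro inverse_stereographic_stereographic) auto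
    then show "p \<in> inverse_stereographic ` W" using p by (metis IntD2 image_eqI vimageD)
  qed
  ultimately show ?thesis by (metis openin_open_Int)
qed

lemma sphere_ball_eq: "sphere_ball b i ` W = inverse_stereographic ` (\<lambda>x. (4 * real i) *\<^sub>R b + x) ` W"
  by (auto simp: sphere_ball_def)

lemma openin_sphere_ball: "open W \<Longrightarrow> openin (top_of_set (sphere 0 1)) (sphere_ball b i ` W)"
  unfolding sphere_ball_eq by (intro openin_inverse_stereographic open_translation)

lemma sphere_ball_eq_iff: "sphere_ball b i x = sphere_ball b j y \<longleftrightarrow> (4 * real i) *\<^sub>R b + x = (4 * real j) *\<^sub>R b + y"
  by (simp add: sphere_ball_def inj_eq[OF inj_inverse_stereographic])

lemma continuous_sphere_ball: "continuous_on S (sphere_ball b i)"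
  unfolding sphere_ball_def
  by (intro continuous_on_compose2[OF continuous_inverse_stereographic[of UNIV]] continuous_intros) auto

lemma inj_sphere_ball: "inj (sphere_ball b i)"
  by (simp add: inj_def sphere_ball_eq_iff)

lemma norm_sphere_ball: "norm (sphere_ball b i x) = 1"
  by (simp add: sphere_ball_def norm_inverse_stereographic)

text \<open>\<open>exp\<close> is open by the open mapping theorem, and the unit circle meets the
  image of the strip over \<open>A\<close> exactly in the image of its imaginary axis.\<close>

lemma openin_cis:
  assumes "open A"
  shows "openin circle (cis ` A)"
proof -
  have "open (exp ` (Im -` A))"
  proof (rule open_mapping_thm[of exp UNIV])
    show "open (Im -` A)" using assms by (intro open_vimage continuous_intros)
    have "exp (0::complex) \<noteq> exp (\<i> * pi)" by simp
    then show "\<not> (exp :: complex \<Rightarrow> complex) constant_on UNIV" unfolding constant_on_def by (metis UNIV_I)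
  qed (auto intro: holomorphic_intros)
  moreover have "cis ` A = sphere 0 1 \<inter> exp ` (Im -` A)"
  proof (intro set_eqI iffI)
    fix w assume "w \<in> cis ` A"
    then obtain t where "t \<in> A" "w = cis t" by blast
    then show "w \<in> sphere 0 1 \<inter> exp ` (Im -` A)"
      by (auto simp: cis_conv_exp intro!: image_eqI[of _ exp "\<i> * complex_of_real t"])
  next
    fix w :: complex assume "w \<in> sphere 0 1 \<inter> exp ` (Im -` A)"
    then obtain z where z: "norm (exp z) = 1" "w = exp z" "Im z \<in> A" by auto
    then have "Re z = 0" by (simp add: norm_exp_eq_Re)
    then have "w = cis (Im z)" using z(2) by (simp add: exp_eq_polar)
    then show "w \<in> cis ` A" using z(3) by blast
  qed
  ultimately show ?thesis by (metis openin_open_Int)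
qed

lemma openin_torus_chart:
  assumes "open W"
  shows "openin (top_of_set (sphere 0 1 \<times> sphere 0 1)) (torus_chart ` W)"
proof (subst openin_subopen, intro ballI)
  fix m assume "m \<in> torus_chart ` W"
  then obtain z where z: "z \<in> W" "m = torus_chart z" by blast
  obtain d where d: "0 < d" "ball z d \<subseteq> W" using assms z(1) by (meson open_contains_ball)
  let ?A = "ball (Re z) (d/2)" and ?B = "ball (Im z) (d/2)"
  have "openin (top_of_set (sphere 0 1 \<times> sphere 0 1)) (cis ` ?A \<times> cis ` ?B)"
    by (intro openin_Times openin_cis open_ball)
  moreover have "m \<in> cis ` ?A \<times> cis ` ?B" using z(2) d(1) by (auto simp: torus_chart_def)
  moreover have "cis ` ?A \<times> cis ` ?B \<subseteq> torus_chart ` W"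
  proof clarify
    fix s t assume st: "s \<in> ?A" "t \<in> ?B"
    have "norm (z - Complex s t) \<le> \<bar>Re z - s\<bar> + \<bar>Im z - t\<bar>"
      using cmod_le[of "z - Complex s t"] by simp
    also have "\<dots> < d" using st by (simp add: dist_real_def)
    finally have "Complex s t \<in> W" using d(2) by (auto simp: dist_norm)
    then show "(cis s, cis t) \<in> torus_chart ` W"
      by (intro image_eqI[of _ _ "Complex s t"]) (auto simp: torus_chart_def)
  qed
  ultimately show "\<exists>T. openin (top_of_set (sphere 0 1 \<times> sphere 0 1)) T \<and> m \<in> T \<and> T \<subseteq> torus_chart ` W"
    by blast
qed

lemma norm_reflect_sphere: "norm (reflect_sphere m) = norm m"
  by (cases m) (simp add: reflect_sphere_def norm_Pair)

lemma sphere_piece_folding: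
  obtains p where
    "folding (sphere 0 1 - (\<Union>i<n. sphere_ball 1 i ` ball 0 1)) reflect_sphere
       (sphere 0 1 - (\<Union>i<n. sphere_ball (0, 1) i ` ball 0 1)) p"
    "\<And>i x w. i < n \<Longrightarrow> norm x = 1 \<Longrightarrow> norm w = 1 \<Longrightarrow>
       p (sphere_ball 1 i x, w) = sphere_ball (0, 1) i (fold_ball (x, w))"
proof -
  \<comment> \<open>The farthest cell has gauge radius 3/2 and centre \<open>4 * real n - 4\<close>,
    so a square of this size contains all cells.\<close>
  have L: "1 \<le> 4 * real n + 4" by simp
  obtain p0 where p0: "folding (sphere 0 1) reflect_sphere (sphere 0 1) p0"
    "\<And>y w. square_gauge y \<le> 4 * real n + 4 \<Longrightarrow> norm w = 1 \<Longrightarrow>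
       p0 (inverse_stereographic y, w) = inverse_stereographic (fold_plane (y, w))"
    using sphere_folding[OF L] by metis
  have \<tau>: "reflect_sphere (sphere_ball 1 i x) = sphere_ball 1 i (cnj x)" for i x
    by (simp add: sphere_ball_def reflect_inverse_stereographic)
  have \<tau>_in: "reflect_sphere m \<in> sphere 0 1" if "m \<in> sphere 0 1" for m
    using that by (simp add: norm_reflect_sphere)
  have \<tau>\<tau>: "reflect_sphere (reflect_sphere m) = m" for m
    by (simp add: reflect_sphere_def)
  obtain q where q: "folding (sphere 0 1) reflect_sphere (sphere 0 1) q"
    "\<And>i x w. i \<in> {..<n} \<Longrightarrow> norm x \<le> 1 \<Longrightarrow> norm w = 1 \<Longrightarrow>
       q (sphere_ball 1 i x, w) = sphere_ball (0, 1) i (fold_ball (x, w))"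
  proof (rule rounded_folding[OF p0(1), of "{..<n}" "sphere_ball 1" "sphere_ball (0, 1)"])
    show "openin (top_of_set (sphere 0 1)) (sphere_ball (1::complex) i ` {y. square_gauge y < 3/2})" for i
      by (intro openin_sphere_ball open_Collect_less square.continuous_gauge continuous_intros)
    show "openin (top_of_set (sphere 0 1)) (sphere_ball (0::complex, 1::real) i ` {v. cylinder_gauge v < 3/2})" for i
      by (intro openin_sphere_ball open_Collect_less cylinder.continuous_gauge continuous_intros)
    \<comment> \<open>Centres are 4 apart along the real axis, while a cell reaches only 3/2 from
      its centre.\<close>
    show "i = j" if "x \<in> square.cell" "y \<in> square.cell" "sphere_ball 1 i x = sphere_ball 1 j y" for i j x y
    proof -
      have "4 * real i + Re x = 4 * real j + Re y" using that(3) by (simp add: sphere_ball_eq_iff complex_eq_iff)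
      moreover have "\<bar>Re x\<bar> \<le> 3/2" "\<bar>Re y\<bar> \<le> 3/2" using that(1,2) by (auto simp: square_gauge_def)
      ultimately show ?thesis by linarith
    qed
    show "i = j" if "x \<in> cylinder.cell" "y \<in> cylinder.cell" "sphere_ball (0::complex, 1::real) i x = sphere_ball (0, 1) j y"
      for i j x y
    proof -
      have "snd ((4 * real i) *\<^sub>R (0::complex, 1::real) + x) = snd ((4 * real j) *\<^sub>R (0::complex, 1::real) + y)"
        using that(3) unfolding sphere_ball_eq_iff by (rule arg_cong)
      then have "4 * real i + snd x = 4 * real j + snd y" by simp
      moreover have "\<bar>snd x\<bar> \<le> 3/2" "\<bar>snd y\<bar> \<le> 3/2" using that(1,2) by (auto simp: cylinder_gauge_def)
      ultimately show ?thesis by linarith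
    qed
    show "p0 (sphere_ball 1 i x, w) = sphere_ball (0, 1) i (fold_plane (x, w))"
      if "i \<in> {..<n}" "x \<in> square.cell" "norm w = 1" for i x w
    proof -
      have "real i + 1 \<le> real n" using that(1) by auto
      then have "square_gauge (complex_of_real (4 * real i) + x) \<le> 4 * real n + 4"
        using that(2) by (auto simp: square_gauge_def)
      then show ?thesis
        using p0(2)[OF _ that(3)] fold_plane_translate[of "4 * real i" x w]
        by (simp add: sphere_ball_def scaleR_conv_of_real)
    qed
  qed (auto intro: continuous_sphere_ball inj_on_subset[OF inj_sphere_ball] simp: norm_sphere_ball \<tau> norm_reflect_sphere \<tau>\<tau>)
  have "folding (sphere 0 1 - (\<Union>i<n. sphere_ball 1 i ` ball 0 1)) reflect_sphere
       (sphere 0 1 - (\<Union>i<n. sphere_ball (0, 1) i ` ball 0 1)) q"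
  proof (rule folding_restrict[OF q(1)])
    fix m :: "complex \<times> real" and w :: complex assume mw: "m \<in> sphere 0 1" "norm w = 1"
    have "q (m, w) \<in> sphere_ball (0, 1) i ` ball 0 1 \<longleftrightarrow> m \<in> sphere_ball 1 i ` ball 0 1" if "i < n" for i
      by (rule folding_ball_iff(1)[OF q(1) _ _ _ \<tau>_in \<tau>\<tau> _ mw])
        (use that q(2) in \<open>auto simp: norm_sphere_ball \<tau> intro: inj_on_subset[OF inj_sphere_ball]\<close>)
    then show "q (m, w) \<in> (\<Union>i<n. sphere_ball (0, 1) i ` ball 0 1) \<longleftrightarrow> m \<in> (\<Union>i<n. sphere_ball 1 i ` ball 0 1)"
      by blast
  qed
  then show thesis using that q(2) by simp
qed

definition reflect_torus :: "complex \<times> complex \<Rightarrow> complex \<times> complex" where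
  "reflect_torus m = (fst m, cnj (snd m))"

lemma reflect_torus_chart: "reflect_torus (torus_chart x) = torus_chart (cnj x)"
  by (simp add: reflect_torus_def torus_chart_def cis_cnj)

lemma continuous_torus_chart: "continuous_on S torus_chart"
  unfolding torus_chart_def by (intro continuous_intros continuous_on_cis)

lemma continuous_S2xS1_chart: "continuous_on S S2xS1_chart"
  unfolding S2xS1_chart_def
  by (intro continuous_intros continuous_on_cis continuous_on_compose2[OF continuous_inverse_stereographic[of UNIV]]) auto

text \<open>The reflection affects only the second circle of the torus, which
  \<open>circle_folding\<close> combines with the extra circle into a 2-sphere. The first circle is
  carried along as the circle of \<open>S^2 \<times> S^1\<close>.\<close>

lemma torus_folding:
  obtains p where
    "folding (sphere 0 1 \<times> sphere 0 1) reflect_torus (sphere 0 1 \<times> sphere 0 1) p"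
    "\<And>x w. \<bar>Im x\<bar> \<le> pi / 2 \<Longrightarrow> norm w = 1 \<Longrightarrow> p (torus_chart x, w) = S2xS1_chart (fold_plane (x, w))"
proof -
  obtain c where c: "folding (sphere 0 1) cnj (sphere 0 1) c"
    "\<And>t w. \<bar>t\<bar> \<le> pi / 2 \<Longrightarrow> norm w = 1 \<Longrightarrow> c (cis t, w) = inverse_stereographic (fold_line (t, w))"
    using circle_folding by metis
  define p :: "(complex \<times> complex) \<times> complex \<Rightarrow> (complex \<times> real) \<times> complex"
    where "p = (\<lambda>q. (c (snd (fst q), snd q), fst (fst q)))"
  have "folding (sphere 0 1 \<times> sphere 0 1) reflect_torus (sphere 0 1 \<times> sphere 0 1) p"
  proof (rule foldingI)
    show "continuous_on ((sphere 0 1 \<times> sphere 0 1) \<times> sphere 0 1) p"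
      unfolding p_def
      by (intro continuous_intros continuous_on_compose2[OF folding_continuous[OF c(1)]]) auto
    show "p (m, w) \<in> sphere 0 1 \<times> sphere 0 1" if "m \<in> sphere 0 1 \<times> sphere 0 1" "norm w = 1" for m w
      using that folding_in[OF c(1)] by (auto simp: p_def)
    show "\<exists>m\<in>sphere 0 1 \<times> sphere 0 1. \<exists>w. norm w = 1 \<and> p (m, w) = k" if k: "k \<in> sphere 0 1 \<times> sphere 0 1" for k
    proof -
      have "fst k \<in> sphere 0 1" using k by auto
      then obtain v w where "v \<in> sphere 0 1" "norm w = 1" "c (v, w) = fst k" using folding_onto[OF c(1)] by metis
      then show ?thesis using k by (intro bexI[of _ "(snd k, v)"] exI[of _ w]) (auto simp: p_def)
    qed
    show "p (m, w) = p (m', w') \<longleftrightarrow> m' = m \<and> w' = w \<or> m' = reflect_torus m \<and> w' = cnj w"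
      if "m \<in> sphere 0 1 \<times> sphere 0 1" "norm w = 1" "m' \<in> sphere 0 1 \<times> sphere 0 1" "norm w' = 1" for m w m' w'
    proof -
      have "c (snd m, w) = c (snd m', w') \<longleftrightarrow> snd m' = snd m \<and> w' = w \<or> snd m' = cnj (snd m) \<and> w' = cnj w"
        using that by (intro folding_fibre[OF c(1)]) auto
      then show ?thesis by (auto simp: p_def reflect_torus_def prod_eq_iff)
    qed
  qed
  moreover have "p (torus_chart x, w) = S2xS1_chart (fold_plane (x, w))" if "\<bar>Im x\<bar> \<le> pi / 2" "norm w = 1" for x w
    using c(2)[OF that] by (simp add: p_def torus_chart_def S2xS1_chart_def fold_plane_def)
  ultimately show thesis using that by blast
qed

text \<open>The corners of the square cell have norm greater than 2 and so lie outside the disc of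
  \<open>inj_on_torus_chart\<close>; their coordinates still lie in the interval of
  \<open>inj_on_cis\<close>. The same holds for the rim of the cylinder cell.\<close>

lemma inj_on_torus_chart_cell: "inj_on torus_chart square.cell"
proof (rule inj_onI)
  fix x y assume xy: "x \<in> square.cell" "y \<in> square.cell" and eq: "torus_chart x = torus_chart y"
  have "Re x \<in> {-2..2}" "Re y \<in> {-2..2}" "Im x \<in> {-2..2}" "Im y \<in> {-2..2}"
    using xy by (auto simp: square_gauge_def)
  then show "x = y" using eq inj_on_eq_iff[OF inj_on_cis] by (simp add: torus_chart_def complex_eq_iff[of x y])
qed

lemma inj_on_S2xS1_chart_cell: "inj_on S2xS1_chart cylinder.cell"
proof (rule inj_onI)
  fix x y assume xy: "x \<in> cylinder.cell" "y \<in> cylinder.cell" and eq: "S2xS1_chart x = S2xS1_chart y"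
  have "snd x \<in> {-2..2}" "snd y \<in> {-2..2}"
    using xy by (auto simp: cylinder_gauge_def)
  moreover have "inverse_stereographic (fst x) = inverse_stereographic (fst y)" "cis (snd x) = cis (snd y)"
    using eq by (simp_all add: S2xS1_chart_def)
  ultimately have "fst x = fst y" "snd x = snd y"
    using inj_onD[OF inj_on_cis] injD[OF inj_inverse_stereographic] by blast+
  then show "x = y" by (rule prod_eqI)
qed

text \<open>The last conclusion is recorded because the map of connected sums must send the seam,
  and nothing else, to the seam.\<close>

lemma torus_piece_folding:
  obtains p where
    "folding (sphere 0 1 \<times> sphere 0 1 - torus_chart ` ball 0 1) reflect_torus
       (sphere 0 1 \<times> sphere 0 1 - S2xS1_chart ` ball 0 1) p"
    "\<And>x w. norm x = 1 \<Longrightarrow> norm w = 1 \<Longrightarrow> p (torus_chart x, w) = S2xS1_chart (fold_ball (x, w))"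
    "\<And>m w. m \<in> sphere 0 1 \<times> sphere 0 1 \<Longrightarrow> norm w = 1 \<Longrightarrow>
       p (m, w) \<in> S2xS1_chart ` sphere 0 1 \<longleftrightarrow> m \<in> torus_chart ` sphere 0 1"
proof -
  let ?M = "sphere 0 1 \<times> sphere 0 1 :: (complex \<times> complex) set"
  obtain p0 where p0: "folding ?M reflect_torus (sphere 0 1 \<times> sphere 0 1) p0"
    "\<And>x w. \<bar>Im x\<bar> \<le> pi / 2 \<Longrightarrow> norm w = 1 \<Longrightarrow> p0 (torus_chart x, w) = S2xS1_chart (fold_plane (x, w))"
    using torus_folding by metis
  have \<tau>_in: "reflect_torus m \<in> ?M" if "m \<in> ?M" for m
    using that by (auto simp: reflect_torus_def)
  have \<tau>\<tau>: "reflect_torus (reflect_torus m) = m" for m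
    by (simp add: reflect_torus_def)
  have chart_in: "torus_chart x \<in> ?M" for x by (simp add: torus_chart_def)
  obtain q where q: "folding ?M reflect_torus (sphere 0 1 \<times> sphere 0 1) q"
    "\<And>i x w. i \<in> {0::nat} \<Longrightarrow> norm x \<le> 1 \<Longrightarrow> norm w = 1 \<Longrightarrow>
       q (torus_chart x, w) = S2xS1_chart (fold_ball (x, w))"
  proof (rule rounded_folding[OF p0(1), of "{0}" "\<lambda>_. torus_chart" "\<lambda>_. S2xS1_chart"])
    show "compact ?M" by (intro compact_Times compact_sphere)
    show "inj_on torus_chart square.cell" by (rule inj_on_torus_chart_cell)
    show "inj_on S2xS1_chart cylinder.cell" by (rule inj_on_S2xS1_chart_cell)
    show "continuous_on square.cell torus_chart" by (rule continuous_torus_chart)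
    show "continuous_on cylinder.cell S2xS1_chart" by (rule continuous_S2xS1_chart)
    show "closed (sphere 0 1 \<times> sphere 0 1 :: ((complex \<times> real) \<times> complex) set)" by (intro closed_Times closed_sphere)
    show "openin (top_of_set ?M) (torus_chart ` {y. square_gauge y < 3/2})"
      by (intro openin_torus_chart open_Collect_less square.continuous_gauge continuous_intros)
    show "openin (top_of_set (sphere 0 1 \<times> sphere 0 1)) (S2xS1_chart ` {v. cylinder_gauge v < 3/2})"
    proof -
      have "S2xS1_chart ` {v. cylinder_gauge v < 3/2} = inverse_stereographic ` ball 0 (3/2) \<times> cis ` {-(3/2)<..<3/2}"
      proof -
        have 1: "{v. cylinder_gauge v < 3/2} = ball 0 (3/2) \<times> {-(3/2)<..<3/2}"
          by (auto simp: cylinder_gauge_def abs_less_iff)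
        have 2: "S2xS1_chart = (\<lambda>(a, b). (inverse_stereographic a, cis b))"
          by (auto simp: S2xS1_chart_def fun_eq_iff)
        show ?thesis unfolding 1 2 image_paired_Times ..
      qed
      then show ?thesis by (simp add: openin_Times openin_inverse_stereographic openin_cis)
    qed
    show "p0 (torus_chart x, w) = S2xS1_chart (fold_plane (x, w))" if "x \<in> square.cell" "norm w = 1" for x w
    proof (rule p0(2)[OF _ that(2)])
      \<comment> \<open>As \<open>3/2 \<le> pi/2\<close>, the cell fits into the arc on which
        \<open>torus_folding\<close> is explicit.\<close>
      have "\<bar>Im x\<bar> \<le> 3/2" using that(1) by (auto simp: square_gauge_def)
      then show "\<bar>Im x\<bar> \<le> pi / 2" using pi_gt3 by linarith
    qed
  qed (auto simp: norm_inverse_stereographic S2xS1_chart_def torus_chart_def cis_cnj reflect_torus_def)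
  have inj: "inj_on S2xS1_chart (cball 0 1)"
    by (rule inj_on_subset[OF inj_on_S2xS1_chart]) auto
  have qc: "q (torus_chart x, w) = S2xS1_chart (fold_ball (x, w))" if "norm x \<le> 1" "norm w = 1" for x w
    using q(2)[of 0] that by simp
  have ball: "q (m, w) \<in> S2xS1_chart ` ball 0 1 \<longleftrightarrow> m \<in> torus_chart ` ball 0 1"
    if "m \<in> ?M" "norm w = 1" for m w
    by (rule folding_ball_iff(1)[where \<tau> = reflect_torus, OF q(1) chart_in inj reflect_torus_chart \<tau>_in \<tau>\<tau> qc that])
  have sphere: "q (m, w) \<in> S2xS1_chart ` sphere 0 1 \<longleftrightarrow> m \<in> torus_chart ` sphere 0 1"
    if "m \<in> ?M" "norm w = 1" for m w
    by (rule folding_ball_iff(2)[where \<tau> = reflect_torus, OF q(1) chart_in inj reflect_torus_chart \<tau>_in \<tau>\<tau> qc that])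
  have "folding (?M - torus_chart ` ball 0 1) reflect_torus
       (sphere 0 1 \<times> sphere 0 1 - S2xS1_chart ` ball 0 1) q"
    using q(1) ball by (rule folding_restrict)
  then show thesis using qc sphere by (intro that[of q]) auto
qed

section \<open>Attaching copies of a punctured space\<close>

lemma openin_tube:
  assumes "openin (prod_topology X Y) W" "compactin Y C"
  shows "openin X {x \<in> topspace X. {x} \<times> C \<subseteq> W}"
proof (subst openin_subopen, intro ballI)
  fix x assume "x \<in> {x \<in> topspace X. {x} \<times> C \<subseteq> W}"
  then obtain U V where "openin X U" "x \<in> U" "C \<subseteq> V" "U \<times> V \<subseteq> W"
    using tube_lemma_right[OF assms(1,2), of x] by auto
  then show "\<exists>T. openin X T \<and> x \<in> T \<and> T \<subseteq> {x \<in> topspace X. {x} \<times> C \<subseteq> W}"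
    using openin_subset[of X U] by (intro exI[of _ U]) auto
qed

text \<open>In the applications \<open>P\<close> is the punctured sphere, \<open>T\<close> the
  punctured summand with boundary \<open>K\<close>, and \<open>s i\<close> glues the boundary of the
  \<open>i\<close>-th copy.\<close>

locale attached_copies =
  fixes P :: "'p::topological_space set" and T K :: "'m::topological_space set" and n :: nat
    and s :: "nat \<Rightarrow> 'm \<Rightarrow> 'p"
  assumes K_subset: "K \<subseteq> T" and s_in: "i < n \<Longrightarrow> y \<in> K \<Longrightarrow> s i y \<in> P"
begin

definition glued :: "('p + nat \<times> 'm) topology" where
  "glued = adjunction_space (top_of_set P) (sum_topology (\<lambda>i. top_of_set T) {..<n})
     ({..<n} \<times> K) (\<lambda>(i, y). s i y)"

text \<open>The quotient map on the \<open>i\<close>-th copy of \<open>T\<close>; seam points have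
  their representatives in \<open>P\<close>.\<close>

definition copy :: "nat \<Rightarrow> 'm \<Rightarrow> 'p + nat \<times> 'm" where
  "copy i m = (if m \<in> K then Inl (s i m) else Inr (i, m))"

lemma topspace_glued: "topspace glued = Inl ` P \<union> Inr ` ({..<n} \<times> (T - K))"
proof -
  have "{..<n} \<times> T - {..<n} \<times> K = {..<n} \<times> (T - K)" by blast
  then show ?thesis
    unfolding glued_def using s_in
    by (subst topspace_adjunction_space) (auto simp: Sigma_def)
qed

lemma Inl_in [simp]: "Inl x \<in> topspace glued \<longleftrightarrow> x \<in> P"
  by (auto simp: topspace_glued)

lemma Inr_in [simp]: "Inr (i, m) \<in> topspace glued \<longleftrightarrow> i < n \<and> m \<in> T \<and> m \<notin> K"
  by (auto simp: topspace_glued)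

lemma copy_in: "i < n \<Longrightarrow> m \<in> T \<Longrightarrow> copy i m \<in> topspace glued"
  using s_in by (auto simp: copy_def)

lemma openin_glued:
  "openin glued U \<longleftrightarrow> U \<subseteq> topspace glued \<and> openin (top_of_set P) {x \<in> P. Inl x \<in> U} \<and>
     (\<forall>i<n. openin (top_of_set T) {m \<in> T. copy i m \<in> U})"
proof -
  have top: "topspace glued = Inl ` topspace (top_of_set P) \<union>
      Inr ` (topspace (sum_topology (\<lambda>i. top_of_set T) {..<n}) - {..<n} \<times> K)"
    unfolding topspace_glued by auto
  have copy: "attach ({..<n} \<times> K) (\<lambda>(i, y). s i y) (i, m) = copy i m" if "i < n" for i m
    using that by (simp add: attach_def copy_def)
  have slice: "{m. (i, m) \<in> {y \<in> topspace (sum_topology (\<lambda>i. top_of_set T) {..<n}).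
      attach ({..<n} \<times> K) (\<lambda>(i, y). s i y) y \<in> U}} = {m \<in> T. copy i m \<in> U}" if "i < n" for i
    using that copy[OF that] by auto
  show ?thesis
    unfolding glued_def openin_adjunction_space
    unfolding glued_def[symmetric] top openin_sum_topology using slice by auto
qed

lemma continuous_map_Inl: "continuous_map (top_of_set P) glued Inl"
  by (auto simp: continuous_map_def openin_glued)

lemma continuous_map_copy: "i < n \<Longrightarrow> continuous_map (top_of_set T) glued (copy i)"
  using copy_in by (auto simp: continuous_map_def openin_glued)

lemma topspace_cases:
  assumes "z \<in> topspace glued"
  obtains x where "x \<in> P" "z = Inl x" | i m where "i < n" "m \<in> T" "m \<notin> K" "z = Inr (i, m)" "z = copy i m"
  using assms by (auto simp: topspace_glued copy_def)

lemma continuous_map_from_glued: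
  assumes "continuous_map (top_of_set P) W (\<lambda>x. h (Inl x))"
    and "\<And>i. i < n \<Longrightarrow> continuous_map (top_of_set T) W (\<lambda>m. h (copy i m))"
  shows "continuous_map glued W h"
proof -
  have "h z \<in> topspace W" if z: "z \<in> topspace glued" for z
    using z
  proof (cases z rule: topspace_cases)
    case (1 x) then show ?thesis using assms(1) by (auto simp: continuous_map_def)
  next
    case (2 i m) then show ?thesis using assms(2)[of i] by (fastforce simp: continuous_map_def)
  qed
  moreover have "openin glued {z \<in> topspace glued. h z \<in> U}" if "openin W U" for U
  proof -
    have 1: "{x \<in> P. Inl x \<in> {z \<in> topspace glued. h z \<in> U}} = {x \<in> topspace (top_of_set P). h (Inl x) \<in> U}"
      by auto
    have 2: "{m \<in> T. copy i m \<in> {z \<in> topspace glued. h z \<in> U}} = {m \<in> topspace (top_of_set T). h (copy i m) \<in> U}"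
      if "i < n" for i
      using copy_in[OF that] by auto
    show ?thesis
      unfolding openin_glued
    proof (intro conjI allI impI)
      show "openin (top_of_set P) {x \<in> P. Inl x \<in> {z \<in> topspace glued. h z \<in> U}}"
        unfolding 1 using assms(1) that by (rule openin_continuous_map_preimage)
      show "openin (top_of_set T) {m \<in> T. copy i m \<in> {z \<in> topspace glued. h z \<in> U}}" if "i < n" for i
        unfolding 2[OF that] using assms(2)[OF that] \<open>openin W U\<close> by (rule openin_continuous_map_preimage)
    qed auto
  qed
  ultimately show ?thesis by (simp add: continuous_map_def)
qed

lemma compact_space_glued:
  assumes "compact P" "compact T"
  shows "compact_space glued"
proof -
  have "compactin glued (Inl ` P)"
    by (rule image_compactin[OF _ continuous_map_Inl]) (simp add: assms compactin_subtopology)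
  moreover have "compactin glued (\<Union>i<n. copy i ` T)"
  proof (rule compactin_Union)
    show "finite ((\<lambda>i. copy i ` T) ` {..<n})" by simp
    fix S assume "S \<in> (\<lambda>i. copy i ` T) ` {..<n}"
    then obtain i where "i < n" "S = copy i ` T" by blast
    then show "compactin glued S"
      using image_compactin[OF _ continuous_map_copy, of T i] by (simp add: assms compactin_subtopology)
  qed
  ultimately have "compactin glued (Inl ` P \<union> (\<Union>i<n. copy i ` T))" by (rule compactin_Un)
  moreover have "Inl ` P \<union> (\<Union>i<n. copy i ` T) = topspace glued"
  proof
    show "Inl ` P \<union> (\<Union>i<n. copy i ` T) \<subseteq> topspace glued" using copy_in by auto
    show "topspace glued \<subseteq> Inl ` P \<union> (\<Union>i<n. copy i ` T)"
    proof
      fix z assume "z \<in> topspace glued"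
      then show "z \<in> Inl ` P \<union> (\<Union>i<n. copy i ` T)"
      proof (cases z rule: topspace_cases)
        case (2 i m)
        then have "z \<in> copy i ` T" by blast
        then show ?thesis using \<open>i < n\<close> by blast
      qed blast
    qed
  qed
  ultimately show ?thesis by (simp add: compact_space_def)
qed

text \<open>That is, the product of the quotient map with the identity of \<open>S\<close> is a quotient map; the tube lemma
  gives this for compact \<open>S\<close>.\<close>

lemma continuous_map_from_prod:
  fixes S :: "'c::metric_space set"
  assumes S: "compact S"
    and h1: "continuous_map (prod_topology (top_of_set P) (top_of_set S)) W (\<lambda>q. h (Inl (fst q), snd q))"
    and h2: "\<And>i. i < n \<Longrightarrow>
      continuous_map (prod_topology (top_of_set T) (top_of_set S)) W (\<lambda>q. h (copy i (fst q), snd q))"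
  shows "continuous_map (prod_topology glued (top_of_set S)) W h"
  unfolding continuous_map_def
proof (intro conjI allI impI)
  have pw: "continuous_map (top_of_set S) W (\<lambda>c. h (z, c))" if z: "z \<in> topspace glued" for z
    using z
  proof (cases z rule: topspace_cases)
    case (1 x)
    have "continuous_map (top_of_set S) (prod_topology (top_of_set P) (top_of_set S)) (\<lambda>c. (x, c))"
      using 1 by (intro continuous_map_pairedI) auto
    from continuous_map_compose[OF this h1] show ?thesis using 1 by (simp add: comp_def)
  next
    case (2 i m)
    have "continuous_map (top_of_set S) (prod_topology (top_of_set T) (top_of_set S)) (\<lambda>c. (m, c))"
      using 2 by (intro continuous_map_pairedI) auto
    from continuous_map_compose[OF this h2[OF 2(1)]] show ?thesis using 2 by (simp add: comp_def)
  qed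
  show "h \<in> topspace (prod_topology glued (top_of_set S)) \<rightarrow> topspace W"
    using pw by (fastforce simp: continuous_map_def)
  fix U assume U: "openin W U"
  let ?W = "{q \<in> topspace (prod_topology glued (top_of_set S)). h q \<in> U}"
  show "openin (prod_topology glued (top_of_set S)) ?W"
  proof (subst openin_subopen, intro ballI)
    fix q assume q: "q \<in> ?W"
    obtain z c where zc: "q = (z, c)" "z \<in> topspace glued" "c \<in> S" "h (z, c) \<in> U" using q by auto
    have "openin (top_of_set S) {c \<in> topspace (top_of_set S). h (z, c) \<in> U}"
      using pw[OF zc(2)] U by (rule openin_continuous_map_preimage)
    then obtain d where d: "0 < d" "\<And>c'. c' \<in> S \<Longrightarrow> dist c' c < d \<Longrightarrow> h (z, c') \<in> U"
      using zc by (auto simp: openin_euclidean_subtopology_iff)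
    \<comment> \<open>A compact neighbourhood of \<open>c\<close> in \<open>S\<close> on which
      \<open>h (z, _)\<close> stays in \<open>U\<close>. By the tube lemma the set \<open>V\<close>
      of all \<open>z'\<close> with this property has open preimages in the pieces, so it is open in
      the glued space.\<close>
    define J where "J = S \<inter> cball c (d/2)"
    have J: "compactin (top_of_set S) J"
      unfolding J_def compactin_subtopology using S by (auto intro: compact_Int_closed)
    have zJ: "{z} \<times> J \<subseteq> ?W"
      using d zc(2) by (auto simp: J_def dist_commute intro!: d(2))
    define V where "V = {z' \<in> topspace glued. {z'} \<times> J \<subseteq> ?W}"
    have JS: "J \<subseteq> S" by (simp add: J_def)
    have V1: "{x \<in> P. Inl x \<in> V} = {x \<in> topspace (top_of_set P). {x} \<times> J \<subseteq>
        {q \<in> topspace (prod_topology (top_of_set P) (top_of_set S)). h (Inl (fst q), snd q) \<in> U}}"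
      using JS by (auto simp: V_def)
    have V2: "{m \<in> T. copy i m \<in> V} = {m \<in> topspace (top_of_set T). {m} \<times> J \<subseteq>
        {q \<in> topspace (prod_topology (top_of_set T) (top_of_set S)). h (copy i (fst q), snd q) \<in> U}}"
      if "i < n" for i
      using JS copy_in[OF that] by (auto simp: V_def)
    have "openin glued V"
      unfolding openin_glued
    proof (intro conjI allI impI)
      show "V \<subseteq> topspace glued" by (auto simp: V_def)
      show "openin (top_of_set P) {x \<in> P. Inl x \<in> V}"
        unfolding V1 by (rule openin_tube[OF openin_continuous_map_preimage[OF h1 U] J])
      show "openin (top_of_set T) {m \<in> T. copy i m \<in> V}" if "i < n" for i
        unfolding V2[OF that] by (rule openin_tube[OF openin_continuous_map_preimage[OF h2[OF that] U] J])
    qed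
    moreover have "openin (top_of_set S) (S \<inter> ball c (d/2))" by (simp add: openin_open_Int)
    ultimately have "openin (prod_topology glued (top_of_set S)) (V \<times> (S \<inter> ball c (d/2)))"
      by (simp add: openin_prod_Times_iff)
    moreover have "q \<in> V \<times> (S \<inter> ball c (d/2))" using zc zJ d(1) by (simp add: V_def)
    moreover have "V \<times> (S \<inter> ball c (d/2)) \<subseteq> ?W"
    proof -
      have "S \<inter> ball c (d/2) \<subseteq> J" by (auto simp: J_def)
      then show ?thesis by (auto simp: V_def)
    qed
    ultimately show "\<exists>V. openin (prod_topology glued (top_of_set S)) V \<and> q \<in> V \<and> V \<subseteq> ?W" by blast
  qed
qed

end

section \<open>The map between connected sums\<close>

text \<open>A continuous surjection from a compact space onto a Hausdorff space is closed, hence a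
  quotient map.\<close>

lemma folding_quotient_map:
  fixes p :: "'a::t2_space \<times> complex \<Rightarrow> 'b::metric_space"
  assumes p: "folding M \<tau> N p" and M: "compact M"
  shows "quotient_map (prod_topology (top_of_set M) circle) (top_of_set N) p"
proof -
  have prod: "prod_topology (top_of_set M) circle = top_of_set (M \<times> sphere 0 1)"
    by (simp add: subtopology_Times euclidean_product_topology)
  have "p ` (M \<times> sphere 0 1) = N" using p by (simp add: folding_def)
  moreover have cont: "continuous_map (top_of_set (M \<times> sphere 0 1)) (top_of_set N) p"
    using folding_continuous[OF p] \<open>p ` _ = N\<close> by auto
  moreover have "closed_map (top_of_set (M \<times> sphere 0 1)) (top_of_set N) p"
  proof (rule continuous_imp_closed_map[OF cont])
    show "compact_space (top_of_set (M \<times> sphere (0::complex) 1))"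
      using M by (simp add: compact_space_subtopology compact_Times)
    show "Hausdorff_space (top_of_set N)" by (intro Hausdorff_space_subtopology Hausdorff_space_euclidean)
  qed
  ultimately show ?thesis
    unfolding prod by (intro continuous_closed_imp_quotient_map) auto
qed

text \<open>The \<open>Inr\<close> case concerns points off the seam; a seam point is stored as
  \<open>Inl\<close> and mapped by \<open>p1\<close>. That \<open>p2\<close> gives the same point
  after gluing is the content of \<open>f_copy\<close>.\<close>

definition sum_map ::
    "('p \<times> complex \<Rightarrow> 'p') \<Rightarrow> ('m \<times> complex \<Rightarrow> 'm') \<Rightarrow> ('p + nat \<times> 'm) \<times> complex \<Rightarrow> 'p' + nat \<times> 'm'" where
  "sum_map p1 p2 q = (case fst q of Inl x \<Rightarrow> Inl (p1 (x, snd q)) | Inr (i, m) \<Rightarrow> Inr (i, p2 (m, snd q)))"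

definition sum_reflection :: "('p \<Rightarrow> 'p) \<Rightarrow> ('m \<Rightarrow> 'm) \<Rightarrow> 'p + nat \<times> 'm \<Rightarrow> 'p + nat \<times> 'm" where
  "sum_reflection \<tau>1 \<tau>2 z = (case z of Inl x \<Rightarrow> Inl (\<tau>1 x) | Inr (i, m) \<Rightarrow> Inr (i, \<tau>2 m))"

locale folded_copies =
  src: attached_copies P T K n s + tgt: attached_copies P' T' K' n s'
  for P :: "'p::t2_space set" and T K :: "'m::t2_space set" and n s
    and P' :: "'q::metric_space set" and T' K' :: "'k::metric_space set" and s' +
  fixes \<tau>1 \<tau>2 p1 p2
  assumes compact_P: "compact P" and compact_T: "compact T"
    and p1: "folding P \<tau>1 P' p1" and p2: "folding T \<tau>2 T' p2"
    and K_iff: "m \<in> T \<Longrightarrow> norm w = 1 \<Longrightarrow> p2 (m, w) \<in> K' \<longleftrightarrow> m \<in> K"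
    and glue: "i < n \<Longrightarrow> m \<in> K \<Longrightarrow> norm w = 1 \<Longrightarrow> p1 (s i m, w) = s' i (p2 (m, w))"
begin

abbreviation "f \<equiv> sum_map p1 p2"

lemma f_Inl: "f (Inl x, w) = Inl (p1 (x, w))"
  by (simp add: sum_map_def)

lemma f_copy:
  assumes "i < n" "m \<in> T" "norm w = 1"
  shows "f (src.copy i m, w) = tgt.copy i (p2 (m, w))"
  using K_iff[OF assms(2,3)] glue[OF assms(1) _ assms(3)]
  by (simp add: src.copy_def tgt.copy_def sum_map_def)

lemma continuous_f: "continuous_map (prod_topology src.glued circle) tgt.glued f"
proof (rule src.continuous_map_from_prod)
  have "continuous_map (prod_topology (top_of_set P) circle) tgt.glued (Inl \<circ> p1)"
    by (rule continuous_map_compose[OF quotient_imp_continuous_map[OF folding_quotient_map[OF p1 compact_P]] tgt.continuous_map_Inl])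
  then show "continuous_map (prod_topology (top_of_set P) circle) tgt.glued (\<lambda>q. f (Inl (fst q), snd q))"
    by (simp add: f_Inl comp_def)
  fix i assume i: "i < n"
  have "continuous_map (prod_topology (top_of_set T) circle) tgt.glued (tgt.copy i \<circ> p2)"
    by (rule continuous_map_compose[OF quotient_imp_continuous_map[OF folding_quotient_map[OF p2 compact_T]] tgt.continuous_map_copy[OF i]])
  then show "continuous_map (prod_topology (top_of_set T) circle) tgt.glued (\<lambda>q. f (src.copy i (fst q), snd q))"
    by (rule continuous_map_eq) (use f_copy[OF i] in auto)
qed simp

text \<open>An open preimage pulls back to open sets in the products of the pieces with the circle,
  where \<open>p1\<close> and \<open>p2\<close> are quotient maps. Openness in the glued target is
  tested on its pieces.\<close>

lemma quotient_f: "quotient_map (prod_topology src.glued circle) tgt.glued f"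
  unfolding quotient_map_def
proof (intro conjI allI impI)
  let ?X = "prod_topology src.glued circle"
  show "f ` topspace ?X = topspace tgt.glued"
  proof
    show "f ` topspace ?X \<subseteq> topspace tgt.glued"
      using continuous_map_image_subset_topspace[OF continuous_f] .
    show "topspace tgt.glued \<subseteq> f ` topspace ?X"
    proof
      fix y assume "y \<in> topspace tgt.glued"
      then show "y \<in> f ` topspace ?X"
      proof (cases y rule: tgt.topspace_cases)
        case (1 v)
        obtain x w where "x \<in> P" "norm w = 1" "p1 (x, w) = v" using folding_onto[OF p1 1(1)] .
        then show ?thesis using 1 by (intro image_eqI[of _ _ "(Inl x, w)"]) (auto simp: f_Inl)
      next
        case (2 i v)
        obtain m w where "m \<in> T" "norm w = 1" "p2 (m, w) = v" using folding_onto[OF p2 2(2)] .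
        then show ?thesis using 2 src.copy_in f_copy
          by (intro image_eqI[of _ _ "(src.copy i m, w)"]) auto
      qed
    qed
  qed
  fix U assume U: "U \<subseteq> topspace tgt.glued"
  show "openin ?X {q \<in> topspace ?X. f q \<in> U} \<longleftrightarrow> openin tgt.glued U"
  proof
    assume op: "openin ?X {q \<in> topspace ?X. f q \<in> U}"
    have pull: "openin (prod_topology (top_of_set A) circle) {q \<in> topspace (prod_topology (top_of_set A) circle). (a (fst q), snd q) \<in> {q \<in> topspace ?X. f q \<in> U}}"
      if "continuous_map (top_of_set A) src.glued a" for a and A :: "'c::topological_space set"
    proof (rule openin_continuous_map_preimage[OF _ op])
      show "continuous_map (prod_topology (top_of_set A) circle) ?X (\<lambda>q. (a (fst q), snd q))"
        by (intro continuous_map_pairedI continuous_map_snd continuous_map_compose[OF continuous_map_fst that, unfolded comp_def])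
    qed
    show "openin tgt.glued U"
      unfolding tgt.openin_glued
    proof (intro conjI U allI impI)
      have "{q \<in> topspace (prod_topology (top_of_set P) circle). (Inl (fst q), snd q) \<in> {q \<in> topspace ?X. f q \<in> U}} =
        {q \<in> topspace (prod_topology (top_of_set P) circle). p1 q \<in> {x \<in> P'. Inl x \<in> U}}"
        using folding_in[OF p1] by (auto simp: f_Inl)
      then show "openin (top_of_set P') {x \<in> P'. Inl x \<in> U}"
        using pull[OF src.continuous_map_Inl] folding_quotient_map[OF p1 compact_P]
        unfolding quotient_map_def by (simp del: mem_Collect_eq)
      fix i assume i: "i < n"
      have "{q \<in> topspace (prod_topology (top_of_set T) circle). (src.copy i (fst q), snd q) \<in> {q \<in> topspace ?X. f q \<in> U}} =
        {q \<in> topspace (prod_topology (top_of_set T) circle). p2 q \<in> {m \<in> T'. tgt.copy i m \<in> U}}"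
        using folding_in[OF p2] f_copy[OF i] src.copy_in[OF i] by auto
      then show "openin (top_of_set T') {m \<in> T'. tgt.copy i m \<in> U}"
        using pull[OF src.continuous_map_copy[OF i]] folding_quotient_map[OF p2 compact_T]
        unfolding quotient_map_def by (simp del: mem_Collect_eq)
    qed
  qed (rule openin_continuous_map_preimage[OF continuous_f])
qed

text \<open>Every point has one representative, in \<open>P\<close> or off the seam of one copy, so
  the fibres of the two foldings never mix.\<close>

lemma fibre_f:
  assumes "q \<in> topspace (prod_topology src.glued circle)" "q' \<in> topspace (prod_topology src.glued circle)"
  shows "f q = f q' \<longleftrightarrow> q' = q \<or> q' = (sum_reflection \<tau>1 \<tau>2 (fst q), cnj (snd q))"
proof -
  obtain z w z' w' where q: "q = (z, w)" "q' = (z', w')" by (cases q; cases q') 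
  then have z: "z \<in> topspace src.glued" "z' \<in> topspace src.glued" and w: "norm w = 1" "norm w' = 1"
    using assms by auto
  show ?thesis
    using z folding_fibre[OF p1 _ w(1) _ w(2)] folding_fibre[OF p2 _ w(1) _ w(2)]
    by (auto simp: q src.topspace_glued sum_map_def sum_reflection_def)
qed

end

section \<open>The product of a reflected surface and a circle\<close>

definition reflected_chart :: "'a topology \<Rightarrow> ('a \<Rightarrow> 'a) \<Rightarrow> 'a set \<Rightarrow> ('a \<Rightarrow> complex) \<Rightarrow> bool" where
  "reflected_chart X \<tau> V h \<longleftrightarrow> openin X V \<and> open (h ` V) \<and>
     homeomorphic_map (subtopology X V) (top_of_set (h ` V)) h \<and>
     \<tau> ` V \<subseteq> V \<and> (\<forall>v\<in>V. h (\<tau> v) = cnj (h v))"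

text \<open>What a surface must provide for its product with the circle to satisfy the criteria for
  quotients by an involution: \<open>b\<close> is the surface part of \<open>j\<close>, and
  \<open>paths\<close> supplies the excursions that close lifted loops.\<close>

locale reflected_surface =
  fixes X :: "'a topology" and \<tau> :: "'a \<Rightarrow> 'a" and b :: "'a \<Rightarrow> real"
  assumes compact: "compact_space X"
    and continuous_\<tau>: "continuous_map X X \<tau>"
    and \<tau>_\<tau>: "x \<in> topspace X \<Longrightarrow> \<tau> (\<tau> x) = x"
    and continuous_b: "continuous_map X euclidean b"
    and b_\<tau>: "x \<in> topspace X \<Longrightarrow> b (\<tau> x) = - b x"
    and b_eq_0: "x \<in> topspace X \<Longrightarrow> b x = 0 \<Longrightarrow> \<tau> x = x"
    and charts: "x \<in> topspace X \<Longrightarrow> b x = 0 \<Longrightarrow> \<exists>V h. x \<in> V \<and> reflected_chart X \<tau> V h"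
    and paths: "x \<in> topspace X \<Longrightarrow> \<exists>d. pathin X d \<and> d 0 = x \<and> b (d 1) = 0"

text \<open>A surface of given genus is known only up to homeomorphism, so all data are carried over
  from the model.\<close>

lemma homeomorphic_reflected_surface:
  assumes "reflected_surface X \<tau> b" and k: "homeomorphic_maps X' X k k'"
  shows "reflected_surface X' (k' \<circ> \<tau> \<circ> k) (b \<circ> k)"
proof -
  interpret reflected_surface X \<tau> b by fact
  have ck: "continuous_map X' X k" "continuous_map X X' k'"
    and kk: "\<And>x. x \<in> topspace X' \<Longrightarrow> k' (k x) = x" "\<And>y. y \<in> topspace X \<Longrightarrow> k (k' y) = y"
    using k by (auto simp: homeomorphic_maps_def)
  have k_in: "k x \<in> topspace X" if "x \<in> topspace X'" for x using ck(1) that by (auto simp: continuous_map_def)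
  have k'_in: "k' y \<in> topspace X'" if "y \<in> topspace X" for y using ck(2) that by (auto simp: continuous_map_def)
  have \<tau>_in: "\<tau> y \<in> topspace X" if "y \<in> topspace X" for y using continuous_\<tau> that by (auto simp: continuous_map_def)
  have hk: "homeomorphic_map X' X k" using k homeomorphic_map_maps by blast
  show ?thesis
  proof
    show "compact_space X'"
      using compact homeomorphic_compact_space[of X' X] k homeomorphic_space_def by blast
    show "continuous_map X' X' (k' \<circ> \<tau> \<circ> k)"
      by (rule continuous_map_compose[OF ck(1) continuous_map_compose[OF continuous_\<tau> ck(2)]])
    show "continuous_map X' euclidean (b \<circ> k)"
      by (rule continuous_map_compose[OF ck(1) continuous_b])
    fix x assume x: "x \<in> topspace X'"
    show "(k' \<circ> \<tau> \<circ> k) ((k' \<circ> \<tau> \<circ> k) x) = x"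
      using x by (simp add: kk k_in \<tau>_in \<tau>_\<tau>)
    show "(b \<circ> k) ((k' \<circ> \<tau> \<circ> k) x) = - (b \<circ> k) x"
      using x by (simp add: kk k_in \<tau>_in b_\<tau>)
    show "(k' \<circ> \<tau> \<circ> k) x = x" if "(b \<circ> k) x = 0"
      using x that b_eq_0[OF k_in[OF x]] by (simp add: kk)
    show "\<exists>d. pathin X' d \<and> d 0 = x \<and> (b \<circ> k) (d 1) = 0"
    proof -
      obtain d where d: "pathin X d" "d 0 = k x" "b (d 1) = 0" using paths[OF k_in[OF x]] by blast
      have "d 1 \<in> topspace X" using d(1) by (auto simp: pathin_def continuous_map_def)
      then show ?thesis
        using d x kk by (intro exI[of _ "k' \<circ> d"]) (simp add: pathin_compose[OF d(1) ck(2)])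
    qed
    show "\<exists>V h. x \<in> V \<and> reflected_chart X' (k' \<circ> \<tau> \<circ> k) V h" if z: "(b \<circ> k) x = 0"
    proof -
      have "b (k x) = 0" using z by simp
      then obtain V h where V: "k x \<in> V" "reflected_chart X \<tau> V h"
        using charts[OF k_in[OF x]] by blast
      then have op: "openin X V" and oph: "open (h ` V)"
        and hom: "homeomorphic_map (subtopology X V) (top_of_set (h ` V)) h"
        and inv: "\<And>v. v \<in> V \<Longrightarrow> \<tau> v \<in> V" and h\<tau>: "\<And>v. v \<in> V \<Longrightarrow> h (\<tau> v) = cnj (h v)"
        by (auto simp: reflected_chart_def)
      have sub: "V \<subseteq> topspace X" using op by (rule openin_subset)
      define V' where "V' = {x \<in> topspace X'. k x \<in> V}"
      have kV': "k ` V' = V"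
      proof
        show "k ` V' \<subseteq> V" by (auto simp: V'_def)
        show "V \<subseteq> k ` V'"
        proof
          fix v assume v: "v \<in> V"
          then have "k' v \<in> V'" "v = k (k' v)" using sub kk k'_in by (auto simp: V'_def)
          then show "v \<in> k ` V'" by blast
        qed
      qed
      have eq: "(h \<circ> k) ` V' = h ` V" by (simp only: image_comp[symmetric] kV')
      have "homeomorphic_map (subtopology X' V') (subtopology X V) k"
        using hk kV' sub by (intro homeomorphic_map_subtopologies_alt) (auto simp: V'_def)
      then have "homeomorphic_map (subtopology X' V') (top_of_set (h ` V)) (h \<circ> k)"
        using hom by (rule homeomorphic_map_compose)
      moreover have "openin X' V'"
        unfolding V'_def using ck(1) op by (rule openin_continuous_map_preimage)
      moreover have inV: "k (k' (\<tau> y)) = \<tau> y" "k' (\<tau> y) \<in> topspace X'" if "y \<in> V" for y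
        using inv[OF that] sub kk(2) k'_in by blast+
      have "(k' \<circ> \<tau> \<circ> k) ` V' \<subseteq> V'"
        using inv inV by (auto simp: V'_def)
      moreover have "(h \<circ> k) ((k' \<circ> \<tau> \<circ> k) v) = cnj ((h \<circ> k) v)" if "v \<in> V'" for v
        using that h\<tau> inV(1) by (simp add: V'_def)
      ultimately have "reflected_chart X' (k' \<circ> \<tau> \<circ> k) V' (h \<circ> k)"
        unfolding reflected_chart_def eq using oph by blast
      moreover have "x \<in> V'" using x V(1) by (simp add: V'_def)
      ultimately show ?thesis by blast
    qed
  qed
qed

locale folded_product = reflected_surface X \<tau> b
  for X :: "'a topology" and \<tau> b +
  fixes Y :: "'y topology" and f :: "'a \<times> complex \<Rightarrow> 'y"
  assumes quotient: "quotient_map (prod_topology X circle) Y f"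
    and fibre: "q \<in> topspace (prod_topology X circle) \<Longrightarrow> q' \<in> topspace (prod_topology X circle) \<Longrightarrow>
      f q = f q' \<longleftrightarrow> q' = q \<or> q' = (\<tau> (fst q), cnj (snd q))"
begin

lemma \<tau>_in: "x \<in> topspace X \<Longrightarrow> \<tau> x \<in> topspace X"
  using continuous_\<tau> by (auto simp: continuous_map_def)

text \<open>Both \<open>b\<close> and the imaginary part on the circle are odd. Combined into one
  complex number they vanish together only at points fixed by both reflections.\<close>

sublocale involution_quotient "prod_topology X circle" Y f "\<lambda>q. (\<tau> (fst q), cnj (snd q))"
  "\<lambda>q. Complex (b (fst q)) (Im (snd q))"
proof
  have "continuous_map circle circle cnj" by (auto intro: continuous_intros)
  then show "continuous_map (prod_topology X circle) (prod_topology X circle) (\<lambda>q. (\<tau> (fst q), cnj (snd q)))"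
    by (intro continuous_map_pairedI continuous_map_compose[OF continuous_map_fst continuous_\<tau>, unfolded comp_def]
        continuous_map_compose[OF continuous_map_snd, unfolded comp_def])
  have 1: "continuous_map (prod_topology X circle) euclidean (\<lambda>q. b (fst q))"
    by (rule continuous_map_compose[OF continuous_map_fst continuous_b, unfolded comp_def])
  have "continuous_map circle euclidean Im" by (simp add: continuous_on_Im)
  from continuous_map_compose[OF continuous_map_snd this]
  have 2: "continuous_map (prod_topology X circle) euclidean (\<lambda>q. Im (snd q))" by (simp add: comp_def)
  have "continuous_map (prod_topology X circle) (prod_topology euclidean euclidean) (\<lambda>q. (b (fst q), Im (snd q)))"
    by (rule continuous_map_pairedI[OF 1 2])
  moreover have "continuous_on UNIV (\<lambda>p. Complex (fst p) (snd p))"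
    unfolding Complex_eq by (intro continuous_intros)
  ultimately show "continuous_map (prod_topology X circle) euclidean (\<lambda>q. Complex (b (fst q)) (Im (snd q)))"
    using continuous_map_compose[of _ "prod_topology euclidean euclidean" "\<lambda>q. (b (fst q), Im (snd q))" euclidean "\<lambda>p. Complex (fst p) (snd p)"]
    by (simp add: comp_def euclidean_product_topology)
  fix q assume q: "q \<in> topspace (prod_topology X circle)"
  then have "fst q \<in> topspace X" by auto
  then show "(\<tau> (fst (\<tau> (fst q), cnj (snd q))), cnj (snd (\<tau> (fst q), cnj (snd q)))) = q"
    "Complex (b (fst (\<tau> (fst q), cnj (snd q)))) (Im (snd (\<tau> (fst q), cnj (snd q)))) = - Complex (b (fst q)) (Im (snd q))"
    by (simp_all add: \<tau>_\<tau> b_\<tau> complex_eq_iff)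
  show "(\<tau> (fst q), cnj (snd q)) = q" if "Complex (b (fst q)) (Im (snd q)) = 0"
    using that b_eq_0[OF \<open>fst q \<in> topspace X\<close>] by (auto simp: complex_eq_iff prod_eq_iff)
qed (use quotient fibre in blast)+

text \<open>At a fixed point \<open>w\<close> is 1 or -1. The odd coordinates, the imaginary part of
  the surface chart and \<open>Im w\<close>, form \<open>z\<close>; the even coordinate, the real
  part of the surface chart, is \<open>t\<close>.\<close>

lemma linearising_chart_exists:
  assumes q: "q \<in> topspace (prod_topology X circle)" and 0: "Complex (b (fst q)) (Im (snd q)) = 0"
  shows "\<exists>U \<phi>. q \<in> U \<and> linearising_chart U \<phi>"
proof -
  obtain x w where xw: "q = (x, w)" "x \<in> topspace X" "norm w = 1" using q by auto
  then have bx: "b x = 0" and Im_w: "Im w = 0" using 0 by (auto simp: complex_eq_iff)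
  then have "\<bar>Re w\<bar> = 1" using xw(3) by (simp add: cmod_eq_Re)
  define \<epsilon> where "\<epsilon> = Re w"
  have \<epsilon>: "\<epsilon> = 1 \<or> \<epsilon> = -1" using \<open>\<bar>Re w\<bar> = 1\<close> by (auto simp: \<epsilon>_def abs_if split: if_splits)
  obtain V h where V: "x \<in> V" "reflected_chart X \<tau> V h" using charts[OF xw(2) bx] by blast
  then have opV: "openin X V" and opW: "open (h ` V)"
    and hom: "homeomorphic_map (subtopology X V) (top_of_set (h ` V)) h"
    and inv: "\<And>v. v \<in> V \<Longrightarrow> \<tau> v \<in> V" and h\<tau>: "\<And>v. v \<in> V \<Longrightarrow> h (\<tau> v) = cnj (h v)"
    by (auto simp: reflected_chart_def)
  have subV: "V \<subseteq> topspace X" using opV by (rule openin_subset)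
  obtain g where g: "homeomorphic_maps (subtopology X V) (top_of_set (h ` V)) h g"
    using hom homeomorphic_map_maps by blast
  then have ch: "continuous_map (subtopology X V) (top_of_set (h ` V)) h"
    and cg: "continuous_map (top_of_set (h ` V)) (subtopology X V) g"
    and gh: "\<And>v. v \<in> V \<Longrightarrow> g (h v) = v" and hg: "\<And>y. y \<in> h ` V \<Longrightarrow> h (g y) = y"
    using subV by (auto simp: homeomorphic_maps_def)
  have g_in: "g y \<in> V" if "y \<in> h ` V" for y using that gh by auto
  \<comment> \<open>The half circle around \<open>w\<close>, on which \<open>Im\<close> is a
    coordinate; the real part is recovered as \<open>\<epsilon>\<close> times a square root, which
    gives the inverse \<open>\<Gamma>\<close> below.\<close>
  define D where "D = {w \<in> sphere 0 1. 0 < \<epsilon> * Re w}"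
  define U where "U = V \<times> D"
  define \<phi> where "\<phi> = (\<lambda>q. (Complex (Im (h (fst q))) (Im (snd q)), Re (h (fst q))))"
  define \<Omega> where "\<Omega> = {p. Complex (snd p) (Re (fst p)) \<in> h ` V \<and> \<bar>Im (fst p)\<bar> < 1}"
  define \<Gamma> where "\<Gamma> = (\<lambda>p. (g (Complex (snd p) (Re (fst p))), Complex (\<epsilon> * sqrt (1 - (Im (fst p))\<^sup>2)) (Im (fst p))))"
  have cC: "continuous_on UNIV (\<lambda>p::complex \<times> real. Complex (snd p) (Re (fst p)))"
    unfolding Complex_eq by (intro continuous_intros)
  have "open D'" if "D' = (\<lambda>p::complex \<times> real. Complex (snd p) (Re (fst p))) -` (h ` V) \<inter> {p. \<bar>Im (fst p)\<bar> < 1}" for D'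
    unfolding that using opW cC
    by (intro open_Int open_vimage open_Collect_less continuous_intros) auto
  moreover have "\<Omega> = (\<lambda>p::complex \<times> real. Complex (snd p) (Re (fst p))) -` (h ` V) \<inter> {p. \<bar>Im (fst p)\<bar> < 1}"
    by (auto simp: \<Omega>_def)
  ultimately have op\<Omega>: "open \<Omega>" by blast
  have Re_D: "Re w = \<epsilon> * sqrt (1 - (Im w)\<^sup>2)" "\<bar>Im w\<bar> < 1" if w: "w \<in> D" for w
  proof -
    have sq: "(Re w)\<^sup>2 + (Im w)\<^sup>2 = 1" using w circle_eq[of w] by (simp add: D_def)
    have pos: "0 < \<epsilon> * Re w" using w by (simp add: D_def)
    have "1 - (Im w)\<^sup>2 = (\<epsilon> * Re w)\<^sup>2" using sq \<epsilon> by auto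
    then have "sqrt (1 - (Im w)\<^sup>2) = \<epsilon> * Re w" using pos by (simp add: real_sqrt_unique)
    then show "Re w = \<epsilon> * sqrt (1 - (Im w)\<^sup>2)" using \<epsilon> by auto
    have "0 < (Re w)\<^sup>2" using pos by auto
    then have "(Im w)\<^sup>2 < 1" using sq by linarith
    then show "\<bar>Im w\<bar> < 1" by (simp add: abs_square_less_1)
  qed
  have in_D: "Complex (\<epsilon> * sqrt (1 - t\<^sup>2)) t \<in> D" if "\<bar>t\<bar> < 1" for t
  proof -
    have "t\<^sup>2 < 1" using that by (simp add: abs_square_less_1)
    then show ?thesis using \<epsilon> by (auto simp: D_def cmod_def power_mult_distrib)
  qed
  have \<phi>_in: "\<phi> u \<in> \<Omega>" and \<Gamma>\<phi>: "\<Gamma> (\<phi> u) = u" if u: "u \<in> U" for u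
  proof -
    have "fst u \<in> V" "snd u \<in> D" using u by (auto simp: U_def)
    then show "\<phi> u \<in> \<Omega>" using Re_D(2) by (simp add: \<phi>_def \<Omega>_def)
    have "snd u = Complex (\<epsilon> * sqrt (1 - (Im (snd u))\<^sup>2)) (Im (snd u))"
      using Re_D(1)[OF \<open>snd u \<in> D\<close>] by (simp add: complex_eq_iff)
    then show "\<Gamma> (\<phi> u) = u"
      using gh[OF \<open>fst u \<in> V\<close>] by (simp add: \<phi>_def \<Gamma>_def prod_eq_iff)
  qed
  have \<Gamma>_in: "\<Gamma> p \<in> U" and \<phi>\<Gamma>: "\<phi> (\<Gamma> p) = p" if p: "p \<in> \<Omega>" for p
  proof -
    have p': "Complex (snd p) (Re (fst p)) \<in> h ` V" "\<bar>Im (fst p)\<bar> < 1" using p by (auto simp: \<Omega>_def)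
    then show "\<Gamma> p \<in> U" using g_in in_D by (simp add: \<Gamma>_def U_def)
    show "\<phi> (\<Gamma> p) = p" using hg[OF p'(1)] by (simp add: \<phi>_def \<Gamma>_def prod_eq_iff)
  qed
  have \<phi>U: "\<phi> ` U = \<Omega>" using \<phi>_in \<Gamma>_in \<phi>\<Gamma> by (metis image_eqI image_subset_iff subsetI subset_antisym)
  have opD: "openin circle D"
  proof -
    have "open {w. 0 < \<epsilon> * Re w}" by (intro open_Collect_less continuous_intros)
    moreover have "D = sphere 0 1 \<inter> {w. 0 < \<epsilon> * Re w}" by (auto simp: D_def)
    ultimately show ?thesis by (simp add: openin_open_Int)
  qed
  have opU: "openin (prod_topology X circle) U" unfolding U_def using opV opD by (simp add: openin_prod_Times_iff)
  have sub: "subtopology (prod_topology X circle) U = prod_topology (subtopology X V) (top_of_set D)"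
  proof -
    have "sphere 0 1 \<inter> D = D" by (auto simp: D_def)
    then show ?thesis unfolding U_def by (simp add: subtopology_Times subtopology_subtopology)
  qed
  have "homeomorphic_maps (subtopology (prod_topology X circle) U) (top_of_set \<Omega>) \<phi> \<Gamma>"
    unfolding homeomorphic_maps_def
  proof (intro conjI ballI)
    show "continuous_map (subtopology (prod_topology X circle) U) (top_of_set \<Omega>) \<phi>"
      unfolding continuous_map_in_subtopology
    proof
      have 1: "continuous_map (prod_topology (subtopology X V) (top_of_set D)) euclidean (\<lambda>q. h (fst q))"
        by (rule continuous_map_compose[OF continuous_map_fst continuous_map_into_fulltopology[OF ch], unfolded comp_def])
      have 2: "continuous_map (prod_topology (subtopology X V) (top_of_set D)) euclidean snd"
        by (rule continuous_map_into_fulltopology[OF continuous_map_snd])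
      have "continuous_map (prod_topology (subtopology X V) (top_of_set D)) (prod_topology euclidean euclidean) (\<lambda>q. (h (fst q), snd q))"
        by (rule continuous_map_pairedI[OF 1 2])
      moreover have "continuous_on UNIV (\<lambda>p::complex \<times> complex. (Complex (Im (fst p)) (Im (snd p)), Re (fst p)))"
        unfolding Complex_eq by (intro continuous_intros)
      ultimately show "continuous_map (subtopology (prod_topology X circle) U) euclidean \<phi>"
        using continuous_map_compose[of "prod_topology (subtopology X V) (top_of_set D)" "prod_topology euclidean euclidean"
            "\<lambda>q. (h (fst q), snd q)" euclidean "\<lambda>p. (Complex (Im (fst p)) (Im (snd p)), Re (fst p))"]
        unfolding sub \<phi>_def by (simp add: comp_def euclidean_product_topology)
      show "\<phi> \<in> topspace (subtopology (prod_topology X circle) U) \<rightarrow> \<Omega>" using \<phi>_in by auto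
    qed
    show "continuous_map (top_of_set \<Omega>) (subtopology (prod_topology X circle) U) \<Gamma>"
      unfolding sub \<Gamma>_def
    proof (rule continuous_map_pairedI)
      have "continuous_map (top_of_set \<Omega>) (top_of_set (h ` V)) (\<lambda>p. Complex (snd p) (Re (fst p)))"
        using continuous_on_subset[OF cC] by (auto simp: continuous_map_in_subtopology \<Omega>_def)
      from continuous_map_compose[OF this cg]
      show "continuous_map (top_of_set \<Omega>) (subtopology X V) (\<lambda>p. g (Complex (snd p) (Re (fst p))))"
        by (simp add: comp_def)
      have "continuous_on \<Omega> (\<lambda>p. Complex (\<epsilon> * sqrt (1 - (Im (fst p))\<^sup>2)) (Im (fst p)))"
        unfolding Complex_eq by (intro continuous_intros)
      then show "continuous_map (top_of_set \<Omega>) (top_of_set D) (\<lambda>p. Complex (\<epsilon> * sqrt (1 - (Im (fst p))\<^sup>2)) (Im (fst p)))"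
        using in_D by (auto simp: \<Omega>_def)
    qed
  qed (use \<Gamma>\<phi> \<phi>\<Gamma> in auto)
  then have "homeomorphic_map (subtopology (prod_topology X circle) U) (top_of_set (\<phi> ` U)) \<phi>"
    unfolding \<phi>U using homeomorphic_map_maps by blast
  then have "local_coordinates (prod_topology X circle) U \<phi>"
    unfolding local_coordinates_def \<phi>U using opU op\<Omega> by blast
  moreover have "(\<lambda>q. (\<tau> (fst q), cnj (snd q))) ` U \<subseteq> U"
    using inv by (auto simp: U_def D_def)
  moreover have "\<phi> (\<tau> (fst u), cnj (snd u)) = (- fst (\<phi> u), snd (\<phi> u))" if "u \<in> U" for u
    using that h\<tau> by (auto simp: U_def \<phi>_def complex_eq_iff)
  ultimately have "linearising_chart U \<phi>" by (simp add: linearising_chart_def)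
  moreover have "q \<in> U" using xw V(1) \<epsilon> by (auto simp: U_def D_def \<epsilon>_def)
  ultimately show ?thesis by blast
qed

text \<open>While \<open>d\<close> runs to a fixed point of the surface, \<open>w\<close> is rotated
  to 1.\<close>

lemma path_exists:
  assumes q: "q \<in> topspace (prod_topology X circle)"
  shows "\<exists>d. pathin (prod_topology X circle) d \<and> d 0 = q \<and> Complex (b (fst (d 1))) (Im (snd (d 1))) = 0"
proof -
  obtain x w where xw: "q = (x, w)" "x \<in> topspace X" "norm w = 1" using q by auto
  obtain d where d: "pathin X d" "d 0 = x" "b (d 1) = 0" using paths[OF xw(2)] by blast
  have "w \<noteq> 0" using xw(3) by auto
  then have w: "cis (Arg w) = w" using cis_Arg[of w] xw(3) by (simp add: sgn_eq)
  have "continuous_map (top_of_set {0..1}) circle (\<lambda>t. cis ((1 - t) * Arg w))"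
    by (auto intro!: continuous_intros)
  then have "pathin (prod_topology X circle) (\<lambda>t. (d t, cis ((1 - t) * Arg w)))"
    using d(1) unfolding pathin_def by (intro continuous_map_pairedI)
  then show ?thesis
    using d xw w by (intro exI[of _ "\<lambda>t. (d t, cis ((1 - t) * Arg w))"]) (simp add: complex_eq_iff)
qed

theorem branched_cover:
  "branched_double_covering (prod_topology X circle) Y f" "pi1_surjective (prod_topology X circle) Y f"
proof -
  have "compact_space (prod_topology X circle)"
    using compact by (simp add: compact_space_prod_topology compact_space_subtopology)
  then show "branched_double_covering (prod_topology X circle) Y f"
    by (rule branched_double_covering_quotient) (use linearising_chart_exists in auto)
  show "pi1_surjective (prod_topology X circle) Y f"
    by (rule pi1_surjective_quotient) (use path_exists in auto)
qed

end

section \<open>Connected sums as attached copies\<close>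

text \<open>The boundary of a ball must avoid all the removed open balls: its own by injectivity,
  the others because the closed balls are disjoint.\<close>

lemma attached_copies_connected_sum:
  fixes e :: "'v::euclidean_space \<Rightarrow> 'm::topological_space"
  assumes b: "norm b = 1" and e: "inj_on e (cball 0 2)" "\<And>x. e x \<in> M"
  shows "attached_copies (sphere 0 1 - (\<Union>i<n. sphere_ball b i ` ball 0 1)) (M - e ` ball 0 1)
     (e ` sphere 0 1) n (\<lambda>i y. sphere_ball b i (inv_into (sphere 0 1) e y))"
proof
  have e1: "e x = e y \<longleftrightarrow> x = y" if "norm x \<le> 1" "norm y \<le> 1" for x y
    using that by (intro inj_on_eq_iff[OF e(1)]) auto
  show "e ` sphere 0 1 \<subseteq> M - e ` ball 0 1"
    using e(2) e1 by force
  fix i y assume "i < n" "y \<in> e ` sphere 0 1"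
  define x where "x = inv_into (sphere 0 1) e y"
  have x: "norm x = 1" using inv_into_into[OF \<open>y \<in> e ` sphere 0 1\<close>] by (simp add: x_def)
  have "sphere_ball b i x \<notin> sphere_ball b j ` ball 0 1" for j
  proof
    assume "sphere_ball b i x \<in> sphere_ball b j ` ball 0 1"
    then obtain z where z: "norm z < 1" "sphere_ball b i x = sphere_ball b j z" by auto
    moreover have "sphere_ball b i x \<in> sphere_ball b i ` cball 0 1" using x by (intro imageI) simp
    moreover have "sphere_ball b j z \<in> sphere_ball b j ` cball 0 1" using z(1) by (intro imageI) simp
    ultimately have "sphere_ball b i x \<in> sphere_ball b i ` cball 0 1 \<inter> sphere_ball b j ` cball 0 1" by simp
    then have "i = j" using disjoint_sphere_balls[OF b, of i j] by blast
    then have "x = z" using z(2) injD[OF inj_sphere_ball] by blast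
    then show False using x z(1) by simp
  qed
  then show "sphere_ball b i (inv_into (sphere 0 1) e y) \<in> sphere 0 1 - (\<Union>i<n. sphere_ball b i ` ball 0 1)"
    unfolding x_def[symmetric] by (simp add: norm_sphere_ball)
qed

lemma connected_sum_copies_eq:
  fixes e :: "'v::euclidean_space \<Rightarrow> 'm::topological_space"
  assumes "norm b = 1" "inj_on e (cball 0 2)" "\<And>x. e x \<in> M"
  shows "connected_sum_copies b (top_of_set M) e n =
    attached_copies.glued (sphere 0 1 - (\<Union>i<n. sphere_ball b i ` ball 0 1)) (M - e ` ball 0 1)
     (e ` sphere 0 1) n (\<lambda>i y. sphere_ball b i (inv_into (sphere 0 1) e y))"
proof -
  have "M \<inter> (M - e ` ball 0 1) = M - e ` ball 0 1" by blast
  then show ?thesis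
    unfolding attached_copies.glued_def[OF attached_copies_connected_sum[OF assms]] connected_sum_copies_def
    by (simp add: subtopology_subtopology)
qed

section \<open>The reflection of the surface of genus n\<close>

abbreviation torus :: "(complex \<times> complex) set" where
  "torus \<equiv> sphere 0 1 \<times> sphere 0 1"

definition punctured_sphere :: "nat \<Rightarrow> (complex \<times> real) set" where
  "punctured_sphere n = sphere 0 1 - (\<Union>i<n. sphere_ball 1 i ` ball 0 1)"

definition seam :: "nat \<Rightarrow> complex \<times> complex \<Rightarrow> complex \<times> real" where
  "seam i y = sphere_ball 1 i (inv_into (sphere 0 1) torus_chart y)"

lemma torus_chart_in: "torus_chart x \<in> torus"
  by (simp add: torus_chart_def)

interpretation surface: attached_copies "punctured_sphere n" "torus - torus_chart ` ball 0 1"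
    "torus_chart ` sphere 0 1" n seam for n
  using attached_copies_connected_sum[of 1 torus_chart torus n, OF _ inj_on_torus_chart torus_chart_in]
  unfolding seam_def punctured_sphere_def by simp

lemma torus_chart_eq_iff:
  "norm x \<le> 2 \<Longrightarrow> norm y \<le> 2 \<Longrightarrow> torus_chart x = torus_chart y \<longleftrightarrow> x = y"
  by (intro inj_on_eq_iff[OF inj_on_torus_chart]) auto

lemma seam_torus_chart: "norm x = 1 \<Longrightarrow> seam i (torus_chart x) = sphere_ball 1 i x"
proof -
  assume x: "norm x = 1"
  have "inj_on torus_chart (sphere 0 1)" by (rule inj_on_subset[OF inj_on_torus_chart]) auto
  then have "inv_into (sphere 0 1) torus_chart (torus_chart x) = x" by (rule inv_into_f_f) (simp add: x)
  then show ?thesis by (simp add: seam_def)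
qed

lemma surface_copy_seam: "norm x = 1 \<Longrightarrow> surface.copy i (torus_chart x) = Inl (sphere_ball 1 i x)"
  by (auto simp: surface.copy_def seam_torus_chart)

lemma surface_copy_off_seam: "m \<notin> torus_chart ` sphere 0 1 \<Longrightarrow> surface.copy i m = Inr (i, m)"
  by (simp add: surface.copy_def)

definition surface_reflection :: "(complex \<times> real) + nat \<times> (complex \<times> complex) \<Rightarrow> (complex \<times> real) + nat \<times> (complex \<times> complex)" where
  "surface_reflection = sum_reflection reflect_sphere reflect_torus"

lemma surface_reflection_Inl [simp]: "surface_reflection (Inl x) = Inl (reflect_sphere x)"
  and surface_reflection_Inr [simp]: "surface_reflection (Inr (i, m)) = Inr (i, reflect_torus m)"
  by (simp_all add: surface_reflection_def sum_reflection_def)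

lemma reflect_sphere_ball: "reflect_sphere (sphere_ball 1 i x) = sphere_ball 1 i (cnj x)"
  by (simp add: sphere_ball_def reflect_inverse_stereographic)

lemma reflect_torus_image:
  assumes "\<And>x. P (cnj x) \<longleftrightarrow> P x"
  shows "reflect_torus m \<in> torus_chart ` {x. P x} \<longleftrightarrow> m \<in> torus_chart ` {x. P x}"
proof -
  have *: "reflect_torus m \<in> torus_chart ` {x. P x}" if "m \<in> torus_chart ` {x. P x}" for m
    using that assms reflect_torus_chart by auto
  show ?thesis using *[of m] *[of "reflect_torus m"] by (auto simp: reflect_torus_def)
qed

lemma reflect_torus_sphere: "reflect_torus m \<in> torus_chart ` sphere 0 1 \<longleftrightarrow> m \<in> torus_chart ` sphere 0 1"
  using reflect_torus_image[of "\<lambda>x. norm x = 1"] by (simp add: sphere_def)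

lemma reflect_torus_ball: "reflect_torus m \<in> torus_chart ` ball 0 1 \<longleftrightarrow> m \<in> torus_chart ` ball 0 1"
  using reflect_torus_image[of "\<lambda>x. norm x < 1"] by (simp add: ball_def)

lemma reflect_torus_cball: "reflect_torus m \<in> torus_chart ` cball 0 1 \<longleftrightarrow> m \<in> torus_chart ` cball 0 1"
  using reflect_torus_image[of "\<lambda>x. norm x \<le> 1"] by (simp add: cball_def)

lemma reflect_torus_in: "reflect_torus m \<in> torus \<longleftrightarrow> m \<in> torus"
  by (cases m) (simp add: reflect_torus_def)

lemma surface_reflection_copy: "surface_reflection (surface.copy i m) = surface.copy i (reflect_torus m)"
proof (cases "m \<in> torus_chart ` sphere 0 1")
  case True
  then obtain x where "norm x = 1" "m = torus_chart x" by auto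
  then show ?thesis by (simp add: surface_copy_seam reflect_torus_chart reflect_sphere_ball)
next
  case False
  then show ?thesis using reflect_torus_sphere[of m] by (simp add: surface_copy_off_seam)
qed

lemma reflect_punctured_sphere: "x \<in> punctured_sphere n \<Longrightarrow> reflect_sphere x \<in> punctured_sphere n"
proof -
  assume x: "x \<in> punctured_sphere n"
  have "reflect_sphere x \<notin> sphere_ball 1 i ` ball 0 1" if "i < n" for i
  proof
    assume "reflect_sphere x \<in> sphere_ball 1 i ` ball 0 1"
    then obtain z where z: "norm z < 1" "reflect_sphere x = sphere_ball 1 i z" by auto
    then have "x = reflect_sphere (sphere_ball 1 i z)" by (metis complex_cnj_cnj prod.collapse reflect_sphere_def fst_conv snd_conv)
    then have "x = sphere_ball 1 i (cnj z)" by (simp add: reflect_sphere_ball)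
    then have "x \<in> sphere_ball 1 i ` ball 0 1" using z(1) by simp
    then show False using x that by (auto simp: punctured_sphere_def)
  qed
  then show ?thesis using x by (simp add: punctured_sphere_def norm_reflect_sphere)
qed

lemma continuous_surface_reflection:
  "continuous_map (surface.glued n) (surface.glued n) surface_reflection"
proof (rule surface.continuous_map_from_glued)
  have "continuous_map (top_of_set (punctured_sphere n)) (top_of_set (punctured_sphere n)) reflect_sphere"
    using reflect_punctured_sphere by (auto simp: reflect_sphere_def intro!: continuous_intros)
  from continuous_map_compose[OF this surface.continuous_map_Inl]
  show "continuous_map (top_of_set (punctured_sphere n)) (surface.glued n) (\<lambda>x. surface_reflection (Inl x))"
    by (simp add: comp_def)
  fix i assume i: "i < n"
  have "continuous_map (top_of_set (torus - torus_chart ` ball 0 1)) (top_of_set (torus - torus_chart ` ball 0 1)) reflect_torus"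
    using reflect_torus_ball reflect_torus_in
    by (auto simp: reflect_torus_def[abs_def] intro!: continuous_intros)
  from continuous_map_compose[OF this surface.continuous_map_copy[OF i]]
  show "continuous_map (top_of_set (torus - torus_chart ` ball 0 1)) (surface.glued n) (\<lambda>m. surface_reflection (surface.copy i m))"
    by (simp add: comp_def surface_reflection_copy)
qed

text \<open>An odd function whose zeros are the fixed points. On the \<open>i\<close>-th torus it continues the values
  \<open>2 Im x / (\<bar>4i + x\<bar>\<^sup>2 + 1)\<close> that the imaginary part takes on the seam.\<close>

definition torus_height :: "nat \<Rightarrow> complex \<times> complex \<Rightarrow> real" where
  "torus_height i m = arcsin (Im (snd m)) / (8 * (real i)\<^sup>2 + 4 * real i * arcsin (Im (fst m)) + 1)"

definition surface_height :: "(complex \<times> real) + nat \<times> (complex \<times> complex) \<Rightarrow> real" where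
  "surface_height z = (case z of Inl x \<Rightarrow> Im (fst x) | Inr (i, m) \<Rightarrow> torus_height i m)"

text \<open>The arcsine is at least \<open>- pi/2 > -2\<close>, so the expression exceeds or equals
  \<open>8 i^2 - 8 i + 1\<close>, and \<open>i \<le> i^2\<close> for natural numbers.\<close>

lemma torus_height_denominator:
  assumes "norm u = 1"
  shows "0 < 8 * (real i)\<^sup>2 + 4 * real i * arcsin (Im u) + 1"
proof -
  have "\<bar>Im u\<bar> \<le> 1" using abs_Im_le_cmod[of u] assms by simp
  then have "- (pi / 2) \<le> arcsin (Im u)" using arcsin_bounded[of "Im u"] by (simp add: abs_le_iff)
  then have "- 2 \<le> arcsin (Im u)" using pi_less_4 by linarith
  then have "real i * (- 2) \<le> real i * arcsin (Im u)" by (intro mult_left_mono) auto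
  moreover have "real i \<le> (real i)\<^sup>2" by (cases i) (simp_all add: power2_eq_square)
  ultimately show ?thesis by linarith
qed

text \<open>For \<open>norm x = 1\<close> the square in \<open>\<bar>4i + x\<bar>^2 + 1\<close>
  expands to twice the denominator, which involves only \<open>Re x\<close>. The arcsine recovers
  both coordinates because they are at most \<open>1 < pi/2\<close> in absolute value.\<close>

lemma torus_height_seam:
  assumes x: "norm x = 1"
  shows "torus_height i (torus_chart x) = Im (fst (sphere_ball 1 i x))"
proof -
  have "\<bar>Re x\<bar> \<le> 1" "\<bar>Im x\<bar> \<le> 1" using abs_Re_le_cmod[of x] abs_Im_le_cmod[of x] x by simp_all
  then have as: "arcsin (sin (Re x)) = Re x" "arcsin (sin (Im x)) = Im x"
    using pi_gt3 by (auto intro!: arcsin_sin)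
  define D where "D = 8 * (real i)\<^sup>2 + 4 * real i * Re x + 1"
  have "(norm (complex_of_real (4 * real i) + x))\<^sup>2 = (4 * real i + Re x)\<^sup>2 + (Im x)\<^sup>2"
    by (simp add: cmod_power2)
  also have "\<dots> = 16 * (real i)\<^sup>2 + 8 * real i * Re x + ((Re x)\<^sup>2 + (Im x)\<^sup>2)"
    by (simp add: power2_eq_square algebra_simps)
  finally have "(norm (complex_of_real (4 * real i) + x))\<^sup>2 + 1 = 2 * D"
    using circle_eq[OF x] by (simp add: D_def)
  then have "Im (fst (sphere_ball 1 i x)) = 2 / (2 * D) * Im x"
    by (simp add: sphere_ball_def inverse_stereographic_def scaleR_conv_of_real)
  also have "\<dots> = Im x / D" by simp
  also have "\<dots> = torus_height i (torus_chart x)" by (simp add: torus_height_def torus_chart_def as D_def)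
  finally show ?thesis ..
qed

lemma surface_height_copy: "surface_height (surface.copy i m) = torus_height i m"
proof (cases "m \<in> torus_chart ` sphere 0 1")
  case True
  then obtain x where "norm x = 1" "m = torus_chart x" by auto
  then show ?thesis by (simp add: surface_copy_seam surface_height_def torus_height_seam)
next
  case False
  then show ?thesis by (simp add: surface_copy_off_seam surface_height_def)
qed

lemma continuous_surface_height: "continuous_map (surface.glued n) euclidean surface_height"
proof (rule surface.continuous_map_from_glued)
  show "continuous_map (top_of_set (punctured_sphere n)) euclidean (\<lambda>x. surface_height (Inl x))"
    by (simp add: surface_height_def) (intro continuous_intros)
  have Im: "- 1 \<le> Im u \<and> Im u \<le> 1" if "norm u = 1" for u
    using abs_Im_le_cmod[of u] that by (simp add: abs_le_iff)
  have "continuous_on (torus - torus_chart ` ball 0 1) (torus_height i)"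
    (is "continuous_on ?T _") for i
  proof -
    have arcs: "continuous_on ?T (\<lambda>m. arcsin (Im (fst m)))" "continuous_on ?T (\<lambda>m. arcsin (Im (snd m)))"
      by (intro continuous_on_arcsin continuous_intros; use Im in auto)+
    have nz: "8 * (real i)\<^sup>2 + 4 * real i * arcsin (Im (fst m)) + 1 \<noteq> 0" if "m \<in> ?T" for m
      using torus_height_denominator[of "fst m" i] that by auto
    have "continuous_on ?T (\<lambda>m. 8 * (real i)\<^sup>2 + 4 * real i * arcsin (Im (fst m)) + 1)"
      by (intro continuous_on_add continuous_on_mult continuous_on_const arcs(1))
    then show ?thesis
      unfolding torus_height_def by (rule continuous_on_divide[OF arcs(2)]) (intro ballI nz)
  qed
  then show "continuous_map (top_of_set (torus - torus_chart ` ball 0 1)) euclidean (\<lambda>m. surface_height (surface.copy i m))" for i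
    by (simp add: surface_height_copy)
qed

lemma surface_height_reflection:
  assumes "z \<in> topspace (surface.glued n)"
  shows "surface_height (surface_reflection z) = - surface_height z"
  using assms
proof (cases z rule: surface.topspace_cases)
  case (2 i m)
  have "\<bar>Im (snd m)\<bar> \<le> 1" using 2(2) abs_Im_le_cmod[of "snd m"] by auto
  then show ?thesis
    using 2 by (simp add: surface_height_def torus_height_def reflect_torus_def arcsin_minus abs_le_iff)
qed (simp add: surface_height_def reflect_sphere_def)

lemma surface_height_eq_0:
  assumes "z \<in> topspace (surface.glued n)" "surface_height z = 0"
  shows "surface_reflection z = z"
  using assms(1)
proof (cases z rule: surface.topspace_cases)
  case (1 x)
  then have "Im (fst x) = 0" using assms(2) by (simp add: surface_height_def)
  then show ?thesis using 1 by (simp add: reflect_sphere_def prod_eq_iff complex_eq_iff)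
next
  case (2 i m)
  have n: "norm (fst m) = 1" "norm (snd m) = 1" using 2(2) by auto
  have Im: "- 1 \<le> Im (snd m)" "Im (snd m) \<le> 1" using abs_Im_le_cmod[of "snd m"] n by (auto simp: abs_le_iff)
  have "torus_height i m = 0" using 2(4) assms(2) by (simp add: surface_height_def)
  then have "arcsin (Im (snd m)) = 0"
    using torus_height_denominator[OF n(1), of i] by (auto simp: torus_height_def)
  then have "Im (snd m) = 0" using sin_arcsin[OF Im] by simp
  then show ?thesis using 2(4) by (simp add: reflect_torus_def prod_eq_iff complex_eq_iff)
qed

section \<open>Paths to the fixed points\<close>

text \<open>Stereographic projection turns discs into caps, which are cut off by planes: multiplying
  \<open>norm (y - 4 i)^2 - 1 < 0\<close> by \<open>2 / (norm y^2 + 1)\<close> makes the condition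
  affine in \<open>x\<close>. \<open>sphere_path\<close> moves along segments for this
  reason.\<close>

lemma in_sphere_ball_iff:
  assumes x: "norm x = 1"
  shows "x \<in> sphere_ball (1::complex) i ` ball 0 1 \<longleftrightarrow>
    (1 + snd x) - 8 * real i * Re (fst x) + (16 * (real i)\<^sup>2 - 1) * (1 - snd x) < 0"
proof (cases "snd x = 1")
  case True
  have "fst x = 0" using x True by (cases x) (simp add: norm_Pair)
  moreover have "x \<notin> sphere_ball (1::complex) i ` ball 0 1"
  proof
    assume "x \<in> sphere_ball 1 i ` ball 0 1"
    then obtain z where "x = sphere_ball 1 i z" by blast
    then show False using True snd_inverse_stereographic_less[of "(4 * real i) *\<^sub>R 1 + z"] by (simp add: sphere_ball_def)
  qed
  ultimately show ?thesis using True by simp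
next
  case False
  define y where "y = stereographic x"
  have xy: "x = inverse_stereographic y" unfolding y_def using inverse_stereographic_stereographic[OF x False] by simp
  define r where "r = (norm y)\<^sup>2 + 1"
  have r: "0 < r" unfolding r_def by (smt (verit) zero_le_power2)
  have "x \<in> sphere_ball 1 i ` ball 0 1 \<longleftrightarrow> norm (y - of_real (4 * real i)) < 1"
  proof
    assume "x \<in> sphere_ball 1 i ` ball 0 1"
    then obtain z where z: "norm z < 1" "x = sphere_ball 1 i z" by auto
    then have "y = of_real (4 * real i) + z"
      using xy by (simp add: sphere_ball_def scaleR_conv_of_real inj_eq[OF inj_inverse_stereographic])
    then show "norm (y - of_real (4 * real i)) < 1" using z(1) by simp
  next
    assume n: "norm (y - of_real (4 * real i)) < 1"
    have "x = sphere_ball 1 i (y - of_real (4 * real i))"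
      by (simp add: xy sphere_ball_def scaleR_conv_of_real)
    then show "x \<in> sphere_ball 1 i ` ball 0 1" using n by (intro image_eqI) auto
  qed
  also have "\<dots> \<longleftrightarrow> (norm (y - of_real (4 * real i)))\<^sup>2 < 1" by (simp add: abs_square_less_1)
  also have "(norm (y - of_real (4 * real i)))\<^sup>2 = r - 1 - 8 * real i * Re y + 16 * (real i)\<^sup>2"
  proof -
    have "(norm (y - of_real (4 * real i)))\<^sup>2 = (Re y - 4 * real i)\<^sup>2 + (Im y)\<^sup>2"
      unfolding cmod_power2 by simp
    moreover have "r = (Re y)\<^sup>2 + (Im y)\<^sup>2 + 1" unfolding r_def cmod_power2 by simp
    ultimately show ?thesis by (simp add: power2_eq_square algebra_simps)
  qed
  finally have "x \<in> sphere_ball 1 i ` ball 0 1 \<longleftrightarrow> r - 1 - 8 * real i * Re y + 16 * (real i)\<^sup>2 < 1" .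
  moreover have pos: "2 / r * E < 0 \<longleftrightarrow> E < 0" for E :: real
    using r by (simp add: divide_less_0_iff)
  moreover have eq: "(1 + snd x) - 8 * real i * Re (fst x) + (16 * (real i)\<^sup>2 - 1) * (1 - snd x) =
      (2 / r) * (r - 1 - 8 * real i * Re y + 16 * (real i)\<^sup>2 - 1)"
  proof -
    have "snd x = (r - 2) / r" "Re (fst x) = 2 * Re y / r"
      by (simp_all add: xy inverse_stereographic_def r_def)
    then have "1 + snd x = (2 / r) * (r - 1)" "1 - snd x = (2 / r) * 1" "Re (fst x) = (2 / r) * Re y"
      using r by (simp_all add: diff_divide_distrib)
    then show ?thesis by (simp only:) (simp add: algebra_simps)
  qed
  ultimately show ?thesis unfolding eq pos by simp
qed

text \<open>In the disc of the coordinates \<open>(a, h)\<close> the removed caps are cut off by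
  lines. The segment to the pole \<open>(0, 1)\<close> stays in the disc and outside the caps, as
  the affine form is nonnegative at \<open>x\<close> and equals 2 at the pole. It is lifted to the
  sphere on the side of \<open>x\<close>, marked by \<open>\<epsilon>\<close>.\<close>

lemma sphere_path:
  assumes x: "x \<in> punctured_sphere n"
  shows "\<exists>d. pathin (surface.glued n) d \<and> d 0 = Inl x \<and> surface_height (d 1) = 0"
proof -
  define a h where "a = Re (fst x)" and "h = snd x"
  have nx: "norm x = 1" using x by (simp add: punctured_sphere_def)
  then have "(norm (fst x))\<^sup>2 + h\<^sup>2 = 1" unfolding h_def by (cases x) (simp add: norm_Pair)
  then have sum1: "a\<^sup>2 + (Im (fst x))\<^sup>2 + h\<^sup>2 = 1" by (simp add: cmod_power2 a_def)
  define A H where "A t = (1 - t) * a" and "H t = (1 - t) * h + t" for t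
  define \<epsilon> :: real where "\<epsilon> = (if 0 \<le> Im (fst x) then 1 else - 1)"
  define c where "c t = (Complex (A t) (\<epsilon> * sqrt (1 - (A t)\<^sup>2 - (H t)\<^sup>2)), H t)" for t
  have AH: "(A t)\<^sup>2 + (H t)\<^sup>2 \<le> 1" if t: "t \<in> {0..1}" for t
  proof -
    have h1: "h \<le> 1" using sum1 abs_square_le_1[of h] by (smt (verit) zero_le_power2 abs_le_iff)
    have ah1: "a\<^sup>2 + h\<^sup>2 \<le> 1" using sum1 zero_le_power2[of "Im (fst x)"] by linarith
    have "(A t)\<^sup>2 + (H t)\<^sup>2 = (1 - t)\<^sup>2 * (a\<^sup>2 + h\<^sup>2) + 2 * ((1 - t) * t) * h + t\<^sup>2"
      by (simp add: A_def H_def power2_eq_square algebra_simps)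
    also have "\<dots> \<le> (1 - t)\<^sup>2 * 1 + 2 * ((1 - t) * t) * 1 + t\<^sup>2"
      using t h1 ah1 by (intro add_mono mult_left_mono) auto
    also have "\<dots> = 1" by (simp add: power2_eq_square algebra_simps)
    finally show ?thesis .
  qed
  have nc: "norm (c t) = 1" if t: "t \<in> {0..1}" for t
  proof -
    have "\<epsilon>\<^sup>2 = 1" by (simp add: \<epsilon>_def)
    then have "(norm (fst (c t)))\<^sup>2 = 1 - (H t)\<^sup>2"
      using AH[OF t] by (simp add: c_def cmod_power2 power_mult_distrib)
    then show ?thesis by (simp add: c_def norm_Pair)
  qed
  have c_in: "c t \<in> punctured_sphere n" if t: "t \<in> {0..1}" for t
  proof -
    have "c t \<notin> sphere_ball 1 i ` ball 0 1" if i: "i < n" for i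
    proof -
      define l where "l = (1 + h) - 8 * real i * a + (16 * (real i)\<^sup>2 - 1) * (1 - h)"
      have "0 \<le> l"
        using x i in_sphere_ball_iff[OF nx, of i] by (force simp: l_def a_def h_def punctured_sphere_def)
      moreover have "(1 + H t) - 8 * real i * A t + (16 * (real i)\<^sup>2 - 1) * (1 - H t) = (1 - t) * l + 2 * t"
        by (simp add: H_def A_def l_def algebra_simps)
      ultimately have "0 \<le> (1 + H t) - 8 * real i * A t + (16 * (real i)\<^sup>2 - 1) * (1 - H t)"
        using t by simp
      then show ?thesis unfolding in_sphere_ball_iff[OF nc[OF t]] by (simp add: c_def)
    qed
    then show ?thesis using nc[OF t] by (simp add: punctured_sphere_def)
  qed
  have "c 0 = x"
  proof -
    have "sqrt (1 - a\<^sup>2 - h\<^sup>2) = \<bar>Im (fst x)\<bar>" using sum1 by (simp add: algebra_simps real_sqrt_unique)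
    then have "\<epsilon> * sqrt (1 - a\<^sup>2 - h\<^sup>2) = Im (fst x)" by (simp add: \<epsilon>_def)
    then show ?thesis by (simp add: c_def A_def H_def prod_eq_iff complex_eq_iff) (simp add: a_def h_def)
  qed
  moreover have "surface_height (Inl (c 1)) = 0" by (simp add: surface_height_def c_def A_def H_def)
  moreover have "pathin (surface.glued n) (Inl \<circ> c)"
  proof -
    have "continuous_on {0..1} c"
      unfolding c_def A_def H_def Complex_eq by (intro continuous_intros)
    then have "continuous_map (top_of_set {0..1}) (top_of_set (punctured_sphere n)) c"
      using c_in by auto
    then show ?thesis unfolding pathin_def by (rule continuous_map_compose[OF _ surface.continuous_map_Inl])
  qed
  ultimately show ?thesis by (intro exI[of _ "Inl \<circ> c"]) simp
qed

text \<open>\<open>u\<close> is kept and the angle of \<open>v\<close> moves away from 0 to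
  \<open>pi\<close> or \<open>- pi\<close>, where \<open>v = -1\<close>. If the path met the removed
  disc at the chart point \<open>x\<close>, then
  \<open>\<bar>\<theta>\<bar> \<le> \<bar>Im x\<bar>\<close> would put
  \<open>Complex (Re x) \<theta>\<close> in the disc too, and this represents the starting
  point.\<close>

lemma torus_path:
  assumes i: "i < n" and m: "m \<in> torus - torus_chart ` ball 0 1"
  shows "\<exists>d. pathin (surface.glued n) d \<and> d 0 = surface.copy i m \<and> surface_height (d 1) = 0"
proof -
  obtain u v where uv: "m = (u, v)" "norm u = 1" "norm v = 1" using m by auto
  define \<theta> where "\<theta> = Arg v"
  have v: "cis \<theta> = v" using uv(3) cis_Arg[of v] by (cases "v = 0") (auto simp: \<theta>_def sgn_eq)
  have \<theta>_le: "\<bar>\<theta>\<bar> \<le> pi" using Arg_bounded[of v] by (simp add: \<theta>_def abs_le_iff)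
  define \<epsilon> :: real where "\<epsilon> = (if 0 \<le> \<theta> then 1 else - 1)"
  define T where "T t = (1 - t) * \<theta> + t * (\<epsilon> * pi)" for t
  have T: "\<bar>\<theta>\<bar> \<le> \<bar>T t\<bar>" "\<bar>T t\<bar> \<le> pi" if t: "t \<in> {0..1}" for t
  proof -
    have "T t = \<epsilon> * ((1 - t) * \<bar>\<theta>\<bar> + t * pi)" by (simp add: T_def \<epsilon>_def algebra_simps)
    moreover have "0 \<le> (1 - t) * \<bar>\<theta>\<bar> + t * pi" using t by simp
    ultimately have abs: "\<bar>T t\<bar> = (1 - t) * \<bar>\<theta>\<bar> + t * pi" by (simp add: abs_mult \<epsilon>_def)
    have "t * \<bar>\<theta>\<bar> \<le> t * pi" "(1 - t) * \<bar>\<theta>\<bar> \<le> (1 - t) * pi" using t \<theta>_le by (auto intro: mult_left_mono)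
    then show "\<bar>\<theta>\<bar> \<le> \<bar>T t\<bar>" "\<bar>T t\<bar> \<le> pi" unfolding abs by (simp_all add: algebra_simps)
  qed
  define c where "c t = (u, cis (T t))" for t
  have c_in: "c t \<in> torus - torus_chart ` ball 0 1" if t: "t \<in> {0..1}" for t
  proof -
    have "c t \<notin> torus_chart ` ball 0 1"
    proof
      assume "c t \<in> torus_chart ` ball 0 1"
      then obtain x where x: "norm x < 1" "u = cis (Re x)" "cis (T t) = cis (Im x)"
        by (auto simp: c_def torus_chart_def)
      have Im1: "\<bar>Im x\<bar> < 1" using abs_Im_le_cmod[of x] x(1) by linarith
      have cos_eq: "cos \<bar>T t\<bar> = cos \<bar>Im x\<bar>" using x(3) by (simp add: complex_eq_iff)
      have "\<bar>T t\<bar> = \<bar>Im x\<bar>"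
      proof (rule cos_inj_pi)
        show "\<bar>Im x\<bar> \<le> pi" using Im1 pi_gt3 by linarith
      qed (use T(2)[OF t] cos_eq in simp_all)
      then have le: "\<bar>\<theta>\<bar> \<le> \<bar>Im x\<bar>" using T(1)[OF t] by simp
      have "(norm (Complex (Re x) \<theta>))\<^sup>2 \<le> (norm x)\<^sup>2"
        using le by (simp add: cmod_power2 abs_le_square_iff)
      then have "norm (Complex (Re x) \<theta>) < 1" using x(1) power2_le_imp_le[of "norm (Complex (Re x) \<theta>)" "norm x"] by simp
      moreover have "m = torus_chart (Complex (Re x) \<theta>)" by (simp add: torus_chart_def uv(1) x(2) v)
      ultimately show False using m by auto
    qed
    then show ?thesis using uv by (simp add: c_def)
  qed
  have "c 0 = m" by (simp add: c_def T_def v uv)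
  moreover have "surface_height (surface.copy i (c 1)) = 0"
    by (simp add: surface_height_copy torus_height_def c_def T_def \<epsilon>_def)
  moreover have "pathin (surface.glued n) (surface.copy i \<circ> c)"
  proof -
    have "continuous_on {0..1} c" unfolding c_def T_def by (intro continuous_intros)
    then have "continuous_map (top_of_set {0..1}) (top_of_set (torus - torus_chart ` ball 0 1)) c"
      using c_in by (simp add: image_subset_iff del: mem_Sigma_iff)
    then show ?thesis unfolding pathin_def by (rule continuous_map_compose[OF _ surface.continuous_map_copy[OF i]])
  qed
  ultimately show ?thesis by (intro exI[of _ "surface.copy i \<circ> c"]) simp
qed

section \<open>Charts at the fixed points\<close>

text \<open>Charts are given through their inverses, which on the seam have a formula in two cases;
  openness of \<open>g\<close> yields continuity of the chart.\<close>

lemma reflected_chart_of_parametrisation: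
  fixes g :: "complex \<Rightarrow> 'a"
  assumes W: "open W" "\<And>y. y \<in> W \<Longrightarrow> cnj y \<in> W"
    and g: "continuous_map (top_of_set W) X g" "inj_on g W"
    and op: "\<And>A. open A \<Longrightarrow> A \<subseteq> W \<Longrightarrow> openin X (g ` A)"
    and \<tau>: "\<And>y. y \<in> W \<Longrightarrow> \<tau> (g y) = g (cnj y)"
  shows "reflected_chart X \<tau> (g ` W) (the_inv_into W g)"
proof -
  define h where "h = the_inv_into W g"
  have hg: "h (g y) = y" if "y \<in> W" for y unfolding h_def using g(2) that by (rule the_inv_into_f_f)
  have opW: "openin X (g ` W)" using op W(1) by blast
  then have sub: "g ` W \<subseteq> topspace X" by (rule openin_subset)
  have "homeomorphic_map (top_of_set W) (subtopology X (g ` W)) g"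
  proof (rule bijective_open_imp_homeomorphic_map)
    show "continuous_map (top_of_set W) (subtopology X (g ` W)) g"
      using g(1) by (simp add: continuous_map_in_subtopology)
    show "open_map (top_of_set W) (subtopology X (g ` W)) g"
      unfolding open_map_def
    proof (intro allI impI)
      fix A assume "openin (top_of_set W) A"
      then have "open A" "A \<subseteq> W" using W(1) by (auto simp: openin_open_eq)
      then show "openin (subtopology X (g ` W)) (g ` A)"
        using op opW by (simp add: openin_open_subtopology image_mono)
    qed
    show "g ` topspace (top_of_set W) = topspace (subtopology X (g ` W))" using sub by auto
    show "inj_on g (topspace (top_of_set W))" using g(2) by simp
  qed
  then obtain g' where g': "homeomorphic_maps (top_of_set W) (subtopology X (g ` W)) g g'"
    using homeomorphic_map_maps by blast
  then have "homeomorphic_maps (subtopology X (g ` W)) (top_of_set W) g' g" by (subst homeomorphic_maps_sym)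
  then have "homeomorphic_map (subtopology X (g ` W)) (top_of_set W) g'" using homeomorphic_map_maps by blast
  then have hom: "homeomorphic_map (subtopology X (g ` W)) (top_of_set W) h"
  proof (rule homeomorphic_map_eq)
    fix v assume "v \<in> topspace (subtopology X (g ` W))"
    then obtain y where "y \<in> W" "v = g y" by auto
    then show "g' v = h v" using hg g' by (auto simp: homeomorphic_maps_def)
  qed
  have "h ` g ` W = W"
    unfolding image_image using hg by (simp cong: image_cong)
  then show ?thesis
    unfolding reflected_chart_def h_def[symmetric] using hom opW W hg \<tau> by auto
qed

lemma openin_surface_sphere:
  assumes A: "openin (top_of_set (sphere 0 1)) A" "A \<inter> (\<Union>i<n. sphere_ball 1 i ` cball 0 1) = {}"
  shows "openin (surface.glued n) (Inl ` A)"
  unfolding surface.openin_glued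
proof (intro conjI allI impI)
  let ?I = "Inl :: complex \<times> real \<Rightarrow> (complex \<times> real) + nat \<times> complex \<times> complex"
  have AP: "A \<subseteq> punctured_sphere n"
    using openin_subset[OF A(1)] A(2) by (force simp: punctured_sphere_def)
  then show "Inl ` A \<subseteq> topspace (surface.glued n)" by auto
  have "{x \<in> punctured_sphere n. ?I x \<in> ?I ` A} = A" using AP by blast
  moreover have "openin (top_of_set (punctured_sphere n)) A"
    using A(1) AP by (intro openin_subset_trans[OF A(1)]) (auto simp: punctured_sphere_def)
  ultimately show "openin (top_of_set (punctured_sphere n)) {x \<in> punctured_sphere n. ?I x \<in> ?I ` A}" by (simp only:)
  fix i assume i: "i < n"
  have "surface.copy i m \<notin> Inl ` A" for m
  proof (cases "m \<in> torus_chart ` sphere 0 1")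
    case True
    then obtain x where x: "norm x = 1" "m = torus_chart x" by auto
    then have "sphere_ball 1 i x \<in> sphere_ball 1 i ` cball 0 1" by (intro imageI) simp
    then have "sphere_ball 1 i x \<notin> A" using A(2) i by blast
    then show ?thesis using x by (auto simp: surface_copy_seam)
  qed (auto simp: surface_copy_off_seam)
  then have eq: "{m \<in> torus - torus_chart ` ball 0 1. surface.copy i m \<in> Inl ` A} = {}" by blast
  show "openin (top_of_set (torus - torus_chart ` ball 0 1)) {m \<in> torus - torus_chart ` ball 0 1. surface.copy i m \<in> Inl ` A}"
    unfolding eq by (rule openin_empty)
qed

lemma openin_surface_torus:
  assumes i: "i < n" and A: "openin (top_of_set torus) A" "A \<inter> torus_chart ` cball 0 1 = {}"
  shows "openin (surface.glued n) ((\<lambda>m. Inr (i, m)) ` A)"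
  unfolding surface.openin_glued
proof (intro conjI allI impI)
  let ?T = "torus - torus_chart ` ball 0 1"
  have AK: "m \<notin> torus_chart ` sphere 0 1" if "m \<in> A" for m
    using that A(2) image_mono[OF sphere_cball, of torus_chart 0 1] by blast
  have AT: "A \<subseteq> ?T"
  proof
    fix m assume m: "m \<in> A"
    then have "m \<in> torus" using openin_subset[OF A(1)] by auto
    moreover have "m \<notin> torus_chart ` ball 0 1" using m A(2) image_mono[OF ball_subset_cball, of torus_chart 0 1] by blast
    ultimately show "m \<in> ?T" by blast
  qed
  show "(\<lambda>m. Inr (i, m)) ` A \<subseteq> topspace (surface.glued n)" using AT AK i by auto
  have eq: "{x \<in> punctured_sphere n. Inl x \<in> (\<lambda>m. Inr (i, m)) ` A} = {}" by blast
  show "openin (top_of_set (punctured_sphere n)) {x \<in> punctured_sphere n. Inl x \<in> (\<lambda>m. Inr (i, m)) ` A}"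
    unfolding eq by (rule openin_empty)
  fix j assume "j < n"
  have eq: "{m \<in> ?T. surface.copy j m \<in> (\<lambda>m. Inr (i, m)) ` A} = (if j = i then A else {})"
    using AT AK by (force simp: surface.copy_def simp del: mem_Sigma_iff split: if_splits)
  have "openin (top_of_set ?T) A"
    using AT by (intro openin_subset_trans[OF A(1)]) auto
  then show "openin (top_of_set ?T) {m \<in> ?T. surface.copy j m \<in> (\<lambda>m. Inr (i, m)) ` A}"
    unfolding eq by (cases "j = i") simp_all
qed

lemma sphere_chart:
  fixes c :: "complex \<Rightarrow> complex \<times> real"
  assumes c: "continuous_on UNIV c" "inj c" "\<And>A. open A \<Longrightarrow> openin (top_of_set (sphere 0 1)) (c ` A)"
    and refl: "\<And>y. reflect_sphere (c y) = c (cnj y)"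
    and x: "c y \<notin> (\<Union>i<n. sphere_ball 1 i ` cball 0 1)"
  shows "\<exists>V h. Inl (c y) \<in> V \<and> reflected_chart (surface.glued n) surface_reflection V h"
proof -
  let ?B = "\<Union>i<n. sphere_ball (1::complex) i ` cball 0 1"
  define W where "W = c -` (- ?B)"
  have "closed ?B"
    by (intro closed_UN ballI compact_imp_closed compact_continuous_image continuous_sphere_ball compact_cball) simp
  then have opW: "open W" unfolding W_def by (intro open_vimage open_Compl c(1))
  have c_in: "c y \<in> sphere 0 1" for y using openin_subset[OF c(3)[OF open_UNIV]] by (simp add: image_subset_iff)
  have reflB: "reflect_sphere m \<in> ?B" if "m \<in> ?B" for m
  proof -
    obtain i z where "i < n" "norm z \<le> 1" "m = sphere_ball 1 i z" using \<open>m \<in> ?B\<close> by auto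
    then show ?thesis by (auto simp: reflect_sphere_ball intro!: bexI[of _ i])
  qed
  have "reflected_chart (surface.glued n) surface_reflection ((Inl \<circ> c) ` W) (the_inv_into W (Inl \<circ> c))"
  proof (rule reflected_chart_of_parametrisation[OF opW])
    show "cnj y \<in> W" if "y \<in> W" for y
    proof -
      have "c y = reflect_sphere (c (cnj y))" by (simp add: refl)
      then show ?thesis using that reflB[of "c (cnj y)"] by (auto simp: W_def)
    qed
    have "continuous_map (top_of_set W) (top_of_set (punctured_sphere n)) c"
    proof -
      have "(\<Union>i<n. sphere_ball (1::complex) i ` ball 0 1) \<subseteq> ?B"
        by (intro UN_mono image_mono ball_subset_cball subset_refl)
      then have "c y \<in> punctured_sphere n" if "y \<in> W" for y
        using that c_in unfolding W_def punctured_sphere_def by blast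
      then show ?thesis using continuous_on_subset[OF c(1)] by (simp add: image_subset_iff)
    qed
    then show "continuous_map (top_of_set W) (surface.glued n) (Inl \<circ> c)"
      by (rule continuous_map_compose[OF _ surface.continuous_map_Inl])
    show "inj_on (Inl \<circ> c) W" using c(2) by (auto simp: inj_on_def)
    show "openin (surface.glued n) ((Inl \<circ> c) ` A)" if "open A" "A \<subseteq> W" for A
    proof -
      have "openin (surface.glued n) (Inl ` c ` A)"
      proof (rule openin_surface_sphere)
        show "openin (top_of_set (sphere 0 1)) (c ` A)" using that(1) by (rule c(3))
        show "c ` A \<inter> ?B = {}" using that(2) unfolding W_def by blast
      qed
      then show ?thesis by (simp only: image_comp)
    qed
  qed (simp add: refl)
  moreover have "Inl (c y) \<in> (Inl \<circ> c) ` W" using x by (auto simp: W_def)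
  ultimately show ?thesis by blast
qed

text \<open>Interchanges the poles: \<open>inverse_stereographic\<close> misses
  \<open>(0, 1)\<close>, a fixed point of the reflection that needs a chart as well.\<close>

definition flip :: "complex \<times> real \<Rightarrow> complex \<times> real" where
  "flip p = (fst p, - snd p)"

lemma sphere_charts:
  assumes x: "x \<in> sphere 0 1" "x \<notin> (\<Union>i<n. sphere_ball 1 i ` cball 0 1)"
  shows "\<exists>V h. Inl x \<in> V \<and> reflected_chart (surface.glued n) surface_reflection V h"
proof (cases "snd x = 1")
  case False
  then have eq: "inverse_stereographic (stereographic x) = x"
    using x(1) by (intro inverse_stereographic_stereographic) auto
  have "\<exists>V h. Inl (inverse_stereographic (stereographic x)) \<in> V \<and> reflected_chart (surface.glued n) surface_reflection V h"
    by (rule sphere_chart)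
      (use x eq in \<open>auto intro: continuous_inverse_stereographic inj_inverse_stereographic
        openin_inverse_stereographic simp: reflect_inverse_stereographic\<close>)
  then show ?thesis by (simp only: eq)
next
  case True
  have fst0: "fst x = 0" using x(1) True by (cases x) (simp add: norm_Pair)
  define c where "c y = flip (inverse_stereographic y)" for y
  have ff: "flip (flip p) = p" for p by (simp add: flip_def)
  have cont: "continuous_on S flip" for S unfolding flip_def by (intro continuous_intros)
  have norm: "norm (flip p) = norm p" for p by (cases p) (simp add: flip_def norm_Pair)
  have c0: "c 0 = x" using True fst0 by (simp add: c_def flip_def inverse_stereographic_def prod_eq_iff)
  have "\<exists>V h. Inl (c 0) \<in> V \<and> reflected_chart (surface.glued n) surface_reflection V h"
  proof (rule sphere_chart)
    show "continuous_on UNIV c"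
      unfolding c_def by (intro continuous_on_compose2[OF cont[of UNIV]] continuous_inverse_stereographic) auto
    show "inj c"
      by (rule injI) (metis c_def ff injD inj_inverse_stereographic)
    show "openin (top_of_set (sphere 0 1)) (c ` A)" if A: "open A" for A
    proof -
      obtain D where D: "open D" "inverse_stereographic ` A = sphere 0 1 \<inter> D"
        using openin_inverse_stereographic[OF A] by (auto simp: openin_open)
      have "c ` A = flip ` (sphere 0 1 \<inter> D)" unfolding D(2)[symmetric] by (auto simp: c_def)
      also have "\<dots> = sphere 0 1 \<inter> flip -` D"
      proof (intro set_eqI iffI)
        fix p assume "p \<in> sphere 0 1 \<inter> flip -` D"
        then have "flip p \<in> sphere 0 1 \<inter> D" by (simp add: norm)
        then show "p \<in> flip ` (sphere 0 1 \<inter> D)" using ff by (metis imageI)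
      qed (auto simp: norm ff)
      finally show ?thesis
        using open_vimage[OF D(1) cont[of UNIV]] by (simp add: openin_open_Int)
    qed
    show "reflect_sphere (c y) = c (cnj y)" for y
      by (simp add: c_def reflect_inverse_stereographic[symmetric]) (simp add: flip_def reflect_sphere_def)
    show "c 0 \<notin> (\<Union>i<n. sphere_ball 1 i ` cball 0 1)" using x(2) c0 by simp
  qed
  then show ?thesis by (simp only: c0)
qed

lemma torus_charts:
  assumes i: "i < n" and m: "m \<in> torus" "m \<notin> torus_chart ` cball 0 1" and Im: "Im (snd m) = 0"
  shows "\<exists>V h. Inr (i, m) \<in> V \<and> reflected_chart (surface.glued n) surface_reflection V h"
proof -
  define u v where "u = fst m" and "v = snd m"
  have "norm u = 1" "norm v = 1" "cnj v = v"
    using m(1) Im by (auto simp: u_def v_def complex_eq_iff)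
  moreover from this have "u \<noteq> 0" "v \<noteq> 0" by auto
  ultimately have uv: "norm u = 1" "norm v = 1" "cnj v = v" "u \<noteq> 0" "v \<noteq> 0" by auto
  \<comment> \<open>Translation in the torus group moves the chart at \<open>(1, 1)\<close> to
    \<open>m\<close>. It commutes with the reflection because \<open>v\<close> is real.\<close>
  define t where "t = (\<lambda>p. (u * fst p, v * snd p))"
  define t' where "t' = (\<lambda>p. (fst p / u, snd p / v))"
  have tt': "t (t' p) = p" "t' (t p) = p" for p using uv by (simp_all add: t_def t'_def)
  have cont: "continuous_on S t" "continuous_on S t'" for S
    unfolding t_def t'_def using uv by (auto intro!: continuous_intros)
  have t_in: "t p \<in> torus \<longleftrightarrow> p \<in> torus" for p using uv by (cases p) (simp add: t_def norm_mult)
  define c where "c y = t (torus_chart y)" for y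
  have c_in: "c y \<in> torus" for y using t_in torus_chart_in by (simp add: c_def)
  have c_refl: "reflect_torus (c y) = c (cnj y)" for y
    by (simp add: c_def reflect_torus_chart[symmetric]) (simp add: t_def reflect_torus_def uv)
  have c_open: "openin (top_of_set torus) (c ` A)" if A: "open A" for A
  proof -
    obtain D where D: "open D" "torus_chart ` A = torus \<inter> D"
      using openin_torus_chart[OF A] by (auto simp: openin_open)
    have "c ` A = t ` (torus \<inter> D)" unfolding D(2)[symmetric] by (auto simp: c_def)
    also have "\<dots> = torus \<inter> t' -` D"
    proof (intro set_eqI iffI)
      fix p assume "p \<in> torus \<inter> t' -` D"
      then have "t' p \<in> torus \<inter> D" using t_in[of "t' p"] by (simp only: tt') blast
      then show "p \<in> t ` (torus \<inter> D)" using tt'(1) by (metis imageI)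
    next
      fix p assume "p \<in> t ` (torus \<inter> D)"
      then obtain r where "r \<in> torus" "r \<in> D" "p = t r" by blast
      then show "p \<in> torus \<inter> t' -` D" using t_in[of r] tt'(2) by simp
    qed
    finally show ?thesis
      using open_vimage[OF D(1) cont(2)[of UNIV]] by (simp add: openin_open_Int)
  qed
  have c_cont: "continuous_on S c" for S
    unfolding c_def by (intro continuous_on_compose2[OF cont(1)[of UNIV]] continuous_torus_chart) auto
  \<comment> \<open>The radius 2 gives injectivity; cutting out the closed disc keeps the chart off
    the seam.\<close>
  define W where "W = ball 0 2 \<inter> c -` (- torus_chart ` cball 0 1)"
  have "closed (torus_chart ` cball 0 1)"
    by (intro compact_imp_closed compact_continuous_image continuous_torus_chart compact_cball)
  then have opW: "open W"
    unfolding W_def by (intro open_Int open_ball open_vimage open_Compl c_cont)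
  let ?g = "\<lambda>y. Inr (i, c y) :: (complex \<times> real) + nat \<times> (complex \<times> complex)"
  have chart: "reflected_chart (surface.glued n) surface_reflection (?g ` W) (the_inv_into W ?g)"
  proof (rule reflected_chart_of_parametrisation[OF opW])
    show "cnj y \<in> W" if "y \<in> W" for y
      using that reflect_torus_cball[of "c y"] by (simp add: W_def c_refl)
    show "inj_on ?g W"
    proof (rule inj_onI)
      fix y y' assume "y \<in> W" "y' \<in> W" "?g y = ?g y'"
      then have "torus_chart y = torus_chart y'" using tt'(2) by (metis c_def prod.inject sum.inject(2))
      then show "y = y'" using \<open>y \<in> W\<close> \<open>y' \<in> W\<close> by (simp add: torus_chart_eq_iff W_def)
    qed
    have sphere: "m \<notin> torus_chart ` sphere 0 1" "m \<notin> torus_chart ` ball 0 1" if "m \<notin> torus_chart ` cball 0 1" for m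
      using that by auto
    have "continuous_map (top_of_set W) (top_of_set (torus - torus_chart ` ball 0 1)) c"
      using c_cont c_in sphere(2) by (simp add: image_subset_iff W_def del: mem_Sigma_iff)
    from continuous_map_compose[OF this surface.continuous_map_copy[OF i]]
    show "continuous_map (top_of_set W) (surface.glued n) ?g"
      by (rule continuous_map_eq) (use sphere(1) in \<open>auto simp: W_def surface_copy_off_seam\<close>)
    show "openin (surface.glued n) (?g ` A)" if "open A" "A \<subseteq> W" for A
    proof -
      have "openin (surface.glued n) ((\<lambda>m. Inr (i, m)) ` c ` A)"
      proof (rule openin_surface_torus[OF i])
        show "openin (top_of_set torus) (c ` A)" using that(1) by (rule c_open)
        show "c ` A \<inter> torus_chart ` cball 0 1 = {}" using that(2) unfolding W_def by blast
      qed
      then show ?thesis by (simp only: image_image)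
    qed
  qed (simp add: c_refl)
  have c0: "c 0 = m" by (simp add: c_def t_def torus_chart_def u_def v_def)
  have "Inr (i, m) \<in> ?g ` W" using m(2) c0 by (intro image_eqI[of _ _ 0]) (auto simp: W_def)
  then show ?thesis using chart by (intro exI conjI)
qed

text \<open>Both sides of the seam are exteriors of the unit circle in their charts; the inversion
  \<open>y \<mapsto> 1 / cnj y\<close> turns one of them inside out.\<close>

definition annulus :: "complex set" where
  "annulus = {y. 2/3 < norm y \<and> norm y < 3/2}"

definition seam_param :: "nat \<Rightarrow> complex \<Rightarrow> (complex \<times> real) + nat \<times> (complex \<times> complex)" where
  "seam_param i y = (if 1 \<le> norm y then Inl (sphere_ball 1 i y) else surface.copy i (torus_chart (inverse (cnj y))))"

lemma norm_inverse_cnj: "norm (inverse (cnj y)) = inverse (norm y)"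
  by (simp add: norm_inverse)

text \<open>The radii 2/3 and 3/2 are reciprocal, so the inversion permutes the annulus. Moreover
  3/2 is less than half of the spacing of the balls and lies within the injectivity radius 2 of
  \<open>torus_chart\<close>.\<close>

lemma annulus_inverse: "y \<in> annulus \<Longrightarrow> inverse (cnj y) \<in> annulus"
proof -
  have "2/3 < inverse r \<and> inverse r < 3/2" if "2/3 < r" "r < 3/2" for r :: real
    using that by (simp add: field_simps)
  then show "y \<in> annulus \<Longrightarrow> inverse (cnj y) \<in> annulus" by (simp only: annulus_def mem_Collect_eq norm_inverse_cnj)
qed

lemma annulus_le2: "y \<in> annulus \<Longrightarrow> norm y \<le> 2"
  by (simp add: annulus_def)

lemma inverse_cnj_unit: "norm y = 1 \<Longrightarrow> inverse (cnj y) = y"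
proof -
  assume "norm y = 1"
  then have "y * cnj y = 1" using complex_norm_square[of y] by simp
  then show ?thesis by (metis inverse_unique mult.commute)
qed

lemma torus_chart_off_seam:
  assumes "y \<in> annulus" "norm y < 1"
  shows "torus_chart (inverse (cnj y)) \<in> torus - torus_chart ` ball 0 1"
    and "torus_chart (inverse (cnj y)) \<notin> torus_chart ` sphere 0 1"
proof -
  have "1 < norm (inverse (cnj y))"
    using assms by (auto simp: norm_inverse_cnj annulus_def intro!: one_less_inverse)
  moreover have "norm (inverse (cnj y)) \<le> 2" using annulus_le2[OF annulus_inverse[OF assms(1)]] .
  ultimately have "torus_chart (inverse (cnj y)) \<noteq> torus_chart x" if "norm x \<le> 1" for x
    using that torus_chart_eq_iff[of "inverse (cnj y)" x] by auto
  then show "torus_chart (inverse (cnj y)) \<in> torus - torus_chart ` ball 0 1"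
    "torus_chart (inverse (cnj y)) \<notin> torus_chart ` sphere 0 1"
    using torus_chart_in by force+
qed

lemma seam_param_outside: "1 \<le> norm y \<Longrightarrow> seam_param i y = Inl (sphere_ball 1 i y)"
  by (simp add: seam_param_def)

lemma seam_param_inside: "y \<in> annulus \<Longrightarrow> norm y < 1 \<Longrightarrow> seam_param i y = Inr (i, torus_chart (inverse (cnj y)))"
  using torus_chart_off_seam(2)[of y] by (simp add: seam_param_def surface_copy_off_seam)

lemma seam_param_inside': "norm y \<le> 1 \<Longrightarrow> seam_param i y = surface.copy i (torus_chart (inverse (cnj y)))"
  by (cases "norm y = 1") (auto simp: seam_param_def inverse_cnj_unit surface_copy_seam)

lemma sphere_ball_annulus:
  assumes "sphere_ball (1::complex) i y = sphere_ball 1 j z" "norm y < 3/2" "norm z < 3/2"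
  shows "i = j \<and> y = z"
proof -
  have "4 * real i + Re y = 4 * real j + Re z" using assms(1) by (simp add: sphere_ball_eq_iff complex_eq_iff)
  moreover have "\<bar>Re y\<bar> < 3/2" "\<bar>Re z\<bar> < 3/2"
    using abs_Re_le_cmod[of y] abs_Re_le_cmod[of z] assms(2,3) by linarith+
  ultimately have "i = j" by linarith
  then show ?thesis using assms(1) injD[OF inj_sphere_ball] by blast
qed

lemma sphere_ball_in_punctured_sphere:
  assumes "i < n" "norm y < 3/2"
  shows "sphere_ball 1 i y \<in> punctured_sphere n \<longleftrightarrow> 1 \<le> norm y"
proof
  assume "sphere_ball 1 i y \<in> punctured_sphere n"
  then have "sphere_ball 1 i y \<notin> sphere_ball 1 i ` ball 0 1" using assms(1) by (auto simp: punctured_sphere_def)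
  then show "1 \<le> norm y" by (metis imageI mem_ball_0 not_le)
next
  assume y: "1 \<le> norm y"
  have "sphere_ball 1 i y \<notin> sphere_ball 1 j ` ball 0 1" for j
  proof
    assume "sphere_ball 1 i y \<in> sphere_ball 1 j ` ball 0 1"
    then obtain z where "norm z < 1" "sphere_ball 1 i y = sphere_ball 1 j z" by auto
    then show False using sphere_ball_annulus[of i y j z] assms(2) y by auto
  qed
  then show "sphere_ball 1 i y \<in> punctured_sphere n" by (simp add: punctured_sphere_def norm_sphere_ball)
qed

text \<open>Openness in the glued space is tested on the pieces: the image of \<open>A\<close> meets
  the punctured sphere in a part of the image of \<open>A\<close> under
  \<open>sphere_ball 1 i\<close>, the \<open>i\<close>-th torus in a part of the image of the
  inverted set \<open>A'\<close>, and no other copy. The inversion commutes with conjugation, so the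
  reflection acts as \<open>cnj\<close>.\<close>

lemma seam_chart:
  assumes i: "i < n" and y: "norm y = 1"
  shows "\<exists>V h. Inl (sphere_ball 1 i y) \<in> V \<and> reflected_chart (surface.glued n) surface_reflection V h"
proof -
  let ?T = "torus - torus_chart ` ball 0 1"
  have op: "open annulus"
  proof -
    have eq: "annulus = {y. 2/3 < norm y} \<inter> {y. norm y < 3/2}" by (auto simp: annulus_def)
    show ?thesis unfolding eq by (intro open_Int open_Collect_less continuous_intros)
  qed
  have "reflected_chart (surface.glued n) surface_reflection (seam_param i ` annulus) (the_inv_into annulus (seam_param i))"
  proof (rule reflected_chart_of_parametrisation[OF op])
    show "cnj y \<in> annulus" if "y \<in> annulus" for y using that by (simp add: annulus_def)
    show "surface_reflection (seam_param i y) = seam_param i (cnj y)" for y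
      by (simp add: seam_param_def reflect_sphere_ball surface_reflection_copy reflect_torus_chart)
    show "inj_on (seam_param i) annulus"
    proof (rule inj_onI)
      fix y z assume yz: "y \<in> annulus" "z \<in> annulus" and eq: "seam_param i y = seam_param i z"
      show "y = z"
      proof (cases "1 \<le> norm y"; cases "1 \<le> norm z")
        assume "1 \<le> norm y" "1 \<le> norm z"
        then show ?thesis using eq injD[OF inj_sphere_ball] by (auto simp: seam_param_outside)
      next
        assume "\<not> 1 \<le> norm y" "\<not> 1 \<le> norm z"
        then have "torus_chart (inverse (cnj y)) = torus_chart (inverse (cnj z))"
          using eq yz by (simp add: seam_param_inside)
        then have "inverse (cnj y) = inverse (cnj z)"
          using torus_chart_eq_iff annulus_le2 annulus_inverse yz by blast
        then show ?thesis by simp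
      qed (use eq yz in \<open>auto simp: seam_param_outside seam_param_inside\<close>)
    qed
    show "continuous_map (top_of_set annulus) (surface.glued n) (seam_param i)"
      unfolding seam_param_def[abs_def]
    proof (rule continuous_map_cases_le)
      show "continuous_map (top_of_set annulus) euclideanreal (\<lambda>y. 1)"
        "continuous_map (top_of_set annulus) euclideanreal norm" by (auto intro: continuous_intros)
      have "continuous_map (top_of_set {y \<in> annulus. 1 \<le> norm y}) (top_of_set (punctured_sphere n)) (sphere_ball 1 i)"
        using sphere_ball_in_punctured_sphere[OF i] by (auto simp: continuous_sphere_ball annulus_def)
      from continuous_map_compose[OF this surface.continuous_map_Inl]
      show "continuous_map (subtopology (top_of_set annulus) {y \<in> topspace (top_of_set annulus). 1 \<le> norm y})
          (surface.glued n) (\<lambda>y. Inl (sphere_ball 1 i y))"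
        unfolding subtopology_Collect_top_of_set by (simp add: comp_def)
      have in_T: "torus_chart (inverse (cnj y)) \<in> ?T" if "y \<in> annulus" "norm y \<le> 1" for y
      proof (cases "norm y = 1")
        case True
        then have "torus_chart (inverse (cnj y)) \<in> torus_chart ` sphere 0 1" by (simp add: inverse_cnj_unit)
        then show ?thesis using surface.K_subset by blast
      qed (use torus_chart_off_seam(1) that in auto)
      have "0 \<notin> annulus" by (simp add: annulus_def)
      then have "continuous_on {y \<in> annulus. norm y \<le> 1} (\<lambda>y. torus_chart (inverse (cnj y)))"
        by (intro continuous_on_compose2[OF continuous_torus_chart[of UNIV]] continuous_intros) auto
      then have "continuous_map (top_of_set {y \<in> annulus. norm y \<le> 1}) (top_of_set ?T) (\<lambda>y. torus_chart (inverse (cnj y)))"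
        using in_T by (simp add: image_subset_iff del: Diff_iff)
      from continuous_map_compose[OF this surface.continuous_map_copy[OF i]]
      show "continuous_map (subtopology (top_of_set annulus) {y \<in> topspace (top_of_set annulus). norm y \<le> 1})
          (surface.glued n) (\<lambda>y. surface.copy i (torus_chart (inverse (cnj y))))"
        unfolding subtopology_Collect_top_of_set by (simp add: comp_def)
      show "Inl (sphere_ball 1 i y) = surface.copy i (torus_chart (inverse (cnj y)))" if "1 = norm y" for y
        using that by (simp add: inverse_cnj_unit surface_copy_seam)
    qed
    fix A assume A: "open A" "A \<subseteq> annulus"
    show "openin (surface.glued n) (seam_param i ` A)"
      unfolding surface.openin_glued
    proof (intro conjI allI impI)
      show "seam_param i ` A \<subseteq> topspace (surface.glued n)"
      proof
        fix z assume "z \<in> seam_param i ` A"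
        then obtain y where y: "y \<in> A" "z = seam_param i y" by blast
        then have "y \<in> annulus" using A(2) by blast
        then show "z \<in> topspace (surface.glued n)"
          using y(2) i sphere_ball_in_punctured_sphere[OF i, of y] torus_chart_off_seam[of y]
          by (cases "1 \<le> norm y") (auto simp: seam_param_outside seam_param_inside annulus_def)
      qed
      have "{x \<in> punctured_sphere n. Inl x \<in> seam_param i ` A} = punctured_sphere n \<inter> sphere_ball 1 i ` A"
      proof (intro set_eqI iffI)
        fix x assume x: "x \<in> {x \<in> punctured_sphere n. Inl x \<in> seam_param i ` A}"
        then obtain y where y: "y \<in> A" "Inl x = seam_param i y" by auto
        then have "1 \<le> norm y" using A(2) seam_param_inside[of y i] by force
        then have "x = sphere_ball 1 i y" using y(2) by (simp add: seam_param_outside)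
        then show "x \<in> punctured_sphere n \<inter> sphere_ball 1 i ` A" using x y(1) by blast
      next
        fix x assume x: "x \<in> punctured_sphere n \<inter> sphere_ball 1 i ` A"
        then obtain y where y: "y \<in> A" "x = sphere_ball 1 i y" by auto
        then have "1 \<le> norm y" using A(2) x sphere_ball_in_punctured_sphere[OF i, of y] by (auto simp: annulus_def)
        then have "Inl x = seam_param i y" using y(2) by (simp add: seam_param_outside)
        then show "x \<in> {x \<in> punctured_sphere n. Inl x \<in> seam_param i ` A}" using x y(1) by auto
      qed
      moreover have "openin (top_of_set (punctured_sphere n)) (punctured_sphere n \<inter> sphere_ball 1 i ` A)"
      proof -
        obtain D where "open D" "sphere_ball 1 i ` A = sphere 0 1 \<inter> D"
          using openin_sphere_ball[OF A(1), of 1 i] unfolding openin_open by blast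
        then have "punctured_sphere n \<inter> sphere_ball 1 i ` A = punctured_sphere n \<inter> D" "open D"
          by (auto simp: punctured_sphere_def)
        then show ?thesis by (simp add: openin_open_Int)
      qed
      ultimately show "openin (top_of_set (punctured_sphere n)) {x \<in> punctured_sphere n. Inl x \<in> seam_param i ` A}"
        by (simp only:)
      fix j assume j: "j < n"
      define A' where "A' = (\<lambda>y. inverse (cnj y)) ` A"
      have "A' = (\<lambda>y. inverse (cnj y)) -` A"
      proof (intro set_eqI iffI)
        fix y assume "y \<in> (\<lambda>y. inverse (cnj y)) -` A"
        then have "inverse (cnj (inverse (cnj y))) \<in> A'" unfolding A'_def by blast
        then show "y \<in> A'" by simp
      qed (auto simp: A'_def)
      then have A'_eq: "A' = - {0} \<inter> (\<lambda>y. inverse (cnj y)) -` A" using A(2) by (auto simp: annulus_def)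
      have "continuous_on (- {0}) (\<lambda>y::complex. inverse (cnj y))" by (intro continuous_intros) auto
      then have opA': "open A'"
        unfolding A'_eq using A(1) by (intro continuous_open_preimage) auto
      have A'_norm: "norm x \<le> 2" if "x \<in> A'" for x
        using that A(2) annulus_inverse annulus_le2 by (auto simp: A'_def)
      \<comment> \<open>A point of another copy could meet the image only on its own seam, which
        lies in \<open>P\<close>; disjointness of the annuli on the sphere excludes this.\<close>
      have eq2: "{m \<in> ?T. surface.copy j m \<in> seam_param i ` A} = (if j = i then ?T \<inter> torus_chart ` A' else {})"
      proof (intro set_eqI iffI)
        fix m assume "m \<in> {m \<in> ?T. surface.copy j m \<in> seam_param i ` A}"
        then obtain y where m: "m \<in> ?T" and y: "y \<in> A" "surface.copy j m = seam_param i y" by auto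
        have ya: "y \<in> annulus" using A(2) y(1) by blast
        have "j = i \<and> m = torus_chart (inverse (cnj y))"
        proof (cases "1 \<le> norm y")
          case True
          then have eq: "surface.copy j m = Inl (sphere_ball 1 i y)" using y(2) by (simp add: seam_param_outside)
          then have "m \<in> torus_chart ` sphere 0 1" by (auto simp: surface.copy_def split: if_splits)
          then obtain x where x: "norm x = 1" "m = torus_chart x" by auto
          then have "sphere_ball 1 j x = sphere_ball 1 i y" using eq by (simp add: surface_copy_seam)
          then have "j = i \<and> x = y" using sphere_ball_annulus[of j x i y] x(1) ya by (simp add: annulus_def)
          then show ?thesis using x inverse_cnj_unit by auto
        next
          case False
          then show ?thesis using y(2) ya by (auto simp: seam_param_inside surface.copy_def split: if_splits)
        qed
        then show "m \<in> (if j = i then ?T \<inter> torus_chart ` A' else {})" using m y(1) by (auto simp: A'_def)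
      next
        fix m assume "m \<in> (if j = i then ?T \<inter> torus_chart ` A' else {})"
        then have ji: "j = i" and m: "m \<in> ?T" and "m \<in> torus_chart ` A'" by (auto split: if_splits)
        then obtain y where y: "y \<in> A" "m = torus_chart (inverse (cnj y))" by (auto simp: A'_def)
        have "\<not> norm (inverse (cnj y)) < 1" using m y(2) by auto
        moreover have "y \<noteq> 0" using y(1) A(2) by (auto simp: annulus_def)
        ultimately have "norm y \<le> 1" unfolding norm_inverse_cnj by (simp add: field_simps)
        then have "surface.copy j m = seam_param i y" using y(2) ji seam_param_inside' by simp
        then show "m \<in> {m \<in> ?T. surface.copy j m \<in> seam_param i ` A}" using m y(1) by blast
      qed
      have "openin (top_of_set ?T) (?T \<inter> torus_chart ` A')"
      proof -
        obtain D where "open D" "torus_chart ` A' = torus \<inter> D"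
          using openin_torus_chart[OF opA'] unfolding openin_open by blast
        then have "?T \<inter> torus_chart ` A' = ?T \<inter> D" "open D" by auto
        then show ?thesis by (simp add: openin_open_Int)
      qed
      then show "openin (top_of_set ?T) {m \<in> ?T. surface.copy j m \<in> seam_param i ` A}"
        unfolding eq2 by (cases "j = i") simp_all
    qed
  qed
  moreover have "Inl (sphere_ball 1 i y) \<in> seam_param i ` annulus"
    using y by (intro image_eqI[of _ _ y]) (auto simp: seam_param_outside annulus_def)
  ultimately show ?thesis by blast
qed

lemma compact_punctured_sphere: "compact (punctured_sphere n)"
proof -
  have "\<forall>i. \<exists>D. open D \<and> sphere_ball (1::complex) i ` ball 0 1 = sphere 0 1 \<inter> D"
    using openin_sphere_ball[OF open_ball] unfolding openin_open by blast
  from choice[OF this] obtain D where D: "\<And>i. open (D i)"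
    "\<And>i. sphere_ball (1::complex) i ` ball 0 1 = sphere 0 1 \<inter> D i" by blast
  have "punctured_sphere n = sphere 0 1 - (\<Union>i<n. D i)" unfolding punctured_sphere_def D(2) by blast
  then show ?thesis using D(1) by (simp add: compact_diff open_UN)
qed

lemma compact_punctured_torus: "compact (torus - torus_chart ` ball 0 1)"
proof -
  obtain D where D: "open D" "torus_chart ` ball 0 1 = torus \<inter> D"
    using openin_torus_chart[OF open_ball, of 0 1] unfolding openin_open by blast
  have "torus - torus_chart ` ball 0 1 = torus - D" unfolding D(2) by blast
  then show ?thesis using D(1) by (simp add: compact_diff compact_Times)
qed

theorem reflected_surface_glued: "reflected_surface (surface.glued n) surface_reflection surface_height"
proof
  show "compact_space (surface.glued n)"
    by (rule surface.compact_space_glued[OF compact_punctured_sphere compact_punctured_torus])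
  show "continuous_map (surface.glued n) (surface.glued n) surface_reflection" by (rule continuous_surface_reflection)
  show "continuous_map (surface.glued n) euclideanreal surface_height" by (rule continuous_surface_height)
  fix z assume z: "z \<in> topspace (surface.glued n)"
  show "surface_reflection (surface_reflection z) = z"
    using z by (cases z rule: surface.topspace_cases) (auto simp: reflect_sphere_def reflect_torus_def)
  show "surface_height (surface_reflection z) = - surface_height z" using z by (rule surface_height_reflection)
  show "surface_reflection z = z" if "surface_height z = 0" using z that by (rule surface_height_eq_0)
  show "\<exists>d. pathin (surface.glued n) d \<and> d 0 = z \<and> surface_height (d 1) = 0"
    using z
  proof (cases z rule: surface.topspace_cases)
    case (1 x)
    then show ?thesis using sphere_path by blast
  next
    case (2 i m)
    then show ?thesis using torus_path[of i n m] by metis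
  qed
  \<comment> \<open>Three kinds of fixed points occur: in the interior of the punctured sphere, on a
    seam, and in a torus off the seam.\<close>
  show "\<exists>V h. z \<in> V \<and> reflected_chart (surface.glued n) surface_reflection V h" if z0: "surface_height z = 0"
    using z
  proof (cases z rule: surface.topspace_cases)
    case (1 x)
    show ?thesis
    proof (cases "x \<in> (\<Union>i<n. sphere_ball 1 i ` cball 0 1)")
      case True
      then obtain i y where iy: "i < n" "norm y \<le> 1" "x = sphere_ball 1 i y" by auto
      then have "1 \<le> norm y" using 1(1) sphere_ball_in_punctured_sphere[of i n y] by auto
      then have "norm y = 1" using iy(2) by simp
      then show ?thesis using seam_chart[OF iy(1)] 1(2) iy(3) by blast
    next
      case False
      have "x \<in> sphere 0 1" using 1(1) by (simp add: punctured_sphere_def)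
      then show ?thesis using sphere_charts False 1(2) by blast
    qed
  next
    case (2 i m)
    have "surface_reflection z = z" using z z0 by (rule surface_height_eq_0)
    then have "Im (snd m) = 0" using 2(4) by (auto simp: reflect_torus_def prod_eq_iff complex_eq_iff)
    moreover have "m \<notin> torus_chart ` cball 0 1"
    proof
      assume "m \<in> torus_chart ` cball 0 1"
      then obtain x where "norm x \<le> 1" "m = torus_chart x" by auto
      then show False using 2(2,3) by (cases "norm x = 1") auto
    qed
    ultimately show ?thesis using torus_charts[OF 2(1), of m] 2(2,4) by blast
  qed
qed

section \<open>The branched double covering\<close>

lemma surface_glued_eq: "connected_sum_copies 1 (prod_topology circle circle) torus_chart n = surface.glued n"
proof -
  have "prod_topology circle circle = top_of_set torus"
    by (simp add: subtopology_Times euclidean_product_topology)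
  then show ?thesis
    using connected_sum_copies_eq[of 1 torus_chart torus n, OF _ inj_on_torus_chart torus_chart_in]
    unfolding seam_def[abs_def] punctured_sphere_def by simp
qed

lemma S2xS1_chart_in: "S2xS1_chart x \<in> sphere 0 1 \<times> sphere 0 1"
  by (simp add: S2xS1_chart_def norm_inverse_stereographic)

theorem proposition4:
  fixes n :: nat and S :: "'a topology"
  assumes "closed_surface_of_genus n S"
  shows "\<exists>f. branched_double_covering (prod_topology S circle) (connected_sum_S2xS1 n) f \<and>
             pi1_surjective (prod_topology S circle) (connected_sum_S2xS1 n) f"
proof -
  have "S homeomorphic_space surface.glued n"
    using assms unfolding closed_surface_of_genus_def surface_glued_eq .
  then obtain k k' where k: "homeomorphic_maps S (surface.glued n) k k'"
    by (auto simp: homeomorphic_space_def)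
  interpret reflected_surface S "k' \<circ> surface_reflection \<circ> k" "surface_height \<circ> k"
    using reflected_surface_glued k by (rule homeomorphic_reflected_surface)
  obtain p1 where p1: "folding (punctured_sphere n) reflect_sphere
       (sphere 0 1 - (\<Union>i<n. sphere_ball (0, 1) i ` ball 0 1)) p1"
    "\<And>i x w. i < n \<Longrightarrow> norm x = 1 \<Longrightarrow> norm w = 1 \<Longrightarrow>
       p1 (sphere_ball 1 i x, w) = sphere_ball (0, 1) i (fold_ball (x, w))"
    using sphere_piece_folding[of n] unfolding punctured_sphere_def by blast
  obtain p2 where p2: "folding (torus - torus_chart ` ball 0 1) reflect_torus
       (sphere 0 1 \<times> sphere 0 1 - S2xS1_chart ` ball 0 1) p2"
    "\<And>x w. norm x = 1 \<Longrightarrow> norm w = 1 \<Longrightarrow> p2 (torus_chart x, w) = S2xS1_chart (fold_ball (x, w))"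
    "\<And>m w. m \<in> torus \<Longrightarrow> norm w = 1 \<Longrightarrow> p2 (m, w) \<in> S2xS1_chart ` sphere 0 1 \<longleftrightarrow> m \<in> torus_chart ` sphere 0 1"
    using torus_piece_folding by blast
  let ?s' = "\<lambda>i y. sphere_ball (0, 1) i (inv_into (sphere 0 1) S2xS1_chart y)"
  interpret tgt: attached_copies "sphere 0 1 - (\<Union>i<n. sphere_ball (0, 1) i ` ball 0 1)"
    "sphere 0 1 \<times> sphere 0 1 - S2xS1_chart ` ball 0 1" "S2xS1_chart ` sphere 0 1" n ?s'
    by (rule attached_copies_connected_sum[OF _ inj_on_S2xS1_chart S2xS1_chart_in]) (simp add: norm_Pair)
  have tgt_eq: "connected_sum_S2xS1 n = tgt.glued"
  proof -
    have "prod_topology (top_of_set (sphere (0 :: complex \<times> real) 1)) circle = top_of_set (sphere 0 1 \<times> sphere 0 1)"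
      by (simp add: subtopology_Times euclidean_product_topology)
    then show ?thesis
      unfolding connected_sum_S2xS1_def
      using connected_sum_copies_eq[of "(0, 1)" S2xS1_chart "sphere 0 1 \<times> sphere 0 1" n, OF _ inj_on_S2xS1_chart S2xS1_chart_in]
      by (simp add: norm_Pair)
  qed
  interpret folded_copies "punctured_sphere n" "torus - torus_chart ` ball 0 1" "torus_chart ` sphere 0 1" n seam
    "sphere 0 1 - (\<Union>i<n. sphere_ball (0, 1) i ` ball 0 1)"
    "sphere 0 1 \<times> sphere 0 1 - S2xS1_chart ` ball 0 1" "S2xS1_chart ` sphere 0 1" ?s'
    reflect_sphere reflect_torus p1 p2
  proof
    show "compact (punctured_sphere n)" by (rule compact_punctured_sphere)
    show "compact (torus - torus_chart ` ball 0 1)" by (rule compact_punctured_torus)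
    show "p2 (m, w) \<in> S2xS1_chart ` sphere 0 1 \<longleftrightarrow> m \<in> torus_chart ` sphere 0 1"
      if "m \<in> torus - torus_chart ` ball 0 1" "norm w = 1" for m w
      using that(1) by (intro p2(3)[OF _ that(2)]) (rule DiffD1)
    \<comment> \<open>Here the rounding pays off: on the seam both foldings are
      \<open>fold_ball\<close> in the charts, and \<open>fold_ball\<close> keeps the radius 1, so
      the chart can be inverted on the boundary sphere.\<close>
    show "p1 (seam i m, w) = ?s' i (p2 (m, w))"
      if i: "i < n" and m: "m \<in> torus_chart ` sphere 0 1" and w: "norm w = 1" for i m w
    proof -
      obtain x where x: "norm x = 1" "m = torus_chart x" using m by auto
      have "norm (fold_ball (x, w)) = 1" using norm_fold_ball_iff(3)[OF w] x(1) by blast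
      moreover have "inj_on S2xS1_chart (sphere 0 1)" by (rule inj_on_subset[OF inj_on_S2xS1_chart]) auto
      ultimately have "inv_into (sphere 0 1) S2xS1_chart (S2xS1_chart (fold_ball (x, w))) = fold_ball (x, w)"
        by (intro inv_into_f_f) auto
      then show ?thesis by (simp add: x seam_torus_chart p1(2) p2(2) i w)
    qed
  qed (fact p1(1) p2(1))+
  define F where "F = sum_map p1 p2 \<circ> (\<lambda>q. (k (fst q), snd q))"
  have hk: "homeomorphic_map (prod_topology S circle) (prod_topology (surface.glued n) circle) (\<lambda>q. (k (fst q), snd q))"
  proof -
    have "homeomorphic_maps circle circle id id" by (simp add: homeomorphic_maps_def)
    then have "homeomorphic_maps (prod_topology S circle) (prod_topology (surface.glued n) circle)
        (\<lambda>(x, y). (k x, id y)) (\<lambda>(x, y). (k' x, id y))"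
      unfolding homeomorphic_maps_prod using k by blast
    then have "homeomorphic_map (prod_topology S circle) (prod_topology (surface.glued n) circle) (\<lambda>(x, y). (k x, id y))"
      using homeomorphic_map_maps by blast
    then show ?thesis by (simp add: case_prod_unfold)
  qed
  have k_in: "k x \<in> topspace (surface.glued n)" if "x \<in> topspace S" for x
    using k that by (auto simp: homeomorphic_maps_def continuous_map_def)
  interpret folded_product S "k' \<circ> surface_reflection \<circ> k" "surface_height \<circ> k" tgt.glued F
  proof
    show "quotient_map (prod_topology S circle) tgt.glued F"
      unfolding F_def using hk quotient_f by (auto simp: homeomorphic_map_def intro: quotient_map_compose)
    fix q q' assume q: "q \<in> topspace (prod_topology S circle)" "q' \<in> topspace (prod_topology S circle)"
    obtain x w x' w' where xw: "q = (x, w)" "q' = (x', w')" by (cases q; cases q')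
    have x: "x \<in> topspace S" "x' \<in> topspace S" "norm w = 1" "norm w' = 1" using q by (auto simp: xw)
    have kk: "k' (k x) = x" "k' (k x') = x'" using k x by (auto simp: homeomorphic_maps_def)
    have refl: "surface_reflection (k x) \<in> topspace (surface.glued n)"
      using continuous_surface_reflection k_in[OF x(1)] by (auto simp: continuous_map_def)
    then have "k (k' (surface_reflection (k x))) = surface_reflection (k x)"
      using k by (auto simp: homeomorphic_maps_def)
    then have eq: "k x' = surface_reflection (k x) \<longleftrightarrow> x' = k' (surface_reflection (k x))"
      using kk by metis
    have eq1: "k x' = k x \<longleftrightarrow> x' = x" using kk by metis
    have "F q = F q' \<longleftrightarrow> (k x', w') = (k x, w) \<or> (k x', w') = (surface_reflection (k x), cnj w)"
      using fibre_f[of "(k x, w)" "(k x', w')"] k_in x by (simp add: F_def xw surface_reflection_def)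
    then show "F q = F q' \<longleftrightarrow> q' = q \<or> q' = ((k' \<circ> surface_reflection \<circ> k) (fst q), cnj (snd q))"
      by (simp only: xw prod.inject eq eq1 comp_apply fst_conv snd_conv)
  qed
  show ?thesis unfolding tgt_eq using branched_cover by blast
qed

end
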